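(* Let $n\ge1$, let $(M^{2n+1},\eta,H)$ be a smooth autonomous contact Hamiltonian system, with $X=X_H$, $a=R(H)$ and $\mu=\eta\wedge(d\eta)^n$. Let $\Phi:M\to M$ be a contact canonoid transformation for it, let $K=-(\Phi^*\eta)(X)$, and define the nonvanishing function $\rho$ by $\Phi^*\mu=\rho\mu$. Then the one-form $$\beta=|\rho|^{-1/(n+1)}\,\Phi^*\eta$$ satisfies $\mathcal L_X\beta=-a\beta$. In particular, the function $$J_\Phi=\frac{K}{|\rho|^{1/(n+1)}}$$ is dissipated on $M$, i.e. $X(J_\Phi)=-aJ_\Phi$, and the function $$I_\Phi=\frac{K}{H|\rho|^{1/(n+1)}},$$ defined on $\{H\neq0\}$, is conserved, i.e. $X(I_\Phi)=0$. Furthermore, the coefficients $C_1,\dots,C_{n+1}$ defined by $$(\eta+t\beta)\wedge(d\eta+t\,d\beta)^n=\Bigl(1+\sum_{j=1}^{n+1}C_jt^j\Bigr)\mu$$ for this $\beta$ are conserved, $X(C_j)=0$, without requiring $H\neq0$.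
   Context: A contact Hamiltonian system $(M^{2n+1},\eta,H)$ is a smooth manifold $M$ of dimension $2n+1$ with a contact form $\eta$ (i.e. $\eta\wedge(d\eta)^n$ is nowhere zero) and a smooth function $H$. The Reeb vector field $R$ is defined by $\eta(R)=1$, $\iota_Rd\eta=0$. The contact Hamiltonian vector field $X_H$ is defined by the convention $\eta(X_H)=-H$, $\iota_{X_H}d\eta=dH-R(H)\eta$. A smooth map $\Phi:M\to M$ is a contact canonoid map for $(M,\eta,H)$ if there exists $b\in C^\infty(M)$ with $\mathcal L_{X_H}(\Phi^*\eta)=-b\,\Phi^*\eta$. A contact canonoid transformation is a contact canonoid map that is a local diffeomorphism. *)

theory Defs
  imports "HOL-Analysis.Analysis"
begin

section \<open>Smooth functions between Euclidean spaces\<close>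

text \<open>Both notions are meant for open \<open>S\<close> only.\<close>

primrec Ck_on :: "nat \<Rightarrow> 'a::euclidean_space set \<Rightarrow> ('a \<Rightarrow> 'b::real_normed_vector) \<Rightarrow> bool" where
  "Ck_on 0 S f \<longleftrightarrow> continuous_on S f"
| "Ck_on (Suc k) S f \<longleftrightarrow>
     f differentiable_on S \<and> (\<forall>v. Ck_on k S (\<lambda>x. frechet_derivative f (at x) v))"

definition smooth_on :: "'a::euclidean_space set \<Rightarrow> ('a \<Rightarrow> 'b::real_normed_vector) \<Rightarrow> bool" where
  "smooth_on S f \<longleftrightarrow> (\<forall>k. Ck_on k S f)"


section \<open>Smooth manifolds\<close>

text \<open>A chart is a pair of its domain and its coordinate map; the values of the coordinate map
  outside the domain are irrelevant. The dimension of the manifold is \<open>DIM('e)\<close>. The atlas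
  need not be maximal.\<close>

type_synonym ('m, 'e) chart = "'m set \<times> ('m \<Rightarrow> 'e)"

record ('m, 'e) manifold =
  topo :: "'m topology"
  atlas :: "('m, 'e) chart set"

definition points :: "('m, 'e) manifold \<Rightarrow> 'm set" where
  "points M = topspace (topo M)"

definition chart_inv :: "('m, 'e) chart \<Rightarrow> 'e \<Rightarrow> 'm" where
  "chart_inv c = inv_into (fst c) (snd c)"

definition is_chart :: "'m topology \<Rightarrow> ('m, 'e::euclidean_space) chart \<Rightarrow> bool" where
  "is_chart T c \<longleftrightarrow>
     openin T (fst c) \<and> open (snd c ` fst c) \<and>
     homeomorphic_map (subtopology T (fst c)) (top_of_set (snd c ` fst c)) (snd c)"

definition transition :: "('m, 'e) chart \<Rightarrow> ('m, 'e) chart \<Rightarrow> 'e \<Rightarrow> 'e" where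
  "transition c c' = snd c' \<circ> chart_inv c"

definition smooth_manifold :: "('m, 'e::euclidean_space) manifold \<Rightarrow> bool" where
  "smooth_manifold M \<longleftrightarrow>
     Hausdorff_space (topo M) \<and> second_countable (topo M) \<and>
     (\<forall>c\<in>atlas M. is_chart (topo M) c) \<and>
     (\<Union>c\<in>atlas M. fst c) = points M \<and>
     (\<forall>c\<in>atlas M. \<forall>c'\<in>atlas M. smooth_on (snd c ` (fst c \<inter> fst c')) (transition c c'))"

definition charts_at :: "('m, 'e) manifold \<Rightarrow> 'm \<Rightarrow> ('m, 'e) chart set" where
  "charts_at M p = {c \<in> atlas M. p \<in> fst c}"

text \<open>Used only where the result does not depend on the chosen chart.\<close>

definition some_chart :: "('m, 'e) manifold \<Rightarrow> 'm \<Rightarrow> ('m, 'e) chart" where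
  "some_chart M p = (SOME c. c \<in> charts_at M p)"

definition smooth_fun_on ::
  "('m, 'e::euclidean_space) manifold \<Rightarrow> 'm set \<Rightarrow> ('m \<Rightarrow> real) \<Rightarrow> bool" where
  "smooth_fun_on M U f \<longleftrightarrow>
     (\<forall>c\<in>atlas M. smooth_on (snd c ` (fst c \<inter> U)) (f \<circ> chart_inv c))"

definition smooth_map_on ::
  "('m, 'e::euclidean_space) manifold \<Rightarrow> ('k, 'f::euclidean_space) manifold \<Rightarrow>
    'm set \<Rightarrow> ('m \<Rightarrow> 'k) \<Rightarrow> bool" where
  "smooth_map_on M N U \<Phi> \<longleftrightarrow>
     continuous_map (subtopology (topo M) U) (topo N) \<Phi> \<and>
     (\<forall>c\<in>atlas M. \<forall>c'\<in>atlas N.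
        smooth_on (snd c ` (fst c \<inter> U \<inter> \<Phi> -` fst c')) (snd c' \<circ> \<Phi> \<circ> chart_inv c))"

definition local_diffeo ::
  "('m, 'e::euclidean_space) manifold \<Rightarrow> ('k, 'f::euclidean_space) manifold \<Rightarrow>
    ('m \<Rightarrow> 'k) \<Rightarrow> bool" where
  "local_diffeo M N \<Phi> \<longleftrightarrow>
     (\<forall>p\<in>points M. \<exists>U. p \<in> U \<and> openin (topo M) U \<and> openin (topo N) (\<Phi> ` U) \<and> inj_on \<Phi> U \<and>
        smooth_map_on M N U \<Phi> \<and> smooth_map_on N M (\<Phi> ` U) (inv_into U \<Phi>))"


section \<open>Tangent vectors and vector fields\<close>

text \<open>A tangent vector at \<open>p\<close> is the family of its components in the charts around \<open>p\<close>, related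
  by the derivatives of the transition maps. Components in charts that do not contain \<open>p\<close> are set
  to \<open>0\<close>, so that equality of tangent vectors is equality of functions; the vector space structure
  is the pointwise one.\<close>

type_synonym ('m, 'e) tvec = "('m, 'e) chart \<Rightarrow> 'e"

definition tangent_space ::
  "('m, 'e::euclidean_space) manifold \<Rightarrow> 'm \<Rightarrow> ('m, 'e) tvec set" where
  "tangent_space M p =
     {v. (\<forall>c\<in>charts_at M p. \<forall>c'\<in>charts_at M p.
            v c' = frechet_derivative (transition c c') (at (snd c p)) (v c)) \<and>
         (\<forall>c. c \<notin> charts_at M p \<longrightarrow> v c = 0)}"

definition tangent_lists ::
  "('m, 'e::euclidean_space) manifold \<Rightarrow> 'm \<Rightarrow> nat \<Rightarrow> ('m, 'e) tvec list set" where
  "tangent_lists M p k = {vs. length vs = k \<and> set vs \<subseteq> tangent_space M p}"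

text \<open>The tangent vector at \<open>p\<close> whose components in the chart \<open>c\<close> are \<open>w\<close>.\<close>

definition coord_tvec ::
  "('m, 'e::euclidean_space) manifold \<Rightarrow> ('m, 'e) chart \<Rightarrow> 'm \<Rightarrow> 'e \<Rightarrow> ('m, 'e) tvec" where
  "coord_tvec M c p w =
     (\<lambda>c'. if c' \<in> charts_at M p
           then frechet_derivative (transition c c') (at (snd c p)) w else 0)"

definition smooth_vector_field ::
  "('m, 'e::euclidean_space) manifold \<Rightarrow> ('m \<Rightarrow> ('m, 'e) tvec) \<Rightarrow> bool" where
  "smooth_vector_field M X \<longleftrightarrow>
     (\<forall>p\<in>points M. X p \<in> tangent_space M p) \<and>
     (\<forall>c\<in>atlas M. smooth_on (snd c ` fst c) (\<lambda>x. X (chart_inv c x) c))"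

definition tangent_map ::
  "('m, 'e::euclidean_space) manifold \<Rightarrow> ('k, 'f::euclidean_space) manifold \<Rightarrow>
    ('m \<Rightarrow> 'k) \<Rightarrow> 'm \<Rightarrow> ('m, 'e) tvec \<Rightarrow> ('k, 'f) tvec" where
  "tangent_map M N \<Phi> p v =
     (\<lambda>c'. if c' \<in> charts_at N (\<Phi> p)
           then let c = some_chart M p in
             frechet_derivative (snd c' \<circ> \<Phi> \<circ> chart_inv c) (at (snd c p)) (v c)
           else 0)"


section \<open>Differential forms\<close>

text \<open>A \<open>k\<close>-form takes a point and a list of \<open>k\<close> tangent vectors at that point; its values on
  other arguments are irrelevant, hence equality of forms is \<open>form_eq\<close>.\<close>

type_synonym ('m, 'e) form = "'m \<Rightarrow> ('m, 'e) tvec list \<Rightarrow> real"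

definition form_eq ::
  "('m, 'e::euclidean_space) manifold \<Rightarrow> nat \<Rightarrow> ('m, 'e) form \<Rightarrow> ('m, 'e) form \<Rightarrow> bool" where
  "form_eq M k \<omega> \<omega>' \<longleftrightarrow> (\<forall>p\<in>points M. \<forall>vs\<in>tangent_lists M p k. \<omega> p vs = \<omega>' p vs)"

definition fun_form :: "('m \<Rightarrow> real) \<Rightarrow> ('m, 'e) form" where
  "fun_form f = (\<lambda>p vs. if vs = [] then f p else 0)"

definition form_add :: "('m, 'e) form \<Rightarrow> ('m, 'e) form \<Rightarrow> ('m, 'e) form" where
  "form_add \<omega> \<omega>' = (\<lambda>p vs. \<omega> p vs + \<omega>' p vs)"

definition form_scale :: "('m \<Rightarrow> real) \<Rightarrow> ('m, 'e) form \<Rightarrow> ('m, 'e) form" where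
  "form_scale f \<omega> = (\<lambda>p vs. f p * \<omega> p vs)"

definition coord_form ::
  "('m, 'e::euclidean_space) manifold \<Rightarrow> ('m, 'e) chart \<Rightarrow> ('m, 'e) form \<Rightarrow>
    'e \<Rightarrow> 'e list \<Rightarrow> real" where
  "coord_form M c \<omega> x ws =
     \<omega> (chart_inv c x) (map (coord_tvec M c (chart_inv c x)) ws)"

definition smooth_form ::
  "('m, 'e::euclidean_space) manifold \<Rightarrow> nat \<Rightarrow> ('m, 'e) form \<Rightarrow> bool" where
  "smooth_form M k \<omega> \<longleftrightarrow>
     (\<forall>p\<in>points M. \<forall>vs\<in>tangent_lists M p k.
        (\<forall>i<k. \<forall>u\<in>tangent_space M p. \<forall>w\<in>tangent_space M p. \<forall>r s.
           \<omega> p (vs[i := (\<lambda>c. r *\<^sub>R u c + s *\<^sub>R w c)]) = r * \<omega> p (vs[i := u]) + s * \<omega> p (vs[i := w])) \<and>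
        (\<forall>i<k. \<forall>j<k. i \<noteq> j \<and> vs ! i = vs ! j \<longrightarrow> \<omega> p vs = 0)) \<and>
     (\<forall>c\<in>atlas M. \<forall>ws. length ws = k \<longrightarrow> smooth_on (snd c ` fst c) (\<lambda>x. coord_form M c \<omega> x ws))"

text \<open>The convention without a factor \<open>1 / (k + 1)\<close>: for a \<open>1\<close>-form, \<open>ext_deriv\<close> is
  \<open>D\<omega>(v\<^sub>0)(v\<^sub>1) - D\<omega>(v\<^sub>1)(v\<^sub>0)\<close> in coordinates.\<close>

definition ext_deriv :: "('m, 'e::euclidean_space) manifold \<Rightarrow> ('m, 'e) form \<Rightarrow> ('m, 'e) form" where
  "ext_deriv M \<omega> = (\<lambda>p vs. let c = some_chart M p in
     \<Sum>i<length vs. (-1) ^ i *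
       frechet_derivative
         (\<lambda>x. coord_form M c \<omega> x (map (\<lambda>v. v c) (take i vs @ drop (Suc i) vs)))
         (at (snd c p)) ((vs ! i) c))"

text \<open>The wedge product of a \<open>k\<close>-form and an \<open>l\<close>-form, normalised so that
  \<open>(\<alpha> \<and> \<beta>)(v, w) = \<alpha>(v) \<beta>(w) - \<alpha>(w) \<beta>(v)\<close> for \<open>1\<close>-forms.\<close>

definition wedge :: "nat \<Rightarrow> nat \<Rightarrow> ('m, 'e) form \<Rightarrow> ('m, 'e) form \<Rightarrow> ('m, 'e) form" where
  "wedge k l \<alpha> \<beta> = (\<lambda>p vs.
     (\<Sum>\<sigma> | \<sigma> permutes {..<k + l}. of_int (sign \<sigma>) *
        \<alpha> p (map (\<lambda>i. vs ! \<sigma> i) [0..<k]) * \<beta> p (map (\<lambda>i. vs ! \<sigma> i) [k..<k + l]))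
     / (fact k * fact l))"

primrec wedge_power :: "nat \<Rightarrow> ('m, 'e) form \<Rightarrow> nat \<Rightarrow> ('m, 'e) form" where
  "wedge_power k \<omega> 0 = fun_form (\<lambda>_. 1)"
| "wedge_power k \<omega> (Suc n) = wedge k (k * n) \<omega> (wedge_power k \<omega> n)"

definition interior_prod :: "('m \<Rightarrow> ('m, 'e) tvec) \<Rightarrow> ('m, 'e) form \<Rightarrow> ('m, 'e) form" where
  "interior_prod X \<omega> = (\<lambda>p vs. \<omega> p (X p # vs))"

text \<open>The Lie derivative, by Cartan's formula.\<close>

definition lie_deriv ::
  "('m, 'e::euclidean_space) manifold \<Rightarrow> ('m \<Rightarrow> ('m, 'e) tvec) \<Rightarrow> ('m, 'e) form \<Rightarrow> ('m, 'e) form" where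
  "lie_deriv M X \<omega> =
     form_add (interior_prod X (ext_deriv M \<omega>)) (ext_deriv M (interior_prod X \<omega>))"

text \<open>The derivative \<open>X(f) = df(X)\<close>.\<close>

definition vf_app ::
  "('m, 'e::euclidean_space) manifold \<Rightarrow> ('m \<Rightarrow> ('m, 'e) tvec) \<Rightarrow> ('m \<Rightarrow> real) \<Rightarrow> 'm \<Rightarrow> real" where
  "vf_app M X f = (\<lambda>p. ext_deriv M (fun_form f) p [X p])"

definition pullback ::
  "('m, 'e::euclidean_space) manifold \<Rightarrow> ('k, 'f::euclidean_space) manifold \<Rightarrow>
    ('m \<Rightarrow> 'k) \<Rightarrow> ('k, 'f) form \<Rightarrow> ('m, 'e) form" where
  "pullback M N \<Phi> \<omega> = (\<lambda>p vs. \<omega> (\<Phi> p) (map (tangent_map M N \<Phi> p) vs))"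


section \<open>Contact Hamiltonian systems\<close>

text \<open>\<open>contact_vol n \<alpha> \<tau>\<close> is \<open>\<alpha> \<and> \<tau>\<^sup>n\<close> for a \<open>1\<close>-form \<open>\<alpha>\<close> and a \<open>2\<close>-form \<open>\<tau>\<close>.\<close>

definition contact_vol :: "nat \<Rightarrow> ('m, 'e) form \<Rightarrow> ('m, 'e) form \<Rightarrow> ('m, 'e) form" where
  "contact_vol n \<alpha> \<tau> = wedge 1 (2 * n) \<alpha> (wedge_power 2 \<tau> n)"

definition contact_form ::
  "('m, 'e::euclidean_space) manifold \<Rightarrow> nat \<Rightarrow> ('m, 'e) form \<Rightarrow> bool" where
  "contact_form M n \<eta> \<longleftrightarrow> smooth_form M 1 \<eta> \<and>
     (\<forall>p\<in>points M. \<exists>vs\<in>tangent_lists M p (2 * n + 1).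
        contact_vol n \<eta> (ext_deriv M \<eta>) p vs \<noteq> 0)"

definition contact_hamiltonian_system ::
  "('m, 'e::euclidean_space) manifold \<Rightarrow> nat \<Rightarrow> ('m, 'e) form \<Rightarrow> ('m \<Rightarrow> real) \<Rightarrow> bool" where
  "contact_hamiltonian_system M n \<eta> H \<longleftrightarrow>
     smooth_manifold M \<and> DIM('e) = 2 * n + 1 \<and> contact_form M n \<eta> \<and>
     smooth_fun_on M (points M) H"

definition reeb_field ::
  "('m, 'e::euclidean_space) manifold \<Rightarrow> ('m, 'e) form \<Rightarrow> ('m \<Rightarrow> ('m, 'e) tvec) \<Rightarrow> bool" where
  "reeb_field M \<eta> R \<longleftrightarrow> smooth_vector_field M R \<and>
     (\<forall>p\<in>points M. \<eta> p [R p] = 1) \<and>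
     form_eq M 1 (interior_prod R (ext_deriv M \<eta>)) (\<lambda>p vs. 0)"

definition contact_hamiltonian_field ::
  "('m, 'e::euclidean_space) manifold \<Rightarrow> ('m, 'e) form \<Rightarrow> ('m \<Rightarrow> ('m, 'e) tvec) \<Rightarrow>
    ('m \<Rightarrow> real) \<Rightarrow> ('m \<Rightarrow> ('m, 'e) tvec) \<Rightarrow> bool" where
  "contact_hamiltonian_field M \<eta> R H X \<longleftrightarrow> smooth_vector_field M X \<and>
     (\<forall>p\<in>points M. \<eta> p [X p] = - H p) \<and>
     form_eq M 1 (interior_prod X (ext_deriv M \<eta>))
       (form_add (ext_deriv M (fun_form H)) (form_scale (\<lambda>p. - vf_app M R H p) \<eta>))"

text \<open>Here \<open>X\<close> is the contact Hamiltonian vector field of the system.\<close>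

definition contact_canonoid_map ::
  "('m, 'e::euclidean_space) manifold \<Rightarrow> ('m, 'e) form \<Rightarrow> ('m \<Rightarrow> ('m, 'e) tvec) \<Rightarrow>
    ('m \<Rightarrow> 'm) \<Rightarrow> bool" where
  "contact_canonoid_map M \<eta> X \<Phi> \<longleftrightarrow> smooth_map_on M M (points M) \<Phi> \<and>
     (\<exists>b. smooth_fun_on M (points M) b \<and>
        form_eq M 1 (lie_deriv M X (pullback M M \<Phi> \<eta>))
          (form_scale (\<lambda>p. - b p) (pullback M M \<Phi> \<eta>)))"

definition contact_canonoid_transformation ::
  "('m, 'e::euclidean_space) manifold \<Rightarrow> ('m, 'e) form \<Rightarrow> ('m \<Rightarrow> ('m, 'e) tvec) \<Rightarrow>
    ('m \<Rightarrow> 'm) \<Rightarrow> bool" where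
  "contact_canonoid_transformation M \<eta> X \<Phi> \<longleftrightarrow>
     contact_canonoid_map M \<eta> X \<Phi> \<and> local_diffeo M M \<Phi>"

text \<open>The functions \<open>C\<^sub>1, \<dots>, C\<^sub>n\<^sub>+\<^sub>1\<close> are the coefficients of the pencil \<open>\<eta> + t\<beta>\<close>.\<close>

definition pencil_coeffs ::
  "('m, 'e::euclidean_space) manifold \<Rightarrow> nat \<Rightarrow> ('m, 'e) form \<Rightarrow> ('m, 'e) form \<Rightarrow>
    (nat \<Rightarrow> 'm \<Rightarrow> real) \<Rightarrow> bool" where
  "pencil_coeffs M n \<eta> \<beta> C \<longleftrightarrow> (\<forall>t::real. form_eq M (2 * n + 1)
     (contact_vol n (form_add \<eta> (form_scale (\<lambda>_. t) \<beta>))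
        (form_add (ext_deriv M \<eta>) (form_scale (\<lambda>_. t) (ext_deriv M \<beta>))))
     (form_scale (\<lambda>p. 1 + (\<Sum>j=1..n+1. C j p * t ^ j)) (contact_vol n \<eta> (ext_deriv M \<eta>))))"

end

theory Submission
  imports Defs
begin

text \<open>Put \<open>\<theta> = \<Phi>\<^sup>*\<eta>\<close>, so that \<open>L\<^sub>X \<theta> = - b \<theta>\<close> and \<open>L\<^sub>X \<eta> = - a \<eta>\<close>. If \<open>L\<^sub>X \<alpha> = - f \<alpha>\<close>, then
  \<open>L\<^sub>X d\<alpha> = - f d\<alpha> - df \<and> \<alpha>\<close>, and the second term is killed by the wedge with \<open>\<alpha>\<close>, so
  \<open>\<alpha> \<and> (d\<alpha>)\<^sup>n\<close> is scaled by \<open>- (n + 1) f\<close>. Comparing this for \<open>\<theta>\<close> and \<open>\<eta>\<close> gives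
  \<open>X(\<rho>) = (n + 1) (a - b) \<rho>\<close>, which is what makes the factor of \<open>\<beta>\<close> turn \<open>b\<close> into \<open>a\<close>.
  The functions \<open>J\<close> and \<open>I\<close> are contractions of \<open>\<beta>\<close> with \<open>X\<close>. For the pencil, the same comparison of
  \<open>\<eta> + t \<beta>\<close> with \<open>\<eta>\<close> shows that the polynomial in \<open>t\<close> is conserved for each \<open>t\<close>, and its coefficients are
  linear combinations of its values.

  No Lie derivative of a volume form is needed: a quotient of two top-degree forms is invariant under
  linear maps, so it suffices to differentiate such quotients in coordinates.\<close>

section \<open>Calculus of smooth functions\<close>

text \<open>The number \<open>n + 1\<close> is the weight of the contact volume: one factor for
  \<open>\<alpha>\<close> and one for each of the \<open>n\<close> copies of
  \<open>d\<alpha>\<close>. It returns in the exponent of \<open>|\<rho>|\<close>, chosen so that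
  the derivative of that power along \<open>X\<close> is \<open>b - a\<close> times the power, and
  in the degree of the pencil polynomial.

  Flows are avoided. In a chart, the map \<open>1 - s DX\<close> stands in for the inverse
  differential of the flow at time \<open>s\<close>, and only derivatives at \<open>s = 0\<close>
  are compared. What this map contributes to the derivative of a volume (the divergence of
  \<open>X\<close>) is common to both volumes and cancels in the quotient, so it is never computed.
  Nor is the derivative of a wedge power: two curves of forms with equal value and derivative at 0
  have volumes with equal derivative.

  The differential of \<open>\<Phi>\<close> being onto enters through
  \<open>\<rho> \<noteq> 0\<close>. Zeros of \<open>H\<close> matter only for \<open>I\<close>: the
  laws for \<open>H\<close> and \<open>J\<close> both come from contracting a one-form with
  \<open>X\<close>, and \<open>I\<close> is their quotient.\<close>

lemma Ck_on_cong:
  assumes "open S" "\<And>x. x \<in> S \<Longrightarrow> f x = g x"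
  shows "Ck_on k S f \<longleftrightarrow> Ck_on k S g"
  using assms(2)
proof (induction k arbitrary: f g)
  case 0
  then show ?case by (simp cong: continuous_on_cong)
next
  case (Suc k)
  have 1: "f differentiable_on S \<longleftrightarrow> g differentiable_on S"
    using Suc.prems by (auto simp: differentiable_on_def intro: differentiable_transform_within[OF _ zero_less_one])
  have "Ck_on k S (\<lambda>x. frechet_derivative f (at x) v) \<longleftrightarrow> Ck_on k S (\<lambda>x. frechet_derivative g (at x) v)"
    if "f differentiable_on S" for v
  proof (rule Suc.IH)
    fix x assume x: "x \<in> S"
    then have "f differentiable at x"
      using that assms(1) by (simp add: differentiable_on_eq_differentiable_at)
    then show "frechet_derivative f (at x) v = frechet_derivative g (at x) v"
      using frechet_derivative_transform_within_open[OF _ assms(1) x] Suc.prems by metis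
  qed
  with 1 show ?case by auto
qed

lemma Ck_on_subset: "Ck_on k S f \<Longrightarrow> T \<subseteq> S \<Longrightarrow> Ck_on k T f"
  by (induction k arbitrary: f) (auto intro: continuous_on_subset differentiable_on_subset)

lemma Ck_on_Suc_imp: "Ck_on (Suc k) S f \<Longrightarrow> Ck_on k S f"
  by (induction k arbitrary: f) (auto intro: differentiable_imp_continuous_on)

lemma Ck_on_SucD: "Ck_on (Suc k) S f \<Longrightarrow> open S \<Longrightarrow> x \<in> S \<Longrightarrow> 
    (f has_derivative frechet_derivative f (at x)) (at x)"
  by (simp add: differentiable_on_eq_differentiable_at frechet_derivative_works)

lemma Ck_on_SucI:
  assumes "open S" "\<And>x. x \<in> S \<Longrightarrow> (f has_derivative f' x) (at x)"
    "\<And>v. Ck_on k S (\<lambda>x. f' x v)"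
  shows "Ck_on (Suc k) S f"
proof -
  have "f differentiable_on S"
    using assms by (auto simp: differentiable_on_eq_differentiable_at differentiable_def)
  moreover have "Ck_on k S (\<lambda>x. frechet_derivative f (at x) v)" for v
    using Ck_on_cong[OF assms(1), of "\<lambda>x. f' x v" "\<lambda>x. frechet_derivative f (at x) v" k]
      assms(2,3) by (metis frechet_derivative_at)
  ultimately show ?thesis by simp
qed

text \<open>Needed for pullbacks, whose smoothness is visible only on the preimage of one target
  chart at a time.\<close>

lemma Ck_on_local:
  assumes "open S" "\<And>x. x \<in> S \<Longrightarrow> \<exists>T. open T \<and> x \<in> T \<and> Ck_on k T f"
  shows "Ck_on k S f"
  using assms(2)
proof (induction k arbitrary: f)
  case 0
  have "isCont f x" if "x \<in> S" for x
    using 0[OF that] by (auto simp: continuous_on_eq_continuous_at)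
  then show ?case by (simp add: assms(1) continuous_on_eq_continuous_at)
next
  case (Suc k)
  have "f differentiable at x" if "x \<in> S" for x
    using Suc.prems[OF that] by (auto simp: differentiable_on_eq_differentiable_at)
  moreover have "Ck_on k S (\<lambda>x. frechet_derivative f (at x) v)" for v
    by (rule Suc.IH) (use Suc.prems in force)
  ultimately show ?case
    by (simp add: assms(1) differentiable_on_eq_differentiable_at)
qed

lemma Ck_on_const [simp]: "Ck_on k S (\<lambda>x. c)"
  by (induction k arbitrary: c) auto

lemma Ck_on_bounded_linear:
  assumes "bounded_linear L" "open S"
  shows "Ck_on k S f \<Longrightarrow> Ck_on k S (\<lambda>x. L (f x))"
proof (induction k arbitrary: f)
  case 0
  then show ?case by (simp add: assms bounded_linear.continuous_on)
next
  case (Suc k)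
  show ?case
    by (rule Ck_on_SucI[where f' = "\<lambda>x v. L (frechet_derivative f (at x) v)"])
      (use Suc assms Ck_on_SucD[OF Suc.prems] in \<open>auto intro: bounded_linear.has_derivative\<close>)
qed

lemma Ck_on_add:
  assumes "open S"
  shows "Ck_on k S f \<Longrightarrow> Ck_on k S g \<Longrightarrow> Ck_on k S (\<lambda>x. f x + g x)"
proof (induction k arbitrary: f g)
  case 0
  then show ?case by (simp add: continuous_on_add)
next
  case (Suc k)
  show ?case
    by (rule Ck_on_SucI[where f' = "\<lambda>x v. frechet_derivative f (at x) v + frechet_derivative g (at x) v"])
      (use Suc assms Ck_on_SucD[OF Suc.prems(1)] Ck_on_SucD[OF Suc.prems(2)] in
        \<open>auto intro: has_derivative_add\<close>)
qed

lemma Ck_on_sum: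
  assumes "open S" "\<And>i. i \<in> I \<Longrightarrow> Ck_on k S (f i)"
  shows "Ck_on k S (\<lambda>x. \<Sum>i\<in>I. f i x)"
  using assms(2) by (induction I rule: infinite_finite_induct) (auto intro: Ck_on_add assms(1))

lemma Ck_on_bounded_bilinear:
  assumes "bounded_bilinear B" "open S"
  shows "Ck_on k S f \<Longrightarrow> Ck_on k S g \<Longrightarrow> Ck_on k S (\<lambda>x. B (f x) (g x))"
proof (induction k arbitrary: f g)
  case 0
  then show ?case by (simp add: assms bounded_bilinear.continuous_on)
next
  case (Suc k)
  show ?case
  proof (rule Ck_on_SucI[OF assms(2)])
    show "((\<lambda>x. B (f x) (g x)) has_derivative (\<lambda>v. B (f x) (frechet_derivative g (at x) v) +
        B (frechet_derivative f (at x) v) (g x))) (at x)" if "x \<in> S" for x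
      by (rule bounded_bilinear.FDERIV[OF assms(1) Ck_on_SucD[OF Suc.prems(1) assms(2) that]
          Ck_on_SucD[OF Suc.prems(2) assms(2) that]])
    show "Ck_on k S (\<lambda>x. B (f x) (frechet_derivative g (at x) v) +
        B (frechet_derivative f (at x) v) (g x))" for v
      using Ck_on_Suc_imp[OF Suc.prems(1)] Ck_on_Suc_imp[OF Suc.prems(2)] Suc.prems
      by (intro Ck_on_add assms(2) Suc.IH) auto
  qed
qed

text \<open>\<open>Ck_on\<close> speaks only of derivatives in fixed directions. Expanding a varying
  direction in the basis reduces it to finitely many fixed ones.\<close>

lemma linear_Basis_expand:
  fixes h :: "'a::euclidean_space \<Rightarrow> 'b::real_vector"
  assumes "linear h"
  shows "h w = (\<Sum>b\<in>Basis. (w \<bullet> b) *\<^sub>R h b)"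
proof -
  have "h w = h (\<Sum>b\<in>Basis. (w \<bullet> b) *\<^sub>R b)" by (simp add: euclidean_representation)
  also have "\<dots> = (\<Sum>b\<in>Basis. (w \<bullet> b) *\<^sub>R h b)"
    by (simp only: linear_sum[OF assms] linear_scale[OF assms])
  finally show ?thesis .
qed

text \<open>The chain rule differentiates \<open>g\<close> in a direction that moves with
  \<open>x\<close>. Expanded in the basis, this is a sum of products of a derivative of
  \<open>f\<close> with a fixed-direction derivative of \<open>g\<close> composed with
  \<open>f\<close>, and the induction hypothesis applies to the latter.\<close>

lemma Ck_on_compose:
  fixes g :: "'b::euclidean_space \<Rightarrow> 'c::real_normed_vector"
  assumes "open S" "open T"
  shows "Ck_on k T g \<Longrightarrow> Ck_on k S f \<Longrightarrow> f ` S \<subseteq> T \<Longrightarrow> Ck_on k S (\<lambda>x. g (f x))"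
proof (induction k arbitrary: f g)
  case 0
  then show ?case by (auto intro: continuous_on_compose2)
next
  case (Suc k)
  let ?D = frechet_derivative
  show ?case
  proof (rule Ck_on_SucI[OF assms(1)])
    fix x assume x: "x \<in> S"
    have g: "(g has_derivative ?D g (at (f x))) (at (f x))"
      using Ck_on_SucD[OF Suc.prems(1) assms(2)] Suc.prems(3) x by blast
    have "((\<lambda>x. g (f x)) has_derivative (\<lambda>v. ?D g (at (f x)) (?D f (at x) v))) (at x)"
      using diff_chain_at[OF Ck_on_SucD[OF Suc.prems(2) assms(1) x] g] by (simp add: o_def)
    moreover have "(\<lambda>v. ?D g (at (f x)) (?D f (at x) v)) =
        (\<lambda>v. \<Sum>b\<in>Basis. (?D f (at x) v \<bullet> b) *\<^sub>R ?D g (at (f x)) b)"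
      by (intro ext linear_Basis_expand[OF has_derivative_linear[OF g]])
    ultimately show "((\<lambda>x. g (f x)) has_derivative
      (\<lambda>v. \<Sum>b\<in>Basis. (?D f (at x) v \<bullet> b) *\<^sub>R ?D g (at (f x)) b)) (at x)"
      by (simp only:)
  next
    fix v
    show "Ck_on k S (\<lambda>x. \<Sum>b\<in>Basis. (?D f (at x) v \<bullet> b) *\<^sub>R ?D g (at (f x)) b)"
    proof (intro Ck_on_sum assms(1) Ck_on_bounded_bilinear[OF bounded_bilinear_scaleR])
      fix b :: 'b
      show "Ck_on k S (\<lambda>x. ?D f (at x) v \<bullet> b)"
        using Suc.prems(2) by (intro Ck_on_bounded_linear[OF bounded_linear_inner_left] assms) auto
      show "Ck_on k S (\<lambda>x. ?D g (at (f x)) b)"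
        using Suc.prems Ck_on_Suc_imp[OF Suc.prems(2)] by (intro Suc.IH) auto
    qed
  qed
qed

lemma Ck_on_powr: "Ck_on k {0<..} (\<lambda>x::real. x powr s)"
proof (induction k arbitrary: s)
  case 0
  show ?case by (auto intro!: continuous_intros)
next
  case (Suc k)
  show ?case
  proof (rule Ck_on_SucI)
    show "((\<lambda>x. x powr s) has_derivative (\<lambda>v. (s * v) * x powr (s - 1))) (at x)"
      if "x \<in> {0<..}" for x
    proof -
      have "(\<lambda>v. (s * v) * x powr (s - 1)) = (*) (s * x powr (s - 1))"
        by (simp add: fun_eq_iff)
      then show ?thesis
        using has_real_derivative_powr[of x s] that by (simp add: has_field_derivative_def)
    qed
    show "Ck_on k {0<..} (\<lambda>x. (s * v) * x powr (s - 1))" for v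
      by (rule Ck_on_bounded_bilinear[OF bounded_bilinear_mult]) (use Suc in auto)
  qed auto
qed

section \<open>Closure properties of smooth functions\<close>

lemma smooth_on_cong:
  "open S \<Longrightarrow> (\<And>x. x \<in> S \<Longrightarrow> f x = g x) \<Longrightarrow> smooth_on S f \<longleftrightarrow> smooth_on S g"
  unfolding smooth_on_def using Ck_on_cong by blast

lemma smooth_on_subset: "smooth_on S f \<Longrightarrow> T \<subseteq> S \<Longrightarrow> smooth_on T f"
  unfolding smooth_on_def using Ck_on_subset by blast

lemma smooth_on_local:
  assumes "open S" "\<And>x. x \<in> S \<Longrightarrow> \<exists>T. open T \<and> x \<in> T \<and> smooth_on T f"
  shows "smooth_on S f"
  unfolding smooth_on_def
proof
  fix k show "Ck_on k S f"
    by (rule Ck_on_local[OF assms(1)]) (use assms(2) in \<open>auto simp: smooth_on_def\<close>)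
qed

lemma smooth_on_const [simp]: "smooth_on S (\<lambda>x. c)"
  by (simp add: smooth_on_def)

lemma smooth_on_add: "open S \<Longrightarrow> smooth_on S f \<Longrightarrow> smooth_on S g \<Longrightarrow> smooth_on S (\<lambda>x. f x + g x)"
  by (simp add: smooth_on_def Ck_on_add)

lemma smooth_on_sum:
  "open S \<Longrightarrow> (\<And>i. i \<in> I \<Longrightarrow> smooth_on S (f i)) \<Longrightarrow> smooth_on S (\<lambda>x. \<Sum>i\<in>I. f i x)"
  by (simp add: smooth_on_def Ck_on_sum)

lemma smooth_on_mult:
  fixes f g :: "'a::euclidean_space \<Rightarrow> real"
  shows "open S \<Longrightarrow> smooth_on S f \<Longrightarrow> smooth_on S g \<Longrightarrow> smooth_on S (\<lambda>x. f x * g x)"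
  by (simp add: smooth_on_def Ck_on_bounded_bilinear[OF bounded_bilinear_mult])

lemma smooth_on_scaleR:
  "open S \<Longrightarrow> smooth_on S f \<Longrightarrow> smooth_on S g \<Longrightarrow> smooth_on S (\<lambda>x. f x *\<^sub>R g x)"
  by (simp add: smooth_on_def Ck_on_bounded_bilinear[OF bounded_bilinear_scaleR])

lemma smooth_on_inner:
  "open S \<Longrightarrow> smooth_on S f \<Longrightarrow> smooth_on S g \<Longrightarrow> smooth_on S (\<lambda>x. f x \<bullet> g x)"
  by (simp add: smooth_on_def Ck_on_bounded_bilinear[OF bounded_bilinear_inner])

lemma smooth_on_minus: "open S \<Longrightarrow> smooth_on S f \<Longrightarrow> smooth_on S (\<lambda>x. - f x)"
  by (simp add: smooth_on_def Ck_on_bounded_linear[OF bounded_linear_minus[OF bounded_linear_ident]])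

lemma smooth_on_diff: "open S \<Longrightarrow> smooth_on S f \<Longrightarrow> smooth_on S g \<Longrightarrow> smooth_on S (\<lambda>x. f x - g x)"
  using smooth_on_add[of S f "\<lambda>x. - g x"] smooth_on_minus[of S g] by simp

lemma smooth_on_compose:
  fixes g :: "'b::euclidean_space \<Rightarrow> 'c::real_normed_vector"
  shows "open S \<Longrightarrow> open T \<Longrightarrow> smooth_on T g \<Longrightarrow> smooth_on S f \<Longrightarrow> f ` S \<subseteq> T \<Longrightarrow>
    smooth_on S (\<lambda>x. g (f x))"
  by (simp add: smooth_on_def Ck_on_compose)

lemma smooth_on_abs_powr:
  fixes f :: "'a::euclidean_space \<Rightarrow> real"
  assumes "open S" "smooth_on S f" "\<And>x. x \<in> S \<Longrightarrow> f x \<noteq> 0"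
  shows "smooth_on S (\<lambda>x. \<bar>f x\<bar> powr s)"
proof -
  have "smooth_on S (\<lambda>x. (f x * f x) powr (s / 2))"
  proof (rule smooth_on_compose[where T = "{0<..}" and g = "\<lambda>x. x powr (s / 2)" and f = "\<lambda>x. f x * f x"])
    show "smooth_on {0<..} (\<lambda>x::real. x powr (s / 2))"
      by (simp add: smooth_on_def Ck_on_powr)
    show "smooth_on S (\<lambda>x. f x * f x)"
      by (intro smooth_on_mult assms)
    show "(\<lambda>x. f x * f x) ` S \<subseteq> {0<..}"
      using assms(3) by (auto simp: zero_less_mult_iff not_less less_le)
  qed (simp_all add: assms)
  moreover have "(f x * f x) powr (s / 2) = \<bar>f x\<bar> powr s" for x
  proof -
    have "\<bar>f x\<bar> powr s = \<bar>f x\<bar> powr (s / 2) * \<bar>f x\<bar> powr (s / 2)"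
      by (simp only: powr_add[symmetric] field_sum_of_halves)
    also have "\<dots> = (\<bar>f x\<bar> * \<bar>f x\<bar>) powr (s / 2)"
      by (rule powr_mult[symmetric])
    finally show ?thesis by (simp only: abs_mult_self_eq)
  qed
  ultimately show ?thesis by simp
qed

lemma smooth_on_divide:
  fixes f g :: "'a::euclidean_space \<Rightarrow> real"
  assumes "open S" "smooth_on S f" "smooth_on S g" "\<And>x. x \<in> S \<Longrightarrow> g x \<noteq> 0"
  shows "smooth_on S (\<lambda>x. f x / g x)"
proof -
  \<comment> \<open>The reciprocal is \<open>g\<close> times a power of \<open>|g|\<close>, hence a
    case of \<open>smooth_on_abs_powr\<close>. The identity holds even at \<open>g x = 0\<close>,
    where both sides are 0.\<close>
  have "f x / g x = f x * (g x * \<bar>g x\<bar> powr (-2))" for x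
  proof -
    have "\<bar>g x\<bar> powr (-2) = inverse (\<bar>g x\<bar>^2)" if "g x \<noteq> 0"
      using that by (simp add: powr_minus powr_numeral)
    then show ?thesis by (cases "g x = 0") (auto simp: field_simps power2_eq_square)
  qed
  then show ?thesis
    using assms by (simp add: smooth_on_mult smooth_on_abs_powr)
qed

lemma smooth_on_has_derivative:
  "smooth_on S f \<Longrightarrow> open S \<Longrightarrow> x \<in> S \<Longrightarrow> (f has_derivative frechet_derivative f (at x)) (at x)"
  using Ck_on_SucD unfolding smooth_on_def by blast

lemma smooth_on_differentiable: "smooth_on S f \<Longrightarrow> open S \<Longrightarrow> x \<in> S \<Longrightarrow> f differentiable at x"
  using smooth_on_has_derivative differentiableI by blast

lemma smooth_on_linear: "smooth_on S f \<Longrightarrow> open S \<Longrightarrow> x \<in> S \<Longrightarrow> linear (frechet_derivative f (at x))"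
  using smooth_on_has_derivative has_derivative_linear by blast

lemma smooth_on_frechet_derivative: "smooth_on S f \<Longrightarrow> smooth_on S (\<lambda>x. frechet_derivative f (at x) v)"
  unfolding smooth_on_def by (metis Ck_on.simps(2))

lemma smooth_on_continuous: "smooth_on S f \<Longrightarrow> continuous_on S f"
  unfolding smooth_on_def by (metis Ck_on.simps(1))

lemma smooth_on_frechet_derivative2:
  fixes f :: "'a::euclidean_space \<Rightarrow> 'b::real_normed_vector"
  assumes "open S" "smooth_on S f" "smooth_on S w"
  shows "smooth_on S (\<lambda>x. frechet_derivative f (at x) (w x))"
proof -
  have "smooth_on S (\<lambda>x. \<Sum>b\<in>Basis. (w x \<bullet> b) *\<^sub>R frechet_derivative f (at x) b)"
    using assms by (intro smooth_on_sum smooth_on_scaleR smooth_on_inner smooth_on_frechet_derivative) auto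
  moreover have "(\<Sum>b\<in>Basis. (w x \<bullet> b) *\<^sub>R frechet_derivative f (at x) b) = frechet_derivative f (at x) (w x)"
    if "x \<in> S" for x
    using linear_Basis_expand[OF smooth_on_linear[OF assms(2,1) that]] by metis
  ultimately show ?thesis using smooth_on_cong[OF assms(1)] by (metis (no_types, lifting))
qed


section \<open>Alternating forms on a vector space\<close>

text \<open>Stated by the sign rule for all permutations: this is what reindexing the sum over
  permutations in a wedge product gives directly.\<close>

definition alternating :: "nat \<Rightarrow> ('v list \<Rightarrow> real) \<Rightarrow> bool" where
  "alternating N \<omega> \<longleftrightarrow> (\<forall>vs \<pi>. length vs = N \<longrightarrow> \<pi> permutes {..<N} \<longrightarrow>
     \<omega> (map (\<lambda>i. vs ! \<pi> i) [0..<N]) = of_int (sign \<pi>) * \<omega> vs)"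

definition multilinear :: "nat \<Rightarrow> ('v::real_vector list \<Rightarrow> real) \<Rightarrow> bool" where
  "multilinear N \<omega> \<longleftrightarrow> (\<forall>vs i. length vs = N \<longrightarrow> i < N \<longrightarrow> linear (\<lambda>v. \<omega> (vs[i := v])))"

lemma alternating_repeat:
  assumes "alternating N \<omega>" "length vs = N" "i < N" "j < N" "i \<noteq> j" "vs ! i = vs ! j"
  shows "\<omega> vs = 0"
proof -
  have "map (\<lambda>m. vs ! Transposition.transpose i j m) [0..<N] = vs"
    using assms by (intro nth_equalityI) (auto simp: Transposition.transpose_def)
  moreover have "Transposition.transpose i j permutes {..<N}"
    using assms by (intro permutes_swap_id) auto
  ultimately have "\<omega> vs = of_int (sign (Transposition.transpose i j)) * \<omega> vs"
    using assms unfolding alternating_def by metis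
  then show ?thesis using assms by (simp add: sign_swap_id)
qed

text \<open>The uniqueness of the determinant: a form of top degree is determined by its value on
  one spanning list. It is the source of all ratios of volumes below.\<close>

lemma multilinear_alternating_eq_0:
  assumes \<omega>: "multilinear N \<omega>" "alternating N \<omega>"
    and bs: "length bs = N" "span (set bs) = UNIV" "\<omega> bs = 0"
    and vs: "length vs = N"
  shows "\<omega> vs = 0"
proof -
  have basis: "\<omega> us = 0" if us: "length us = N" "set us \<subseteq> set bs" for us
  proof (cases "distinct us")
    case False
    then show ?thesis
      using alternating_repeat[OF \<omega>(2) us(1)] us(1) by (auto simp: distinct_conv_nth)
  next
    case True
    \<comment> \<open>\<open>us\<close> has \<open>N\<close> distinct entries and
      \<open>set bs\<close> has at most \<open>N\<close>, so the inclusion is an equality and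
      \<open>us\<close> is a rearrangement of \<open>bs\<close>.\<close>
    then have "card (set bs) \<le> card (set us)"
      using card_length[of bs] us(1) bs(1) by (simp add: distinct_card)
    then have "set us = set bs"
      using us(2) by (simp add: card_seteq)
    moreover from this have "distinct bs"
      using True us(1) bs(1) by (metis card_distinct distinct_card)
    ultimately have "mset us = mset bs"
      using True set_eq_iff_mset_eq_distinct by blast
    then obtain \<pi> where "\<pi> permutes {..<length bs}" "permute_list \<pi> bs = us"
      by (rule mset_eq_permutation)
    then show ?thesis
      using \<omega>(2) bs unfolding alternating_def permute_list_def by (metis mult_zero_right)
  qed
  \<comment> \<open>Here \<open>m\<close> counts the leading slots that may hold arbitrary vectors.
    Each step frees one more slot by linearity over the span of \<open>bs\<close>;
    \<open>m = N\<close> is the claim.\<close>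
  have "\<omega> us = 0" if "m \<le> N" "length us = N" "set (drop m us) \<subseteq> set bs" for m us
    using that
  proof (induction m arbitrary: us)
    case 0
    then show ?case by (simp add: basis)
  next
    case (Suc m)
    have "linear (\<lambda>v. \<omega> (us[m := v]))"
      using \<omega>(1) Suc.prems by (auto simp: multilinear_def)
    moreover have "\<omega> (us[m := b]) = 0" if "b \<in> set bs" for b
    proof -
      have "drop m (us[m := b]) = b # drop (Suc m) us"
        using Suc.prems by (simp add: Cons_nth_drop_Suc[symmetric])
      then show ?thesis using Suc that by auto
    qed
    ultimately have "\<omega> (us[m := us ! m]) = 0"
      using linear_eq_0_on_span[of "\<lambda>v. \<omega> (us[m := v])" "set bs" "us ! m"] bs(2) by auto
    then show ?case by simp
  qed
  from this[of N vs] vs show ?thesis by simp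
qed

lemma multilinear_diff:
  "multilinear N \<omega> \<Longrightarrow> multilinear N \<omega>' \<Longrightarrow> multilinear N (\<lambda>vs. c * \<omega> vs - d * \<omega>' vs)"
  by (auto simp: multilinear_def linear_iff algebra_simps)

lemma alternating_diff:
  "alternating N \<omega> \<Longrightarrow> alternating N \<omega>' \<Longrightarrow> alternating N (\<lambda>vs. c * \<omega> vs - d * \<omega>' vs)"
  by (auto simp: alternating_def algebra_simps)

text \<open>The combination \<open>\<omega>' bs * \<omega> - \<omega> bs * \<omega>'\<close> is
  again multilinear and alternating, and it vanishes on \<open>bs\<close>.\<close>

lemma multilinear_alternating_proportional:
  assumes "multilinear N \<omega>" "alternating N \<omega>" "multilinear N \<omega>'" "alternating N \<omega>'"
    and "length bs = N" "span (set bs) = UNIV" "length vs = N"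
  shows "\<omega>' bs * \<omega> vs = \<omega> bs * \<omega>' vs"
  using multilinear_alternating_eq_0[OF multilinear_diff alternating_diff, OF assms(1,3,2,4,5,6), of "\<omega>' bs" "\<omega> bs" vs] assms(7)
  by simp

text \<open>The wedge product, wedge power and contact volume at a single point, on an arbitrary vector
  space: in this form they apply to tangent vectors and to their coordinates alike.\<close>

definition lwedge :: "nat \<Rightarrow> nat \<Rightarrow> ('v list \<Rightarrow> real) \<Rightarrow> ('v list \<Rightarrow> real) \<Rightarrow> 'v list \<Rightarrow> real" where
  "lwedge k l a b vs =
     (\<Sum>\<sigma> | \<sigma> permutes {..<k + l}. of_int (sign \<sigma>) *
        a (map (\<lambda>i. vs ! \<sigma> i) [0..<k]) * b (map (\<lambda>i. vs ! \<sigma> i) [k..<k + l]))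
     / (fact k * fact l)"

primrec lpow :: "nat \<Rightarrow> ('v list \<Rightarrow> real) \<Rightarrow> nat \<Rightarrow> 'v list \<Rightarrow> real" where
  "lpow k \<tau> 0 = (\<lambda>vs. if vs = [] then 1 else 0)"
| "lpow k \<tau> (Suc n) = lwedge k (k * n) \<tau> (lpow k \<tau> n)"

definition lvol :: "nat \<Rightarrow> ('v list \<Rightarrow> real) \<Rightarrow> ('v list \<Rightarrow> real) \<Rightarrow> 'v list \<Rightarrow> real" where
  "lvol n a \<tau> = lwedge 1 (2 * n) a (lpow 2 \<tau> n)"

lemma wedge_power_eq_lpow: "wedge_power k \<tau> n p = lpow k (\<tau> p) n"
  by (induction n) (auto simp: fun_form_def wedge_def lwedge_def fun_eq_iff)

lemma contact_vol_eq_lvol: "contact_vol n \<alpha> \<tau> p = lvol n (\<alpha> p) (\<tau> p)"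
  by (auto simp: contact_vol_def lvol_def wedge_def lwedge_def fun_eq_iff wedge_power_eq_lpow)

lemma permutes_lessThan: "\<sigma> permutes {..<N} \<Longrightarrow> i < N \<Longrightarrow> \<sigma> i < (N::nat)"
  using permutes_in_image[of \<sigma> "{..<N}" i] by auto

text \<open>Forms on a manifold are controlled only on tangent vectors at the given point, so the
  agreement is demanded only on lists drawn from \<open>vs\<close>.\<close>

lemma lwedge_cong:
  assumes "length vs = k + l"
    and "\<And>us. length us = k \<Longrightarrow> set us \<subseteq> set vs \<Longrightarrow> a us = a' us"
    and "\<And>us. length us = l \<Longrightarrow> set us \<subseteq> set vs \<Longrightarrow> b us = b' us"
  shows "lwedge k l a b vs = lwedge k l a' b' vs"
  unfolding lwedge_def
proof (intro arg_cong2[where f = "(/)"] sum.cong refl)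
  fix \<sigma> assume "\<sigma> \<in> {\<sigma>. \<sigma> permutes {..<k + l}}"
  then have \<sigma>: "\<sigma> i < k + l" if "i < k + l" for i
    using that by (auto intro: permutes_lessThan)
  have "a (map (\<lambda>i. vs ! \<sigma> i) [0..<k]) = a' (map (\<lambda>i. vs ! \<sigma> i) [0..<k])"
    by (rule assms(2)) (use \<sigma> assms(1) in auto)
  moreover have "b (map (\<lambda>i. vs ! \<sigma> i) [k..<k + l]) = b' (map (\<lambda>i. vs ! \<sigma> i) [k..<k + l])"
    by (rule assms(3)) (use \<sigma> assms(1) in auto)
  ultimately show "of_int (sign \<sigma>) * a (map (\<lambda>i. vs ! \<sigma> i) [0..<k]) * b (map (\<lambda>i. vs ! \<sigma> i) [k..<k + l]) =
      of_int (sign \<sigma>) * a' (map (\<lambda>i. vs ! \<sigma> i) [0..<k]) * b' (map (\<lambda>i. vs ! \<sigma> i) [k..<k + l])"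
    by simp
qed

lemma lpow_cong:
  assumes "length vs = k * n" "\<And>us. length us = k \<Longrightarrow> set us \<subseteq> set vs \<Longrightarrow> \<tau> us = \<tau>' us"
  shows "lpow k \<tau> n vs = lpow k \<tau>' n vs"
  using assms
proof (induction n arbitrary: vs)
  case (Suc n)
  show ?case
    unfolding lpow.simps
  proof (rule lwedge_cong)
    fix us :: "'a list" assume "length us = k * n" "set us \<subseteq> set vs"
    then show "lpow k \<tau> n us = lpow k \<tau>' n us"
      by (intro Suc.IH Suc.prems(2)) auto
  qed (use Suc.prems in auto)
qed simp

lemma lvol_cong:
  assumes "length vs = 2 * n + 1"
    and "\<And>us. length us = 1 \<Longrightarrow> set us \<subseteq> set vs \<Longrightarrow> a us = a' us"
    and "\<And>us. length us = 2 \<Longrightarrow> set us \<subseteq> set vs \<Longrightarrow> \<tau> us = \<tau>' us"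
  shows "lvol n a \<tau> vs = lvol n a' \<tau>' vs"
  unfolding lvol_def
proof (rule lwedge_cong)
  fix us :: "'a list" assume "length us = 2 * n" "set us \<subseteq> set vs"
  then show "lpow 2 \<tau> n us = lpow 2 \<tau>' n us"
    by (intro lpow_cong assms(3)) auto
qed (use assms in auto)

text \<open>A wedge product only rearranges its arguments, so any map \<open>g\<close> may be moved
  inside. In \<open>lvol_map\<close> this serves three maps: passage to coordinates, the tangent map
  of \<open>\<Phi>\<close>, and \<open>1 - s DX\<close>.\<close>

lemma lwedge_map:
  assumes "length vs = k + l"
  shows "lwedge k l a b (map g vs) = lwedge k l (\<lambda>us. a (map g us)) (\<lambda>us. b (map g us)) vs"
  unfolding lwedge_def
proof (intro arg_cong2[where f = "(/)"] sum.cong refl)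
  fix \<sigma> assume "\<sigma> \<in> {\<sigma>. \<sigma> permutes {..<k + l}}"
  then have \<sigma>: "\<sigma> i < k + l" if "i < k + l" for i
    using that by (auto intro: permutes_lessThan)
  have "map (\<lambda>i. map g vs ! \<sigma> i) [0..<k] = map g (map (\<lambda>i. vs ! \<sigma> i) [0..<k])"
    "map (\<lambda>i. map g vs ! \<sigma> i) [k..<k + l] = map g (map (\<lambda>i. vs ! \<sigma> i) [k..<k + l])"
    using \<sigma> assms by auto
  then show "of_int (sign \<sigma>) * a (map (\<lambda>i. map g vs ! \<sigma> i) [0..<k]) * b (map (\<lambda>i. map g vs ! \<sigma> i) [k..<k + l]) =
      of_int (sign \<sigma>) * a (map g (map (\<lambda>i. vs ! \<sigma> i) [0..<k])) * b (map g (map (\<lambda>i. vs ! \<sigma> i) [k..<k + l]))"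
    by presburger
qed

lemma lpow_map:
  "length vs = k * n \<Longrightarrow> lpow k \<tau> n (map g vs) = lpow k (\<lambda>us. \<tau> (map g us)) n vs"
proof (induction n arbitrary: vs)
  case (Suc n)
  have "lpow k \<tau> (Suc n) (map g vs) =
      lwedge k (k * n) (\<lambda>us. \<tau> (map g us)) (\<lambda>us. lpow k \<tau> n (map g us)) vs"
    using Suc.prems by (simp add: lwedge_map)
  also have "\<dots> = lpow k (\<lambda>us. \<tau> (map g us)) (Suc n) vs"
    unfolding lpow.simps using Suc by (intro lwedge_cong) auto
  finally show ?case .
qed simp

lemma lvol_map:
  assumes "length vs = 2 * n + 1"
  shows "lvol n a \<tau> (map g vs) = lvol n (\<lambda>us. a (map g us)) (\<lambda>us. \<tau> (map g us)) vs"
proof -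
  have "lvol n a \<tau> (map g vs) =
      lwedge 1 (2 * n) (\<lambda>us. a (map g us)) (\<lambda>us. lpow 2 \<tau> n (map g us)) vs"
    using assms by (simp add: lvol_def lwedge_map)
  also have "\<dots> = lvol n (\<lambda>us. a (map g us)) (\<lambda>us. \<tau> (map g us)) vs"
    unfolding lvol_def using assms by (intro lwedge_cong) (auto simp: lpow_map)
  finally show ?thesis .
qed

text \<open>Permuting the arguments by \<open>\<pi>\<close> replaces \<open>\<sigma>\<close> by
  \<open>\<pi> \<circ> \<sigma>\<close> in the sum; the sign of \<open>\<pi>\<close> comes out
  because its square is 1.\<close>

lemma alternating_lwedge: "alternating (k + l) (lwedge k l a b)"
  unfolding alternating_def
proof (intro allI impI)
  fix vs :: "'a list" and \<pi>
  assume vs: "length vs = k + l" and \<pi>: "\<pi> permutes {..<k + l}"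
  let ?P = "{\<sigma>. \<sigma> permutes {..<k + l}}"
  let ?f = "\<lambda>\<sigma>. of_int (sign \<sigma>) * a (map (\<lambda>i. vs ! \<sigma> i) [0..<k]) * b (map (\<lambda>i. vs ! \<sigma> i) [k..<k + l])"
  let ?vs = "map (\<lambda>i. vs ! \<pi> i) [0..<k + l]"
  have "(\<Sum>\<sigma>\<in>?P. of_int (sign \<sigma>) * a (map (\<lambda>i. ?vs ! \<sigma> i) [0..<k]) * b (map (\<lambda>i. ?vs ! \<sigma> i) [k..<k + l]))
      = (\<Sum>\<sigma>\<in>?P. of_int (sign \<pi>) * ?f (\<pi> \<circ> \<sigma>))"
  proof (intro sum.cong refl)
    fix \<sigma> assume "\<sigma> \<in> ?P"
    then have p: "\<sigma> permutes {..<k + l}" by simp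
    then have \<sigma>: "\<sigma> i < k + l" if "i < k + l" for i
      using that by (auto intro: permutes_lessThan)
    have eq: "map (\<lambda>i. ?vs ! \<sigma> i) [0..<k] = map (\<lambda>i. vs ! (\<pi> \<circ> \<sigma>) i) [0..<k]"
      "map (\<lambda>i. ?vs ! \<sigma> i) [k..<k + l] = map (\<lambda>i. vs ! (\<pi> \<circ> \<sigma>) i) [k..<k + l]"
      using \<sigma> by (auto simp del: upt_Suc)
    have "sign (\<pi> \<circ> \<sigma>) = sign \<pi> * sign \<sigma>"
      using p \<pi> by (auto intro!: sign_compose permutation_permutes[THEN iffD2])
    moreover have "(of_int (sign \<pi>) * of_int (sign \<pi>) :: real) = 1"
      by (simp add: sign_def)
    ultimately show "of_int (sign \<sigma>) * a (map (\<lambda>i. ?vs ! \<sigma> i) [0..<k]) * b (map (\<lambda>i. ?vs ! \<sigma> i) [k..<k + l])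
        = of_int (sign \<pi>) * ?f (\<pi> \<circ> \<sigma>)"
      unfolding eq by (simp add: mult.assoc[symmetric])
  qed
  also have "\<dots> = (\<Sum>\<sigma>\<in>?P. of_int (sign \<pi>) * ?f \<sigma>)"
    by (rule setum_permutations_compose_left[OF \<pi>, symmetric])
  finally show "lwedge k l a b ?vs = of_int (sign \<pi>) * lwedge k l a b vs"
    by (simp add: lwedge_def sum_distrib_left[symmetric])
qed

lemma multilinear_lwedge:
  assumes a: "multilinear k a" and b: "multilinear l b"
  shows "multilinear (k + l) (lwedge k l a b)"
  unfolding multilinear_def
proof (intro allI impI)
  fix vs :: "'a list" and i
  assume vs: "length vs = k + l" and i: "i < k + l"
  have "linear (\<lambda>v. of_int (sign \<sigma>) * a (map (\<lambda>m. vs[i := v] ! \<sigma> m) [0..<k]) *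
      b (map (\<lambda>m. vs[i := v] ! \<sigma> m) [k..<k + l]))" if p: "\<sigma> permutes {..<k + l}" for \<sigma>
  proof -
    have \<sigma>: "\<sigma> m < k + l" if "m < k + l" for m
      using that p by (auto intro: permutes_lessThan)
    \<comment> \<open>Slot \<open>i\<close> is read exactly once, at position \<open>j\<close>, so
      only one of the two factors depends on \<open>v\<close>.\<close>
    obtain j where j: "\<sigma> j = i" "j < k + l"
      using p i by (metis lessThan_iff permutes_inv permutes_inverses(1) permutes_lessThan)
    have eq: "vs[i := v] ! \<sigma> m = (if m = j then v else vs ! \<sigma> m)" if "m < k + l" for m v
      using that j vs i \<sigma>[OF that] inj_eq[OF permutes_inj[OF p], of m j]
      by (cases "m = j") simp_all
    let ?A = "map (\<lambda>m. vs ! \<sigma> m) [0..<k]" and ?B = "map (\<lambda>m. vs ! \<sigma> m) [k..<k + l]"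
    show ?thesis
    proof (cases "j < k")
      case True
      have L: "map (\<lambda>m. vs[i := v] ! \<sigma> m) [0..<k] = ?A[j := v]"
        "map (\<lambda>m. vs[i := v] ! \<sigma> m) [k..<k + l] = ?B" for v
        using True by (auto intro!: nth_equalityI simp: eq nth_list_update)
      have "linear (\<lambda>v. a (?A[j := v]))"
        using a True by (auto simp: multilinear_def)
      then show ?thesis unfolding L by (simp add: linear_iff algebra_simps)
    next
      case False
      have L: "map (\<lambda>m. vs[i := v] ! \<sigma> m) [0..<k] = ?A"
        "map (\<lambda>m. vs[i := v] ! \<sigma> m) [k..<k + l] = ?B[j - k := v]" for v
        using False j(2) by (auto intro!: nth_equalityI simp: eq nth_list_update)
      have "linear (\<lambda>v. b (?B[j - k := v]))"
        using b False j(2) by (auto simp: multilinear_def)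
      then show ?thesis unfolding L by (simp add: linear_iff algebra_simps)
    qed
  qed
  then have "linear (\<lambda>v. \<Sum>\<sigma> | \<sigma> permutes {..<k + l}. of_int (sign \<sigma>) *
      a (map (\<lambda>m. vs[i := v] ! \<sigma> m) [0..<k]) * b (map (\<lambda>m. vs[i := v] ! \<sigma> m) [k..<k + l]))"
    by (intro linear_compose_sum) auto
  then show "linear (\<lambda>v. lwedge k l a b (vs[i := v]))"
    by (simp add: lwedge_def linear_iff add_divide_distrib)
qed

lemma multilinear_lpow: "multilinear k \<tau> \<Longrightarrow> multilinear (k * n) (lpow k \<tau> n)"
proof (induction n)
  case 0
  then show ?case by (simp add: multilinear_def)
next
  case (Suc n)
  then show ?case using multilinear_lwedge[of k \<tau> "k * n" "lpow k \<tau> n"] by simp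
qed

lemma multilinear_lvol: "multilinear 1 a \<Longrightarrow> multilinear 2 \<tau> \<Longrightarrow> multilinear (2 * n + 1) (lvol n a \<tau>)"
  unfolding lvol_def using multilinear_lwedge[of 1 a "2 * n" "lpow 2 \<tau> n"] multilinear_lpow[of 2 \<tau> n] by simp

lemma alternating_lvol: "alternating (2 * n + 1) (lvol n a \<tau>)"
  unfolding lvol_def using alternating_lwedge[of 1 "2 * n"] by simp

lemma lpow_scale: "lpow k (\<lambda>us. s * \<tau> us) n vs = s ^ n * lpow k \<tau> n vs"
proof (induction n arbitrary: vs)
  case (Suc n)
  then have "lpow k (\<lambda>us. s * \<tau> us) n = (\<lambda>vs. s ^ n * lpow k \<tau> n vs)" by (simp add: fun_eq_iff)
  then show ?case
    by (simp add: lwedge_def sum_distrib_left mult.assoc mult.left_commute)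
qed simp

text \<open>One power of \<open>s\<close> comes from \<open>a\<close> and \<open>n\<close> from the
  copies of \<open>\<tau>\<close>.\<close>

lemma lvol_scale: "lvol n (\<lambda>us. s * a us) (\<lambda>us. s * \<tau> us) vs = s ^ (n + 1) * lvol n a \<tau> vs"
proof -
  have "lpow 2 (\<lambda>us. s * \<tau> us) n = (\<lambda>vs. s ^ n * lpow 2 \<tau> n vs)" by (simp add: fun_eq_iff lpow_scale)
  then show ?thesis
    by (simp add: lvol_def lwedge_def sum_distrib_left mult.assoc mult.left_commute)
qed

text \<open>In particular \<open>\<tau> + \<xi> \<and> A\<close> may replace \<open>\<tau>\<close>. The volumes are compared on a basis with all but one
  vector in the kernel of \<open>A\<close>.\<close>

lemma lvol_cong_kernel:
  fixes A :: "'v::euclidean_space \<Rightarrow> real"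
  assumes A: "linear A" and dim: "DIM('v) = 2 * n + 1"
    and \<tau>: "multilinear 2 \<tau>" "multilinear 2 \<tau>'"
    and eq: "\<And>us. length us = 2 \<Longrightarrow> (\<And>u. u \<in> set us \<Longrightarrow> A u = 0) \<Longrightarrow> \<tau> us = \<tau>' us"
    and vs: "length vs = 2 * n + 1"
  shows "lvol n (\<lambda>us. A (us ! 0)) \<tau> vs = lvol n (\<lambda>us. A (us ! 0)) \<tau>' vs"
proof (cases "\<exists>b\<in>Basis. A b \<noteq> 0")
  \<comment> \<open>Now \<open>A = 0\<close>, so every pair lies in the kernel and
    \<open>\<tau>\<close>, \<open>\<tau>'\<close> agree on all pairs.\<close>
  case False
  then have "A v = 0" for v
    using linear_Basis_expand[OF A, of v] by simp
  then show ?thesis using vs by (intro lvol_cong eq) auto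
next
  case True
  then obtain b0 where b0: "b0 \<in> Basis" "A b0 \<noteq> 0" by blast
  obtain bl where bl: "set bl = Basis - {b0}" "distinct bl"
    using finite_distinct_list[of "Basis - {b0}"] by auto
  define bs where "bs = b0 # map (\<lambda>b. b - (A b / A b0) *\<^sub>R b0) bl"
  have "length bl = 2 * n"
    using distinct_card[OF bl(2)] bl(1) dim b0 by simp
  then have len: "length bs = 2 * n + 1" by (simp add: bs_def)
  have ker: "A (bs ! i) = 0" if "i < 2 * n + 1" "i \<noteq> 0" for i
    using that len b0 by (cases i) (auto simp: bs_def linear_diff[OF A] linear_scale[OF A])
  have "b \<in> span (set bs)" if b: "b \<in> Basis" for b
  proof (cases "b = b0")
    case True
    then show ?thesis by (auto simp: bs_def intro: span_base)
  next
    case False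
    then have "b - (A b / A b0) *\<^sub>R b0 \<in> span (set bs)" "b0 \<in> span (set bs)"
      using b bl by (auto simp: bs_def intro: span_base)
    then have "b - (A b / A b0) *\<^sub>R b0 + (A b / A b0) *\<^sub>R b0 \<in> span (set bs)"
      by (intro span_add span_scale)
    then show ?thesis by simp
  qed
  then have span: "span (set bs) = UNIV"
    using span_mono[of Basis "span (set bs)"] by (auto simp: span_span)
  have "lvol n (\<lambda>us. A (us ! 0)) \<tau> bs = lvol n (\<lambda>us. A (us ! 0)) \<tau>' bs"
    unfolding lvol_def lwedge_def
  proof (intro arg_cong2[where f = "(/)"] sum.cong refl)
    fix \<sigma> assume "\<sigma> \<in> {\<sigma>. \<sigma> permutes {..<1 + 2 * n}}"
    then have p: "\<sigma> permutes {..<1 + 2 * n}" by simp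
    then have \<sigma>: "\<sigma> i < 2 * n + 1" if "i < 2 * n + 1" for i
      using that permutes_lessThan[of \<sigma> "1 + 2 * n"] by simp
    show "of_int (sign \<sigma>) * A (map (\<lambda>i. bs ! \<sigma> i) [0..<1] ! 0) * lpow 2 \<tau> n (map (\<lambda>i. bs ! \<sigma> i) [1..<1 + 2 * n])
      = of_int (sign \<sigma>) * A (map (\<lambda>i. bs ! \<sigma> i) [0..<1] ! 0) * lpow 2 \<tau>' n (map (\<lambda>i. bs ! \<sigma> i) [1..<1 + 2 * n])"
    \<comment> \<open>\<open>\<sigma> 0\<close> is the index of the vector given to
      \<open>A\<close>. If it is not 0, that factor is 0. If it is 0, the vector \<open>b0\<close>
      is used up and the 2-forms see kernel vectors only.\<close>
    proof (cases "\<sigma> 0 = 0")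
      case False
      then show ?thesis using ker[of "\<sigma> 0"] \<sigma>[of 0] by simp
    next
      case True
      have "lpow 2 \<tau> n (map (\<lambda>i. bs ! \<sigma> i) [1..<1 + 2 * n]) = lpow 2 \<tau>' n (map (\<lambda>i. bs ! \<sigma> i) [1..<1 + 2 * n])"
      proof (rule lpow_cong)
        fix us :: "'v list"
        assume us: "length us = 2" "set us \<subseteq> set (map (\<lambda>i. bs ! \<sigma> i) [1..<1 + 2 * n])"
        have "A u = 0" if u: "u \<in> set us" for u
        proof -
          obtain i where i: "u = bs ! \<sigma> i" "1 \<le> i" "i < 1 + 2 * n"
            using subsetD[OF us(2) u] unfolding set_map set_upt by (auto simp del: upt_Suc)
          then have "\<sigma> i \<noteq> 0" using True permutes_inj[OF p] by (metis injD not_one_le_zero)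
          then show ?thesis using i ker \<sigma> by simp
        qed
        then show "\<tau> us = \<tau>' us" by (rule eq[OF us(1)])
      qed simp
      then show ?thesis by simp
    qed
  qed
  then have 0: "1 * lvol n (\<lambda>us. A (us ! 0)) \<tau> bs - 1 * lvol n (\<lambda>us. A (us ! 0)) \<tau>' bs = 0"
    by simp
  have a: "multilinear 1 (\<lambda>us. A (us ! 0))"
    using A by (simp add: multilinear_def)
  show ?thesis
    using multilinear_alternating_eq_0[OF
        multilinear_diff[OF multilinear_lvol[OF a \<tau>(1)] multilinear_lvol[OF a \<tau>(2)]]
        alternating_diff[OF alternating_lvol alternating_lvol] len span 0 vs]
    by simp
qed

section \<open>Derivatives of volumes along a curve of forms\<close>

lemma lwedge_has_derivative:
  assumes "\<And>us. ((\<lambda>s. a s us) has_real_derivative a' us) (at 0)"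
    and "\<And>us. ((\<lambda>s. b s us) has_real_derivative b' us) (at 0)"
  shows "((\<lambda>s. lwedge k l (a s) (b s) vs) has_real_derivative
     lwedge k l a' (b 0) vs + lwedge k l (a 0) b' vs) (at 0)"
proof -
  let ?f = "\<lambda>a b \<sigma>. of_int (sign \<sigma>) * a (map (\<lambda>i. vs ! \<sigma> i) [0..<k]) * b (map (\<lambda>i. vs ! \<sigma> i) [k..<k + l])"
  have "((\<lambda>s. ?f (a s) (b s) \<sigma>) has_real_derivative ?f a' (b 0) \<sigma> + ?f (a 0) b' \<sigma>) (at 0)" for \<sigma>
    by (rule derivative_eq_intros assms refl)+ (simp add: mult.commute)
  then have "((\<lambda>s. \<Sum>\<sigma> | \<sigma> permutes {..<k + l}. ?f (a s) (b s) \<sigma>) has_real_derivative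
      (\<Sum>\<sigma> | \<sigma> permutes {..<k + l}. ?f a' (b 0) \<sigma> + ?f (a 0) b' \<sigma>)) (at 0)"
    by (intro DERIV_sum)
  from DERIV_cdivide[OF this, of "fact k * fact l"] show ?thesis
    by (simp add: lwedge_def sum.distrib add_divide_distrib)
qed

text \<open>\<open>D\<close> is quantified before the curve \<open>\<tau>\<close>, hence depends
  only on its value and derivative at 0. Curves with the same 1-jet therefore share
  \<open>D\<close>, and no formula for it has to be stated.\<close>

lemma lpow_has_derivative:
  "\<exists>D. \<forall>\<tau>. \<tau> 0 = \<tau>0 \<longrightarrow> (\<forall>us. ((\<lambda>s. \<tau> s us) has_real_derivative \<tau>' us) (at 0)) \<longrightarrow>
     (\<forall>vs. ((\<lambda>s. lpow k (\<tau> s) n vs) has_real_derivative D vs) (at 0))"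
proof (induction n)
  case 0
  show ?case by (intro exI[of _ "\<lambda>_. 0"]) auto
next
  case (Suc n)
  then obtain D where D: "\<forall>\<tau>. \<tau> 0 = \<tau>0 \<longrightarrow> (\<forall>us. ((\<lambda>s. \<tau> s us) has_real_derivative \<tau>' us) (at 0)) \<longrightarrow>
     (\<forall>vs. ((\<lambda>s. lpow k (\<tau> s) n vs) has_real_derivative D vs) (at 0))" by blast
  show ?case
  proof (intro exI allI impI)
    fix \<tau> vs
    assume \<tau>: "\<tau> 0 = \<tau>0" "\<forall>us. ((\<lambda>s. \<tau> s us) has_real_derivative \<tau>' us) (at 0)"
    then have "((\<lambda>s. lpow k (\<tau> s) n vs) has_real_derivative D vs) (at 0)" for vs
      using D by blast
    with \<tau> show "((\<lambda>s. lpow k (\<tau> s) (Suc n) vs) has_real_derivative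
        lwedge k (k * n) \<tau>' (lpow k \<tau>0 n) vs + lwedge k (k * n) \<tau>0 D vs) (at 0)"
      using lwedge_has_derivative[of \<tau> \<tau>' "\<lambda>s. lpow k (\<tau> s) n" D k "k * n" vs] by simp
  qed
qed

lemma lvol_has_same_derivative:
  assumes "a 0 = b 0" "\<tau> 0 = \<upsilon> 0"
    and "\<And>us. ((\<lambda>s. a s us) has_real_derivative a' us) (at 0)"
    and "\<And>us. ((\<lambda>s. b s us) has_real_derivative a' us) (at 0)"
    and "\<And>us. ((\<lambda>s. \<tau> s us) has_real_derivative \<tau>' us) (at 0)"
    and "\<And>us. ((\<lambda>s. \<upsilon> s us) has_real_derivative \<tau>' us) (at 0)"
  obtains D where "((\<lambda>s. lvol n (a s) (\<tau> s) vs) has_real_derivative D) (at 0)"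
    "((\<lambda>s. lvol n (b s) (\<upsilon> s) vs) has_real_derivative D) (at 0)"
proof -
  obtain E where E: "\<forall>\<sigma>. \<sigma> 0 = \<tau> 0 \<longrightarrow> (\<forall>us. ((\<lambda>s. \<sigma> s us) has_real_derivative \<tau>' us) (at 0)) \<longrightarrow>
     (\<forall>vs. ((\<lambda>s. lpow 2 (\<sigma> s) n vs) has_real_derivative E vs) (at 0))"
    using lpow_has_derivative by blast
  show thesis
  proof (rule that)
    show "((\<lambda>s. lvol n (a s) (\<tau> s) vs) has_real_derivative
       lwedge 1 (2 * n) a' (lpow 2 (\<tau> 0) n) vs + lwedge 1 (2 * n) (a 0) E vs) (at 0)"
      unfolding lvol_def using assms E by (intro lwedge_has_derivative) auto
    have "((\<lambda>s. lvol n (b s) (\<upsilon> s) vs) has_real_derivative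
       lwedge 1 (2 * n) a' (lpow 2 (\<upsilon> 0) n) vs + lwedge 1 (2 * n) (b 0) E vs) (at 0)"
      unfolding lvol_def using assms E by (intro lwedge_has_derivative) auto
    then show "((\<lambda>s. lvol n (b s) (\<upsilon> s) vs) has_real_derivative
       lwedge 1 (2 * n) a' (lpow 2 (\<tau> 0) n) vs + lwedge 1 (2 * n) (a 0) E vs) (at 0)"
      using assms by simp
  qed
qed

lemma smooth_on_lwedge:
  assumes "open S" "\<And>us. smooth_on S (\<lambda>x. a x us)" "\<And>us. smooth_on S (\<lambda>x. b x us)"
  shows "smooth_on S (\<lambda>x. lwedge k l (a x) (b x) vs)"
  unfolding lwedge_def divide_inverse
  by (intro smooth_on_mult smooth_on_sum assms smooth_on_const)

lemma smooth_on_lvol: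
  assumes "open S" "\<And>us. smooth_on S (\<lambda>x. a x us)" "\<And>us. smooth_on S (\<lambda>x. \<tau> x us)"
  shows "smooth_on S (\<lambda>x. lvol n (a x) (\<tau> x) vs)"
proof -
  have "smooth_on S (\<lambda>x. lpow 2 (\<tau> x) n us)" for us
    by (induction n arbitrary: us) (auto intro!: smooth_on_lwedge assms)
  then show ?thesis unfolding lvol_def by (intro smooth_on_lwedge assms)
qed

section \<open>Polynomial dependence on a parameter\<close>

definition poly_fun :: "nat \<Rightarrow> (real \<Rightarrow> real) \<Rightarrow> bool" where
  "poly_fun d f \<longleftrightarrow> (\<exists>q. degree q \<le> d \<and> (\<forall>t. f t = poly q t))"

lemma poly_fun_affine: "poly_fun 1 (\<lambda>t. c + t * d)"
  unfolding poly_fun_def by (intro exI[of _ "[:c, d:]"]) simp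

lemma poly_fun_const: "poly_fun d (\<lambda>t. c)"
  unfolding poly_fun_def by (intro exI[of _ "[:c:]"]) simp

lemma poly_fun_mult: "poly_fun d f \<Longrightarrow> poly_fun e g \<Longrightarrow> poly_fun (d + e) (\<lambda>t. f t * g t)"
  unfolding poly_fun_def using degree_mult_le by (metis add_mono order_trans poly_mult)

lemma poly_fun_sum: "(\<And>i. i \<in> I \<Longrightarrow> poly_fun d (f i)) \<Longrightarrow> poly_fun d (\<lambda>t. \<Sum>i\<in>I. f i t)"
proof (induction I rule: infinite_finite_induct)
  case (insert i I)
  obtain q where "degree q \<le> d" "\<forall>t. f i t = poly q t"
    using insert.prems[of i] by (auto simp: poly_fun_def)
  moreover obtain r where "degree r \<le> d" "\<forall>t. (\<Sum>i\<in>I. f i t) = poly r t"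
    using insert by (auto simp: poly_fun_def)
  ultimately show ?case using insert.hyps
    unfolding poly_fun_def by (intro exI[of _ "q + r"]) (auto intro: degree_add_le)
qed (auto intro: poly_fun_const)

lemma poly_fun_lwedge:
  assumes "\<And>us. poly_fun d (\<lambda>t. a t us)" "\<And>us. poly_fun e (\<lambda>t. b t us)"
  shows "poly_fun (d + e) (\<lambda>t. lwedge k l (a t) (b t) vs)"
proof -
  have "poly_fun (d + e + 0) (\<lambda>t. (\<Sum>\<sigma> | \<sigma> permutes {..<k + l}. of_int (sign \<sigma>) *
        a t (map (\<lambda>i. vs ! \<sigma> i) [0..<k]) * b t (map (\<lambda>i. vs ! \<sigma> i) [k..<k + l]))
     * inverse (fact k * fact l))"
    unfolding mult.assoc[of "of_int _"]
    by (intro poly_fun_mult poly_fun_sum poly_fun_const assms poly_fun_mult[of 0 _ "d + e", simplified])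
  then show ?thesis by (simp add: lwedge_def divide_inverse)
qed

text \<open>Degree one comes from \<open>a\<close> and one from each of the \<open>n\<close> copies
  of \<open>\<tau>\<close>; hence a pencil has \<open>n + 1\<close> coefficients beyond the constant
  one.\<close>

lemma poly_fun_lvol:
  assumes "\<And>us. poly_fun 1 (\<lambda>t. a t us)" "\<And>us. poly_fun 1 (\<lambda>t. \<tau> t us)"
  shows "poly_fun (n + 1) (\<lambda>t. lvol n (a t) (\<tau> t) vs)"
proof -
  have "poly_fun n (\<lambda>t. lpow 2 (\<tau> t) n us)" for us
  proof (induction n arbitrary: us)
    case (Suc n)
    then show ?case
      using poly_fun_lwedge[of 1 \<tau> n "\<lambda>t. lpow 2 (\<tau> t) n", OF assms(2)] by simp
  qed (simp add: poly_fun_const)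
  then show ?thesis using poly_fun_lwedge[OF assms(1), of n "\<lambda>t. lpow 2 (\<tau> t) n"] by (simp add: lvol_def)
qed

text \<open>The weights are the coefficients of the Lagrange basis polynomials at the nodes \<open>0, \<dots>, N\<close>.\<close>

lemma poly_coeff_from_values:
  assumes "j \<le> N"
  shows "\<exists>w. \<forall>c. c j = (\<Sum>k\<le>N. w k * (\<Sum>i\<le>N. c i * real k ^ i))"
proof -
  define L where "L k = (\<Prod>l\<in>{..N} - {k}. [: - real l / (real k - real l), 1 / (real k - real l) :])" for k
  have L: "poly (L k) (real m) = (if m = k then 1 else 0)" if "m \<le> N" for k m
  proof (cases "m = k")
    case True
    have "(\<Prod>l\<in>{..N} - {k}. - real l / (real k - real l) + real k * (1 / (real k - real l))) = 1"
      by (intro prod.neutral) (auto simp: diff_divide_distrib[symmetric])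
    then show ?thesis using True by (simp add: L_def poly_prod)
  next
    case False
    have "(\<Prod>l\<in>{..N} - {k}. - real l / (real k - real l) + real m * (1 / (real k - real l))) = 0"
      using that False by (intro prod_zero) (auto intro!: bexI[of _ m])
    then show ?thesis using False by (simp add: L_def poly_prod)
  qed
  have degL: "degree (L k) \<le> N" if "k \<le> N" for k
  proof -
    have "degree (L k) \<le> (\<Sum>l\<in>{..N} - {k}. degree [: - real l / (real k - real l), 1 / (real k - real l) :])"
      unfolding L_def by (rule degree_prod_sum_le[unfolded o_def]) simp
    also have "\<dots> \<le> (\<Sum>l\<in>{..N} - {k}. 1)"
      by (intro sum_mono) auto
    finally show ?thesis using that by simp
  qed
  show ?thesis
  proof (intro exI[of _ "\<lambda>k. coeff (L k) j"] allI)
    fix c :: "nat \<Rightarrow> real"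
    define p where "p = (\<Sum>i\<le>N. monom (c i) i)"
    define q where "q = (\<Sum>k\<le>N. smult (poly p (real k)) (L k))"
    have p: "poly p x = (\<Sum>i\<le>N. c i * x ^ i)" for x
      by (simp add: p_def poly_sum poly_monom)
    have "p = q"
    proof (rule poly_eqI_degree[where A = "real ` {..N}"])
      fix x assume "x \<in> real ` {..N}"
      then obtain m where m: "m \<le> N" "x = real m" by auto
      have "poly q x = (\<Sum>k\<le>N. if m = k then poly p (real k) else 0)"
        unfolding q_def poly_sum m(2) by (intro sum.cong) (auto simp: L[OF m(1)])
      then show "poly p x = poly q x" using m by simp
    next
      have card: "card (real ` {..N}) = Suc N" by (subst card_image) auto
      have "degree p \<le> N"
        unfolding p_def by (intro degree_sum_le) (auto intro: order_trans[OF degree_monom_le])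
      then show "degree p < card (real ` {..N})" by (simp add: card)
      have "degree q \<le> N"
        unfolding q_def by (intro degree_sum_le) (auto intro: order_trans[OF degree_smult_le] degL)
      then show "degree q < card (real ` {..N})" by (simp add: card)
    qed
    moreover have "coeff p j = c j"
      using assms by (simp add: p_def coeff_sum)
    ultimately have "c j = coeff q j" by simp
    then show "c j = (\<Sum>k\<le>N. coeff (L k) j * (\<Sum>i\<le>N. c i * real k ^ i))"
      by (simp add: q_def coeff_sum p[symmetric] mult.commute)
  qed
qed


section \<open>One-forms in coordinates\<close>

abbreviation fd :: "('a::real_normed_vector \<Rightarrow> 'b::real_normed_vector) \<Rightarrow> 'a \<Rightarrow> 'a \<Rightarrow> 'b" where
  "fd f x \<equiv> frechet_derivative f (at x)"

lemma fd_eq: "(f has_derivative f') (at x) \<Longrightarrow> fd f x = f'"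
  using frechet_derivative_at by metis

lemma has_real_derivative_line:
  fixes f :: "'a::real_normed_vector \<Rightarrow> real"
  assumes "(f has_derivative f') (at (p + s *\<^sub>R v))"
  shows "((\<lambda>s. f (p + s *\<^sub>R v)) has_real_derivative f' v) (at s)"
proof -
  have "((\<lambda>s. p + s *\<^sub>R v) has_derivative (\<lambda>t. t *\<^sub>R v)) (at s)"
    by (auto intro!: derivative_eq_intros)
  from diff_chain_at[OF this assms] have "((\<lambda>s. f (p + s *\<^sub>R v)) has_derivative (\<lambda>t. f' (t *\<^sub>R v))) (at s)"
    by (simp add: o_def)
  moreover have "f' (t *\<^sub>R v) = f' v * t" for t
    using has_derivative_linear[OF assms] by (simp add: linear_scale mult.commute)
  ultimately show ?thesis by (simp add: has_field_derivative_def fun_eq_iff)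
qed

section \<open>Symmetry of second derivatives\<close>

lemma second_difference:
  fixes f :: "'a::euclidean_space \<Rightarrow> real"
  assumes U: "ball x r \<subseteq> U" "open U" "smooth_on U f"
    and h: "0 < h" "h * (norm v + norm w) < r"
  shows "\<exists>y. dist x y \<le> h * (norm v + norm w) \<and>
    f (x + h *\<^sub>R v + h *\<^sub>R w) - f (x + h *\<^sub>R v) - f (x + h *\<^sub>R w) + f x =
      h * h * fd (\<lambda>y. fd f y v) y w"
proof -
  have le: "dist x (x + s *\<^sub>R v + t *\<^sub>R w) \<le> h * (norm v + norm w)" if "0 \<le> s" "s \<le> h" "0 \<le> t" "t \<le> h" for s t
  proof -
    have "dist x (x + s *\<^sub>R v + t *\<^sub>R w) = norm (s *\<^sub>R v + t *\<^sub>R w)"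
      by (metis add.assoc add_diff_cancel_left' dist_commute dist_norm)
    also have "\<dots> \<le> s * norm v + t * norm w"
      using that norm_triangle_ineq[of "s *\<^sub>R v" "t *\<^sub>R w"] by simp
    also have "\<dots> \<le> h * norm v + h * norm w"
      using that by (intro add_mono mult_right_mono) auto
    finally show ?thesis by (simp add: distrib_left)
  qed
  then have inU: "x + s *\<^sub>R v + t *\<^sub>R w \<in> U" if "0 \<le> s" "s \<le> h" "0 \<le> t" "t \<le> h" for s t
    using that h(2) U(1) by (meson le_less_trans mem_ball subsetD)
  have d: "((\<lambda>s. f (x + t *\<^sub>R w + s *\<^sub>R v)) has_real_derivative fd f (x + t *\<^sub>R w + s *\<^sub>R v) v) (at s)"
    if "0 \<le> s" "s \<le> h" "0 \<le> t" "t \<le> h" for s t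
    using inU[OF that] U by (intro has_real_derivative_line smooth_on_has_derivative[of U]) (auto simp: add_ac)
  \<comment> \<open>The mean value theorem is applied in the direction \<open>v\<close> to the
    difference of \<open>f\<close> along two parallel edges, and afterwards in the direction
    \<open>w\<close> to the derivative so obtained.\<close>
  have "\<exists>\<xi>. 0 < \<xi> \<and> \<xi> < h \<and>
     (f (x + h *\<^sub>R w + h *\<^sub>R v) - f (x + 0 *\<^sub>R w + h *\<^sub>R v)) - (f (x + h *\<^sub>R w + 0 *\<^sub>R v) - f (x + 0 *\<^sub>R w + 0 *\<^sub>R v))
     = (h - 0) * (fd f (x + h *\<^sub>R w + \<xi> *\<^sub>R v) v - fd f (x + 0 *\<^sub>R w + \<xi> *\<^sub>R v) v)"
    by (rule MVT2[of 0 h "\<lambda>s. f (x + h *\<^sub>R w + s *\<^sub>R v) - f (x + 0 *\<^sub>R w + s *\<^sub>R v)"])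
      (use h(1) in \<open>auto intro!: DERIV_diff d d[of _ 0, simplified]\<close>)
  then obtain \<xi> where \<xi>: "0 < \<xi>" "\<xi> < h"
    "(f (x + h *\<^sub>R w + h *\<^sub>R v) - f (x + h *\<^sub>R v)) - (f (x + h *\<^sub>R w) - f x)
     = h * (fd f (x + h *\<^sub>R w + \<xi> *\<^sub>R v) v - fd f (x + \<xi> *\<^sub>R v) v)"
    by auto
  have d2: "((\<lambda>t. fd f (x + \<xi> *\<^sub>R v + t *\<^sub>R w) v) has_real_derivative fd (\<lambda>y. fd f y v) (x + \<xi> *\<^sub>R v + t *\<^sub>R w) w) (at t)"
    if "0 \<le> t" "t \<le> h" for t
    by (intro has_real_derivative_line smooth_on_has_derivative[OF smooth_on_frechet_derivative[OF U(3)] U(2)] inU)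
      (use that \<xi> in auto)
  have "\<exists>\<zeta>. 0 < \<zeta> \<and> \<zeta> < h \<and>
      fd f (x + \<xi> *\<^sub>R v + h *\<^sub>R w) v - fd f (x + \<xi> *\<^sub>R v + 0 *\<^sub>R w) v = (h - 0) * fd (\<lambda>y. fd f y v) (x + \<xi> *\<^sub>R v + \<zeta> *\<^sub>R w) w"
    by (rule MVT2[OF h(1) d2])
  then obtain \<zeta> where \<zeta>: "0 < \<zeta>" "\<zeta> < h"
      "fd f (x + \<xi> *\<^sub>R v + h *\<^sub>R w) v - fd f (x + \<xi> *\<^sub>R v) v = h * fd (\<lambda>y. fd f y v) (x + \<xi> *\<^sub>R v + \<zeta> *\<^sub>R w) w"
    by auto
  show ?thesis
  proof (intro exI[of _ "x + \<xi> *\<^sub>R v + \<zeta> *\<^sub>R w"] conjI)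
    show "dist x (x + \<xi> *\<^sub>R v + \<zeta> *\<^sub>R w) \<le> h * (norm v + norm w)"
      using \<xi> \<zeta> by (intro le) auto
    have comm: "x + h *\<^sub>R w + u = x + u + h *\<^sub>R w" for u by (simp add: add_ac)
    show "f (x + h *\<^sub>R v + h *\<^sub>R w) - f (x + h *\<^sub>R v) - f (x + h *\<^sub>R w) + f x =
        h * h * fd (\<lambda>y. fd f y v) (x + \<xi> *\<^sub>R v + \<zeta> *\<^sub>R w) w"
      using \<xi>(3) \<zeta>(3) unfolding comm by (simp add: mult.assoc)
  qed
qed

text \<open>The second difference over a parallelogram is symmetric in its two edges. By
  \<open>second_difference\<close> it equals either mixed derivative at some nearby point, and
  continuity carries the equality to \<open>x\<close>.\<close>

lemma symmetric_second_derivative_real: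
  fixes f :: "'a::euclidean_space \<Rightarrow> real"
  assumes U: "open U" "smooth_on U f" "x \<in> U"
  shows "fd (\<lambda>y. fd f y v) x w = fd (\<lambda>y. fd f y w) x v"
proof (rule ccontr)
  let ?G = "\<lambda>y. fd (\<lambda>y. fd f y v) y w" and ?H = "\<lambda>y. fd (\<lambda>y. fd f y w) y v"
  assume ne: "?G x \<noteq> ?H x"
  define e where "e = \<bar>?G x - ?H x\<bar> / 2"
  have e: "e > 0" using ne by (simp add: e_def)
  have cont: "isCont ?G x" "isCont ?H x"
    using U smooth_on_continuous[OF smooth_on_frechet_derivative[OF smooth_on_frechet_derivative[OF U(2)]]]
    by (auto simp: continuous_on_eq_continuous_at)
  obtain d1 where d1: "d1 > 0" "\<And>y. dist y x < d1 \<Longrightarrow> dist (?G y) (?G x) < e"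
    using cont(1) e unfolding continuous_at_eps_delta by blast
  obtain d2 where d2: "d2 > 0" "\<And>y. dist y x < d2 \<Longrightarrow> dist (?H y) (?H x) < e"
    using cont(2) e unfolding continuous_at_eps_delta by blast
  obtain r where r: "r > 0" "ball x r \<subseteq> U" using U open_contains_ball by blast
  define m where "m = min r (min d1 d2)"
  have m: "m > 0" "m \<le> r" "m \<le> d1" "m \<le> d2" using r d1 d2 by (auto simp: m_def)
  \<comment> \<open>The summand 1 keeps \<open>N\<close> positive when both vectors vanish; the
    factor 2 in \<open>h\<close> makes the later bound strict.\<close>
  define N where "N = norm v + norm w + 1"
  have N: "N > 0" by (simp add: N_def add_nonneg_pos)
  define h where "h = m / (2 * N)"
  have h: "h > 0" using m N by (simp add: h_def)
  have "h * (norm v + norm w) \<le> h * N" using h by (simp add: N_def)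
  also have "\<dots> = m / 2" using N by (simp add: h_def)
  also have "\<dots> < m" using m by simp
  finally have hm: "h * (norm v + norm w) < m" .
  obtain y where y: "dist x y \<le> h * (norm v + norm w)"
    "f (x + h *\<^sub>R v + h *\<^sub>R w) - f (x + h *\<^sub>R v) - f (x + h *\<^sub>R w) + f x = h * h * ?G y"
    using second_difference[OF r(2) U(1,2) h, of v w] hm m by fastforce
  obtain z where z: "dist x z \<le> h * (norm w + norm v)"
    "f (x + h *\<^sub>R w + h *\<^sub>R v) - f (x + h *\<^sub>R w) - f (x + h *\<^sub>R v) + f x = h * h * ?H z"
    using second_difference[OF r(2) U(1,2) h, of w v] hm m by (fastforce simp: add.commute)
  have comm: "x + h *\<^sub>R w + h *\<^sub>R v = x + h *\<^sub>R v + h *\<^sub>R w" by (simp add: add_ac)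
  have "h * h * ?G y = h * h * ?H z"
    using y(2) z(2)[unfolded comm] by linarith
  then have eq: "?G y = ?H z" using h by simp
  have "dist (?G y) (?G x) < e" using d1(2)[of y] y(1) hm m by (simp add: dist_commute)
  moreover have "dist (?H z) (?H x) < e" using d2(2)[of z] z(1) hm m by (simp add: dist_commute add.commute)
  ultimately show False using eq by (simp add: dist_real_def e_def) argo
qed

lemma fd_inner_const:
  assumes "smooth_on U f" "open U" "x \<in> U"
  shows "fd (\<lambda>y. f y \<bullet> w) x v = fd f x v \<bullet> w"
  using fd_eq[OF has_derivative_inner_left[OF smooth_on_has_derivative[OF assms]], of w] by simp

lemma symmetric_second_derivative:
  fixes f :: "'a::euclidean_space \<Rightarrow> 'b::euclidean_space"
  assumes U: "open U" "smooth_on U f" "x \<in> U"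
  shows "fd (\<lambda>y. fd f y v) x w = fd (\<lambda>y. fd f y w) x v"
proof (rule euclidean_eqI)
  fix b :: 'b
  have *: "fd (\<lambda>y. fd (\<lambda>z. f z \<bullet> b) y v) x w = fd (\<lambda>y. fd f y v) x w \<bullet> b" for v w
  proof -
    have "fd (\<lambda>y. fd (\<lambda>z. f z \<bullet> b) y v) x w = fd (\<lambda>y. fd f y v \<bullet> b) x w"
    proof (rule arg_cong[where f = "\<lambda>g. g w"], rule frechet_derivative_transform_within_open[OF _ U(1,3)])
      show "(\<lambda>y. fd (\<lambda>z. f z \<bullet> b) y v) differentiable at x"
        by (intro smooth_on_differentiable[OF smooth_on_frechet_derivative[OF smooth_on_inner]]) (use U in auto)
    qed (simp add: fd_inner_const[OF U(2,1)])
    then show ?thesis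
      using fd_inner_const[OF smooth_on_frechet_derivative[OF U(2)] U(1,3)] by simp
  qed
  show "fd (\<lambda>y. fd f y v) x w \<bullet> b = fd (\<lambda>y. fd f y w) x v \<bullet> b"
    using symmetric_second_derivative_real[OF U(1) smooth_on_inner[OF U(1,2) smooth_on_const] U(3), of b v w]
    by (simp only: *)
qed

text \<open>Symmetry of the second derivative of \<open>a\<close> puts \<open>X x\<close> into the
  outer slot, so the first summand is a derivative along \<open>X\<close> of a fixed-direction
  derivative of \<open>a\<close>. This is how \<open>d\<close> gets past the Lie derivative.\<close>

lemma fd_fd_field:
  fixes a :: "'a::euclidean_space \<Rightarrow> 'b::euclidean_space"
  assumes U: "open U" "smooth_on U a" "smooth_on U X" "x \<in> U"
  shows "((\<lambda>y. fd a y (X y)) has_derivative (\<lambda>v. fd (\<lambda>y. fd a y v) x (X x) + fd a x (fd X x v))) (at x)"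
proof -
  have 1: "((\<lambda>y. \<Sum>b\<in>Basis. (X y \<bullet> b) *\<^sub>R fd a y b) has_derivative
      (\<lambda>v. \<Sum>b\<in>Basis. (X x \<bullet> b) *\<^sub>R fd (\<lambda>y. fd a y b) x v + (fd X x v \<bullet> b) *\<^sub>R fd a x b)) (at x)"
    by (intro has_derivative_sum has_derivative_scaleR has_derivative_inner_left
        smooth_on_has_derivative[of U] smooth_on_frechet_derivative U)
  have "(\<Sum>b\<in>Basis. (X x \<bullet> b) *\<^sub>R fd (\<lambda>y. fd a y b) x v) = fd (\<lambda>y. fd a y v) x (X x)" for v
    unfolding linear_Basis_expand[OF smooth_on_linear[OF smooth_on_frechet_derivative[OF U(2)] U(1,4)], of v "X x"]
    by (intro sum.cong refl arg_cong2[where f = scaleR] symmetric_second_derivative[OF U(1,2,4)])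
  moreover have "(\<Sum>b\<in>Basis. (fd X x v \<bullet> b) *\<^sub>R fd a x b) = fd a x (fd X x v)" for v
    by (rule linear_Basis_expand[OF smooth_on_linear[OF U(2,1,4)], symmetric])
  ultimately have 2: "((\<lambda>y. \<Sum>b\<in>Basis. (X y \<bullet> b) *\<^sub>R fd a y b) has_derivative
      (\<lambda>v. fd (\<lambda>y. fd a y v) x (X x) + fd a x (fd X x v))) (at x)"
    using 1 by (simp only: sum.distrib)
  show ?thesis
    by (rule has_derivative_transform_within_open[OF 2 U(1,4)])
      (rule linear_Basis_expand[OF smooth_on_linear[OF U(2,1)], symmetric])
qed

text \<open>A one-form on an open set of Euclidean space is represented by the vector field \<open>a\<close> dual to it
  under the inner product; \<open>curl a\<close> is then its exterior derivative, and \<open>conformal_on U X a f\<close>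
  says that its Lie derivative along \<open>X\<close> is \<open>- f a\<close>.\<close>

definition covec :: "'a::euclidean_space \<Rightarrow> 'a list \<Rightarrow> real" where
  "covec a us = a \<bullet> us ! 0"

definition curl :: "('a::euclidean_space \<Rightarrow> 'a) \<Rightarrow> 'a \<Rightarrow> 'a list \<Rightarrow> real" where
  "curl a x us = fd a x (us ! 0) \<bullet> us ! 1 - fd a x (us ! 1) \<bullet> us ! 0"

definition vol :: "nat \<Rightarrow> ('a::euclidean_space \<Rightarrow> 'a) \<Rightarrow> 'a \<Rightarrow> 'a list \<Rightarrow> real" where
  "vol n a x = lvol n (covec (a x)) (curl a x)"

definition conformal_on :: "'a set \<Rightarrow> ('a::euclidean_space \<Rightarrow> 'a) \<Rightarrow> ('a \<Rightarrow> 'a) \<Rightarrow> ('a \<Rightarrow> real) \<Rightarrow> bool" where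
  "conformal_on U X a f \<longleftrightarrow>
    (\<forall>x\<in>U. \<forall>v. fd a x (X x) \<bullet> v + a x \<bullet> fd X x v = - f x * (a x \<bullet> v))"

lemma smooth_on_curl: "open U \<Longrightarrow> smooth_on U a \<Longrightarrow> smooth_on U (\<lambda>x. curl a x us)"
  unfolding curl_def by (intro smooth_on_diff smooth_on_inner smooth_on_frechet_derivative smooth_on_const)

lemma smooth_on_vol: "open U \<Longrightarrow> smooth_on U a \<Longrightarrow> smooth_on U (\<lambda>x. vol n a x us)"
  unfolding vol_def
  by (intro smooth_on_lvol smooth_on_curl) (auto simp: covec_def intro: smooth_on_inner)

lemma multilinear_covec: "multilinear 1 (covec a)"
  by (simp add: multilinear_def covec_def linear_iff inner_add_right)

lemma multilinear_2I:
  assumes "\<And>w. linear (\<lambda>v. B v w)" "\<And>v. linear (\<lambda>w. B v w)"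
  shows "multilinear 2 (\<lambda>us. B (us ! 0) (us ! 1))"
  unfolding multilinear_def
proof (intro allI impI)
  fix vs :: "'a list" and i :: nat
  assume "length vs = 2" "i < 2"
  then show "linear (\<lambda>v. B (vs[i := v] ! 0) (vs[i := v] ! 1))"
    using assms by (cases "i = 0") (auto simp: less_2_cases_iff)
qed

lemma multilinear_curl:
  assumes "a differentiable at x"
  shows "multilinear 2 (curl a x)"
proof -
  have l: "linear (fd a x)" using assms by (rule linear_frechet_derivative)
  have "multilinear 2 (\<lambda>us. fd a x (us ! 0) \<bullet> us ! 1 - fd a x (us ! 1) \<bullet> us ! 0)"
    by (rule multilinear_2I[where B = "\<lambda>v w. fd a x v \<bullet> w - fd a x w \<bullet> v"])
      (auto simp: linear_iff linear_add[OF l] linear_scale[OF l] inner_add_left inner_add_right algebra_simps)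
  then show ?thesis by (simp add: multilinear_def curl_def)
qed

text \<open>The rule \<open>L\<^sub>X d\<alpha> = - f d\<alpha> - df \<and> \<alpha>\<close> in
  coordinates; the two terms with \<open>fd X x\<close> are the difference between differentiating
  components along \<open>X\<close> and taking the Lie derivative. The conformal identity is
  differentiated in direction \<open>v\<close> and antisymmetrised in \<open>v\<close> and
  \<open>w\<close>, whereby the second derivatives of \<open>X\<close> cancel.\<close>

lemma curl_lie:
  assumes U: "open U" "x \<in> U" and sm: "smooth_on U a" "smooth_on U X" "smooth_on U f"
    and conf: "conformal_on U X a f"
  shows "fd (\<lambda>y. curl a y us) x (X x) =
     - curl a x [fd X x (us ! 0), us ! 1] - curl a x [us ! 0, fd X x (us ! 1)]
     - (fd f x (us ! 0) * (a x \<bullet> us ! 1) - fd f x (us ! 1) * (a x \<bullet> us ! 0)) - f x * curl a x us"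
proof -
  let ?A = "\<lambda>v w. fd (\<lambda>y. fd a y v) x w" and ?Y = "\<lambda>v w. fd (\<lambda>y. fd X y v) x w"
  note hd = smooth_on_has_derivative[OF _ U]
  have L: "?A v (X x) \<bullet> w + fd a x (fd X x v) \<bullet> w + fd a x v \<bullet> fd X x w + a x \<bullet> ?Y w v
      = - fd f x v * (a x \<bullet> w) - f x * (fd a x v \<bullet> w)" for v w
  proof -
    have l: "((\<lambda>y. fd a y (X y) \<bullet> w + a y \<bullet> fd X y w) has_derivative
      (\<lambda>v. (?A v (X x) + fd a x (fd X x v)) \<bullet> w + (a x \<bullet> ?Y w v + fd a x v \<bullet> fd X x w))) (at x)"
      by (intro has_derivative_add has_derivative_inner_left fd_fd_field[OF U(1) sm(1,2) U(2)]
          has_derivative_inner hd sm smooth_on_frechet_derivative)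
    have r: "((\<lambda>y. - f y * (a y \<bullet> w)) has_derivative
      (\<lambda>v. - f x * (fd a x v \<bullet> w) + - fd f x v * (a x \<bullet> w))) (at x)"
      by (intro has_derivative_mult has_derivative_minus has_derivative_inner_left hd sm)
    have "((\<lambda>y. fd a y (X y) \<bullet> w + a y \<bullet> fd X y w) has_derivative
      (\<lambda>v. - f x * (fd a x v \<bullet> w) + - fd f x v * (a x \<bullet> w))) (at x)"
      \<comment> \<open>Differentiating the identity is legitimate because it holds on all of the
        open set \<open>U\<close>.\<close>
      by (rule has_derivative_transform_within_open[OF r U]) (use conf in \<open>auto simp: conformal_on_def\<close>)
    from fun_cong[OF has_derivative_unique[OF l this], of v]
    show ?thesis by (simp add: inner_add_left)
  qed
  have "((\<lambda>y. curl a y us) has_derivative (\<lambda>u. ?A (us ! 0) u \<bullet> us ! 1 - ?A (us ! 1) u \<bullet> us ! 0)) (at x)"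
    unfolding curl_def
    by (intro has_derivative_diff has_derivative_inner_left hd smooth_on_frechet_derivative sm)
  then have "fd (\<lambda>y. curl a y us) x (X x) = ?A (us ! 0) (X x) \<bullet> us ! 1 - ?A (us ! 1) (X x) \<bullet> us ! 0"
    by (simp add: fd_eq)
  then show ?thesis
    using L[of "us ! 0" "us ! 1"] L[of "us ! 1" "us ! 0"]
      symmetric_second_derivative[OF U(1) sm(2) U(2), of "us ! 0" "us ! 1"]
    by (simp add: curl_def algebra_simps)
qed

text \<open>Along the line through \<open>x\<close> in direction \<open>X x\<close>, the forms \<open>\<alpha>\<close> and \<open>d\<alpha>\<close> have the same 1-jets as
  \<open>(1 - s f) g\<^sub>s\<^sup>*\<alpha>\<close> and \<open>(1 - s f) g\<^sub>s\<^sup>*d\<alpha> - s df \<and> (1 - s f) g\<^sub>s\<^sup>*\<alpha>\<close> with \<open>g\<^sub>s = 1 - s DX\<close>. The volume of the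
  latter pair is explicit because the wedge with \<open>\<alpha>\<close> drops out.\<close>

lemma vol_transport:
  fixes a :: "'a::euclidean_space \<Rightarrow> 'a"
  assumes U: "open U" "x \<in> U" and sm: "smooth_on U a" "smooth_on U X" "smooth_on U f"
    and conf: "conformal_on U X a f" and dim: "DIM('a) = 2 * n + 1" and bs: "length bs = 2 * n + 1"
  obtains D where
    "((\<lambda>s. vol n a (x + s *\<^sub>R X x) bs) has_real_derivative D) (at 0)"
    "((\<lambda>s. (1 - s * f x) ^ (n + 1) * vol n a x (map (\<lambda>u. u - s *\<^sub>R fd X x u) bs)) has_real_derivative D) (at 0)"
proof -
  define g where "g s u = u - s *\<^sub>R fd X x u" for s u
  define B where "B s u = (1 - s * f x) * (a x \<bullet> g s u)" for s u
  define \<upsilon> where "\<upsilon> s us = (1 - s * f x) * curl a x [g s (us ! 0), g s (us ! 1)]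
    - s * (fd f x (us ! 0) * B s (us ! 1) - fd f x (us ! 1) * B s (us ! 0))" for s us
  let ?a' = "\<lambda>us. - f x * (a x \<bullet> us ! 0) - a x \<bullet> fd X x (us ! 0)"
  have lin: "linear (fd a x)" "linear (fd X x)" "linear (fd f x)"
    using smooth_on_linear[OF _ U] sm by auto
  have g: "linear (g s)" for s
    using lin(2) by (simp add: g_def linear_iff algebra_simps)
  have Blin: "linear (B s)" for s
    using g[of s] by (simp add: B_def linear_iff algebra_simps)
  have curlD: "((\<lambda>y. curl a y us) has_derivative fd (\<lambda>y. curl a y us) x) (at (x + 0 *\<^sub>R X x))" for us
    using smooth_on_has_derivative[OF smooth_on_curl[OF U(1) sm(1)] U] by simp
  have covD: "((\<lambda>y. covec (a y) us) has_derivative (\<lambda>v. fd a x v \<bullet> us ! 0)) (at (x + 0 *\<^sub>R X x))" for us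
    unfolding covec_def using has_derivative_inner_left[OF smooth_on_has_derivative[OF sm(1) U]] by simp
  have conf': "fd a x (X x) \<bullet> v = - f x * (a x \<bullet> v) - a x \<bullet> fd X x v" for v
    using conf U(2) unfolding conformal_on_def by (metis add_diff_cancel_right')
  have gd: "((\<lambda>s. w \<bullet> g s u) has_real_derivative - (w \<bullet> fd X x u)) (at s)" for w u s
    unfolding g_def inner_diff_right inner_scaleR_right
    by (auto intro!: derivative_eq_intros)
  obtain D where D:
    "((\<lambda>s. lvol n (covec (a (x + s *\<^sub>R X x))) (curl a (x + s *\<^sub>R X x)) bs) has_real_derivative D) (at 0)"
    "((\<lambda>s. lvol n (\<lambda>us. B s (us ! 0)) (\<upsilon> s) bs) has_real_derivative D) (at 0)"
  proof (rule lvol_has_same_derivative)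
    show "covec (a (x + 0 *\<^sub>R X x)) = (\<lambda>us. B 0 (us ! 0))"
      by (auto simp: covec_def B_def g_def)
    show "curl a (x + 0 *\<^sub>R X x) = \<upsilon> 0"
      by (auto simp: curl_def \<upsilon>_def g_def)
    show "((\<lambda>s. covec (a (x + s *\<^sub>R X x)) us) has_real_derivative ?a' us) (at 0)" for us
      using has_real_derivative_line[OF covD] by (simp only: conf')
    show "((\<lambda>s. B s (us ! 0)) has_real_derivative ?a' us) (at 0)" for us
      unfolding B_def by (rule derivative_eq_intros gd refl)+ (simp add: g_def)
    show "((\<lambda>s. curl a (x + s *\<^sub>R X x) us) has_real_derivative fd (\<lambda>y. curl a y us) x (X x)) (at 0)" for us
      by (rule has_real_derivative_line[OF curlD])
    \<comment> \<open>Quadratic in \<open>s\<close>: the linear coefficient produces the two terms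
      with \<open>fd X x\<close> of \<open>curl_lie\<close>, and the quadratic term has derivative 0
      at \<open>s = 0\<close>.\<close>
    have curl_g: "curl a x [g s u, g s w] = curl a x [u, w] - s * (curl a x [fd X x u, w] + curl a x [u, fd X x w])
        + s * s * curl a x [fd X x u, fd X x w]" for s u w
      by (simp add: curl_def g_def linear_diff[OF lin(1)] linear_scale[OF lin(1)] inner_diff_left inner_diff_right algebra_simps)
    show "((\<lambda>s. \<upsilon> s us) has_real_derivative fd (\<lambda>y. curl a y us) x (X x)) (at 0)" for us
      unfolding \<upsilon>_def B_def curl_g curl_lie[OF U sm conf]
      by (rule derivative_eq_intros gd refl)+ (simp add: g_def curl_def)
  qed
  have "lvol n (\<lambda>us. B s (us ! 0)) (\<upsilon> s) bs = (1 - s * f x) ^ (n + 1) * vol n a x (map (g s) bs)" for s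
  proof -
    have l2: "multilinear 2 (\<lambda>us. (1 - s * f x) * curl a x [g s (us ! 0), g s (us ! 1)])"
      using g[of s] lin(1)
      by (intro multilinear_2I) (simp_all add: curl_def linear_iff inner_add_left inner_add_right algebra_simps)
    have "multilinear 2 (\<lambda>us. s * (fd f x (us ! 0) * B s (us ! 1) - fd f x (us ! 1) * B s (us ! 0)))"
      using Blin[of s] lin(3) by (intro multilinear_2I) (simp_all add: linear_iff algebra_simps)
    from multilinear_diff[OF l2 this, of 1 1] have l1: "multilinear 2 (\<upsilon> s)"
      unfolding \<upsilon>_def by simp
    have "lvol n (\<lambda>us. B s (us ! 0)) (\<upsilon> s) bs =
      lvol n (\<lambda>us. B s (us ! 0)) (\<lambda>us. (1 - s * f x) * curl a x [g s (us ! 0), g s (us ! 1)]) bs"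
    \<comment> \<open>Each term of the correction in \<open>\<upsilon>\<close> contains a value of
      \<open>B s\<close>, so the correction vanishes on pairs from its kernel.\<close>
    proof (rule lvol_cong_kernel[OF Blin dim l1 l2 _ bs])
      fix us :: "'a list" assume "length us = 2" "\<And>u. u \<in> set us \<Longrightarrow> B s u = 0"
      then show "\<upsilon> s us = (1 - s * f x) * curl a x [g s (us ! 0), g s (us ! 1)]"
        by (simp add: \<upsilon>_def)
    qed
    also have "\<dots> = (1 - s * f x) ^ (n + 1) *
        lvol n (\<lambda>us. a x \<bullet> g s (us ! 0)) (\<lambda>us. curl a x [g s (us ! 0), g s (us ! 1)]) bs"
      unfolding B_def by (rule lvol_scale)
    also have "lvol n (\<lambda>us. a x \<bullet> g s (us ! 0)) (\<lambda>us. curl a x [g s (us ! 0), g s (us ! 1)]) bs =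
        lvol n (\<lambda>us. covec (a x) (map (g s) us)) (\<lambda>us. curl a x (map (g s) us)) bs"
      by (rule lvol_cong[OF bs]) (simp_all add: covec_def curl_def)
    also have "\<dots> = vol n a x (map (g s) bs)"
      unfolding vol_def by (rule lvol_map[OF bs, symmetric])
    finally show ?thesis .
  qed
  with D(2) have "((\<lambda>s. (1 - s * f x) ^ (n + 1) * vol n a x (map (g s) bs)) has_real_derivative D) (at 0)"
    by (simp only:)
  moreover have "g s = (\<lambda>u. u - s *\<^sub>R fd X x u)" for s
    by (simp add: g_def fun_eq_iff)
  ultimately show thesis
    using D(1) by (intro that[of D]) (simp_all only: vol_def)
qed

text \<open>Along the line in direction \<open>X x\<close>, both volumes vary to first order as
  explicit powers times the volumes at \<open>x\<close> evaluated on a moved list. Cross-multiplying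
  by the two powers relates the derivatives \<open>D\<close> and \<open>E\<close> of the volumes,
  and the quotient rule turns this relation into the derivative of \<open>\<rho>\<close>.\<close>

lemma vol_ratio:
  fixes a h X :: "'a::euclidean_space \<Rightarrow> 'a"
  assumes U: "open U" and sm: "smooth_on U a" "smooth_on U h" "smooth_on U X" "smooth_on U f" "smooth_on U k"
    and conf: "conformal_on U X a f" "conformal_on U X h k"
    and dim: "DIM('a) = 2 * n + 1" and bs: "length bs = 2 * n + 1"
    and nz: "\<And>y. y \<in> U \<Longrightarrow> vol n h y bs \<noteq> 0"
    and \<rho>: "\<And>y vs. y \<in> U \<Longrightarrow> length vs = 2 * n + 1 \<Longrightarrow> vol n a y vs = \<rho> y * vol n h y vs"
  shows "smooth_on U \<rho>"
    and "x \<in> U \<Longrightarrow> fd \<rho> x (X x) = (real n + 1) * (k x - f x) * \<rho> x"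
proof -
  have \<rho>': "\<rho> y = vol n a y bs / vol n h y bs" if "y \<in> U" for y
    using \<rho>[OF that bs] nz[OF that] by simp
  have "smooth_on U (\<lambda>y. vol n a y bs / vol n h y bs)"
    by (intro smooth_on_divide smooth_on_vol U sm nz)
  then show sm\<rho>: "smooth_on U \<rho>"
    using smooth_on_cong[OF U, of \<rho> "\<lambda>y. vol n a y bs / vol n h y bs"] \<rho>' by simp
  assume x: "x \<in> U"
  let ?G = "\<lambda>s. map (\<lambda>u. u - s *\<^sub>R fd X x u) bs"
  obtain D where D: "((\<lambda>s. vol n a (x + s *\<^sub>R X x) bs) has_real_derivative D) (at 0)"
    "((\<lambda>s. (1 - s * f x) ^ (n + 1) * vol n a x (?G s)) has_real_derivative D) (at 0)"
    by (rule vol_transport[OF U x sm(1,3,4) conf(1) dim bs])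
  obtain E where E: "((\<lambda>s. vol n h (x + s *\<^sub>R X x) bs) has_real_derivative E) (at 0)"
    "((\<lambda>s. (1 - s * k x) ^ (n + 1) * vol n h x (?G s)) has_real_derivative E) (at 0)"
    by (rule vol_transport[OF U x sm(2,3,5) conf(2) dim bs])
  have pw: "((\<lambda>s. (1 - s * c) ^ (n + 1)) has_real_derivative - ((real n + 1) * c)) (at 0)" for c :: real
    by (rule derivative_eq_intros refl)+ simp
  have l: "((\<lambda>s. (1 - s * k x) ^ (n + 1) * ((1 - s * f x) ^ (n + 1) * vol n a x (?G s))) has_real_derivative
      - ((real n + 1) * k x) * vol n a x bs + D) (at 0)"
    using DERIV_mult[OF pw[of "k x"] D(2)] by simp
  have r: "((\<lambda>s. (1 - s * f x) ^ (n + 1) * ((1 - s * k x) ^ (n + 1) * vol n h x (?G s)) * \<rho> x) has_real_derivative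
      (- ((real n + 1) * f x) * vol n h x bs + E) * \<rho> x) (at 0)"
    using DERIV_cmult_right[OF DERIV_mult[OF pw[of "f x"] E(2)], of "\<rho> x"] by simp
  \<comment> \<open>Here the base point stays at \<open>x\<close> and only the list moves, so the
    ratio of the volumes is the constant \<open>\<rho> x\<close>.\<close>
  have "(\<lambda>s. (1 - s * k x) ^ (n + 1) * ((1 - s * f x) ^ (n + 1) * vol n a x (?G s))) =
    (\<lambda>s. (1 - s * f x) ^ (n + 1) * ((1 - s * k x) ^ (n + 1) * vol n h x (?G s)) * \<rho> x)"
    using \<rho>[OF x, of "?G _"] bs by (simp add: fun_eq_iff)
  with r have r': "((\<lambda>s. (1 - s * k x) ^ (n + 1) * ((1 - s * f x) ^ (n + 1) * vol n a x (?G s))) has_real_derivative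
      (- ((real n + 1) * f x) * vol n h x bs + E) * \<rho> x) (at 0)" by (simp only:)
  have DE: "- ((real n + 1) * k x) * vol n a x bs + D = (- ((real n + 1) * f x) * vol n h x bs + E) * \<rho> x"
    by (rule DERIV_unique[OF l r'])
  have "((\<lambda>s. vol n a (x + s *\<^sub>R X x) bs / vol n h (x + s *\<^sub>R X x) bs) has_real_derivative
      (D * vol n h x bs - vol n a x bs * E) / (vol n h x bs * vol n h x bs)) (at 0)"
    using DERIV_divide[OF D(1) E(1)] nz[OF x] by simp
  \<comment> \<open>\<open>\<rho>\<close> is a quotient of volumes on \<open>U\<close> only, which
    the line leaves for large \<open>s\<close>.\<close>
  moreover have "eventually (\<lambda>s. x + s *\<^sub>R X x \<in> U) (nhds 0)"
  proof -
    have "((\<lambda>s::real. x + s *\<^sub>R X x) \<longlongrightarrow> x + 0 *\<^sub>R X x) (nhds 0)"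
      by (intro tendsto_intros filterlim_ident)
    then show ?thesis using topological_tendstoD[OF _ U, of "\<lambda>s::real. x + s *\<^sub>R X x" x] x by simp
  qed
  then have "eventually (\<lambda>s. \<rho> (x + s *\<^sub>R X x) = vol n a (x + s *\<^sub>R X x) bs / vol n h (x + s *\<^sub>R X x) bs) (nhds 0)"
    by (rule eventually_mono) (rule \<rho>')
  ultimately have d: "((\<lambda>s. \<rho> (x + s *\<^sub>R X x)) has_real_derivative
      (D * vol n h x bs - vol n a x bs * E) / (vol n h x bs * vol n h x bs)) (at 0)"
    by (simp add: DERIV_cong_ev)
  have "((\<lambda>s. \<rho> (x + s *\<^sub>R X x)) has_real_derivative fd \<rho> x (X x)) (at 0)"
    using has_real_derivative_line[of \<rho> "fd \<rho> x" x 0 "X x"] smooth_on_has_derivative[OF sm\<rho> U x] by simp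
  then have "fd \<rho> x (X x) = (D * vol n h x bs - vol n a x bs * E) / (vol n h x bs * vol n h x bs)"
    by (rule DERIV_unique[OF _ d])
  also have "\<dots> = (real n + 1) * (k x - f x) * \<rho> x"
  proof -
    have a: "vol n a x bs = \<rho> x * vol n h x bs" by (rule \<rho>[OF x bs])
    have D_eq: "D = (- ((real n + 1) * f x) * vol n h x bs + E) * \<rho> x + ((real n + 1) * k x) * (\<rho> x * vol n h x bs)"
      using DE a by simp
    have "D * vol n h x bs - vol n a x bs * E =
        (real n + 1) * (k x - f x) * \<rho> x * (vol n h x bs * vol n h x bs)"
      unfolding D_eq a by (simp add: algebra_simps)
    then show ?thesis using nz[OF x] by simp
  qed
  finally show "fd \<rho> x (X x) = (real n + 1) * (k x - f x) * \<rho> x" .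
qed

text \<open>Naturality of \<open>d\<close> under pullback: differentiating
  \<open>c (\<phi> y) \<bullet> fd \<phi> y w\<close> leaves second derivatives of
  \<open>\<phi>\<close>, which cancel on antisymmetrising. Used with a transition map for
  \<open>\<phi>\<close>, and with \<open>\<Phi>\<close> read in charts.\<close>

lemma pullback_field:
  fixes a :: "'a::euclidean_space \<Rightarrow> 'a" and c :: "'b::euclidean_space \<Rightarrow> 'b"
  assumes U: "open U" "open V" and \<phi>: "smooth_on U \<phi>" "\<phi> ` U \<subseteq> V" and c: "smooth_on V c"
    and eq: "\<And>y v. y \<in> U \<Longrightarrow> a y \<bullet> v = c (\<phi> y) \<bullet> fd \<phi> y v"
  shows "smooth_on U a"
    and "x \<in> U \<Longrightarrow> curl a x [v, w] = curl c (\<phi> x) [fd \<phi> x v, fd \<phi> x w]"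
proof -
  have c\<phi>: "smooth_on U (\<lambda>y. c (\<phi> y))"
    by (rule smooth_on_compose[OF U c \<phi>])
  have S: "smooth_on U (\<lambda>y. \<Sum>b\<in>Basis. (c (\<phi> y) \<bullet> fd \<phi> y b) *\<^sub>R b)"
    by (intro smooth_on_sum smooth_on_scaleR smooth_on_inner smooth_on_frechet_derivative c\<phi> \<phi> U smooth_on_const)
  have E: "a y = (\<Sum>b\<in>Basis. (c (\<phi> y) \<bullet> fd \<phi> y b) *\<^sub>R b)" if "y \<in> U" for y
    using euclidean_representation[of "a y"] eq[OF that] by simp
  show sma: "smooth_on U a"
    by (rule iffD2[OF smooth_on_cong[OF U(1)] S]) (rule E)
  assume x: "x \<in> U"
  note hd = smooth_on_has_derivative[OF _ U(1) x]
  have d: "fd a x v \<bullet> w = c (\<phi> x) \<bullet> fd (\<lambda>y. fd \<phi> y w) x v + fd c (\<phi> x) (fd \<phi> x v) \<bullet> fd \<phi> x w" for v w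
  proof -
    have "(c has_derivative fd c (\<phi> x)) (at (\<phi> x))"
      using smooth_on_has_derivative[OF c U(2)] \<phi>(2) x by blast
    from diff_chain_at[OF hd[OF \<phi>(1)] this]
    have "((\<lambda>y. c (\<phi> y)) has_derivative (\<lambda>v. fd c (\<phi> x) (fd \<phi> x v))) (at x)" by (simp add: o_def)
    from has_derivative_inner[OF this hd[OF smooth_on_frechet_derivative[OF \<phi>(1)]]]
    have 1: "((\<lambda>y. c (\<phi> y) \<bullet> fd \<phi> y w) has_derivative
      (\<lambda>v. c (\<phi> x) \<bullet> fd (\<lambda>y. fd \<phi> y w) x v + fd c (\<phi> x) (fd \<phi> x v) \<bullet> fd \<phi> x w)) (at x)" .
    have "((\<lambda>y. a y \<bullet> w) has_derivative
      (\<lambda>v. c (\<phi> x) \<bullet> fd (\<lambda>y. fd \<phi> y w) x v + fd c (\<phi> x) (fd \<phi> x v) \<bullet> fd \<phi> x w)) (at x)"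
      by (rule has_derivative_transform_within_open[OF 1 U(1) x]) (simp add: eq)
    from fd_eq[OF this] show ?thesis using fd_inner_const[OF sma U(1) x] by metis
  qed
  show "curl a x [v, w] = curl c (\<phi> x) [fd \<phi> x v, fd \<phi> x w]"
    using symmetric_second_derivative[OF U(1) \<phi>(1) x, of v w] by (simp add: curl_def d)
qed


section \<open>One-forms on a manifold\<close>

lemma points_eq [simp]: "topspace (topo M) = points M"
  by (simp add: points_def)

definition vf_coord :: "('m \<Rightarrow> ('m, 'e) tvec) \<Rightarrow> ('m, 'e) chart \<Rightarrow> 'e \<Rightarrow> 'e" where
  "vf_coord X c x = X (chart_inv c x) c"

locale smooth_mfd =
  fixes M :: "('m, 'e::euclidean_space) manifold"
  assumes smooth_manifold: "smooth_manifold M"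
begin

definition form_vec :: "('m, 'e) chart \<Rightarrow> ('m, 'e) form \<Rightarrow> 'e \<Rightarrow> 'e" where
  "form_vec c \<alpha> x = (\<Sum>b\<in>Basis. coord_form M c \<alpha> x [b] *\<^sub>R b)"

section \<open>Charts, transition maps and tangent vectors\<close>

lemma chart_facts:
  assumes "c \<in> atlas M"
  shows "openin (topo M) (fst c)" "open (snd c ` fst c)" "inj_on (snd c) (fst c)" "fst c \<subseteq> points M"
    "homeomorphic_map (subtopology (topo M) (fst c)) (top_of_set (snd c ` fst c)) (snd c)"
proof -
  have c: "is_chart (topo M) c" using assms smooth_manifold by (simp add: smooth_manifold_def)
  then show *: "openin (topo M) (fst c)" "open (snd c ` fst c)"
    "homeomorphic_map (subtopology (topo M) (fst c)) (top_of_set (snd c ` fst c)) (snd c)"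
    by (simp_all add: is_chart_def)
  show "fst c \<subseteq> points M" using openin_subset[OF *(1)] by simp
  then show "inj_on (snd c) (fst c)"
    using homeomorphic_imp_injective_map[OF *(3)] by (simp add: topspace_subtopology inf_absorb2)
qed

lemma charts_atD: "c \<in> charts_at M p \<Longrightarrow> c \<in> atlas M" "c \<in> charts_at M p \<Longrightarrow> p \<in> fst c"
  by (auto simp: charts_at_def)

lemma charts_atI: "c \<in> atlas M \<Longrightarrow> p \<in> fst c \<Longrightarrow> c \<in> charts_at M p"
  by (simp add: charts_at_def)

lemma charts_at_points: "c \<in> charts_at M p \<Longrightarrow> p \<in> points M"
  using charts_atD chart_facts by blast

lemma some_chart_in: "p \<in> points M \<Longrightarrow> some_chart M p \<in> charts_at M p"
proof -
  assume "p \<in> points M"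
  then have "p \<in> (\<Union>c\<in>atlas M. fst c)" using smooth_manifold by (simp add: smooth_manifold_def)
  then have "\<exists>c. c \<in> charts_at M p" by (auto simp: charts_at_def)
  then show ?thesis unfolding some_chart_def by (rule someI_ex)
qed

lemma chart_inv_chart [simp]: "c \<in> atlas M \<Longrightarrow> p \<in> fst c \<Longrightarrow> chart_inv c (snd c p) = p"
  by (simp add: chart_inv_def chart_facts)

lemma chart_chart_inv [simp]: "x \<in> snd c ` fst c \<Longrightarrow> snd c (chart_inv c x) = x"
  by (simp add: chart_inv_def f_inv_into_f)

lemma chart_inv_in [simp]: "x \<in> snd c ` fst c \<Longrightarrow> chart_inv c x \<in> fst c"
  by (simp add: chart_inv_def inv_into_into)

lemma chart_inv_charts_at: "c \<in> atlas M \<Longrightarrow> x \<in> snd c ` fst c \<Longrightarrow> c \<in> charts_at M (chart_inv c x)"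
  by (simp add: charts_atI)

lemma open_chart_image:
  assumes c: "c \<in> atlas M" and W: "openin (topo M) W"
  shows "open (snd c ` (fst c \<inter> W))"
proof -
  have "openin (subtopology (topo M) (fst c)) (fst c \<inter> W)"
    using W by (auto simp: openin_subtopology)
  then have "openin (top_of_set (snd c ` fst c)) (snd c ` (fst c \<inter> W))"
    using homeomorphic_imp_open_map[OF chart_facts(5)[OF c]] by (simp add: open_map_def)
  then show ?thesis using chart_facts(2)[OF c] by (simp add: openin_open_eq)
qed

lemma open_overlap: "c \<in> atlas M \<Longrightarrow> c' \<in> atlas M \<Longrightarrow> open (snd c ` (fst c \<inter> fst c'))"
  by (rule open_chart_image) (use chart_facts in auto)

lemma smooth_transition:
  "c \<in> atlas M \<Longrightarrow> c' \<in> atlas M \<Longrightarrow> smooth_on (snd c ` (fst c \<inter> fst c')) (transition c c')"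
  using smooth_manifold unfolding smooth_manifold_def by blast

lemma transition_in_overlap:
  assumes "c \<in> atlas M" "c' \<in> atlas M" "x \<in> snd c ` (fst c \<inter> fst c')"
  shows "transition c c' x \<in> snd c' ` fst c'" "chart_inv c' (transition c c' x) = chart_inv c x"
    "chart_inv c x \<in> fst c'"
  using assms by (auto simp: transition_def)

lemma transition_has_derivative:
  assumes "c \<in> charts_at M p" "c' \<in> charts_at M p"
  shows "(transition c c' has_derivative fd (transition c c') (snd c p)) (at (snd c p))"
  using assms charts_atD
  by (intro smooth_on_has_derivative[OF smooth_transition open_overlap]) blast+

lemma transition_at: "c \<in> charts_at M p \<Longrightarrow> transition c c' (snd c p) = snd c' p"
  using charts_atD by (simp add: transition_def)

text \<open>It lets the differential of a function and \<open>tangent_map\<close>, both defined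
  through \<open>some_chart\<close>, be computed in any chart.\<close>

lemma chart_change_has_derivative:
  fixes f :: "'m \<Rightarrow> 'b::real_normed_vector"
  assumes c: "c \<in> charts_at M p" "c' \<in> charts_at M p"
    and f: "(f \<circ> chart_inv c') differentiable at (snd c' p)"
  shows "((f \<circ> chart_inv c) has_derivative
    (\<lambda>v. fd (f \<circ> chart_inv c') (snd c' p) (fd (transition c c') (snd c p) v))) (at (snd c p))"
proof -
  have "((f \<circ> chart_inv c') has_derivative fd (f \<circ> chart_inv c') (snd c' p)) (at (transition c c' (snd c p)))"
    using f c by (simp add: frechet_derivative_works transition_at)
  from diff_chain_at[OF transition_has_derivative[OF c] this]
  have 1: "((f \<circ> chart_inv c' \<circ> transition c c') has_derivative
     (\<lambda>v. fd (f \<circ> chart_inv c') (snd c' p) (fd (transition c c') (snd c p) v))) (at (snd c p))"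
    by (simp add: o_def)
  show ?thesis
  proof (rule has_derivative_transform_within_open[OF 1])
    show "open (snd c ` (fst c \<inter> fst c'))" "snd c p \<in> snd c ` (fst c \<inter> fst c')"
      using c charts_atD open_overlap by auto
    show "(f \<circ> chart_inv c' \<circ> transition c c') x = (f \<circ> chart_inv c) x"
      if "x \<in> snd c ` (fst c \<inter> fst c')" for x
      using transition_in_overlap[OF charts_atD(1)[OF c(1)] charts_atD(1)[OF c(2)] that] by simp
  qed
qed

lemma transition_chain:
  assumes "c \<in> charts_at M p" "c' \<in> charts_at M p" "c'' \<in> charts_at M p"
  shows "fd (transition c c'') (snd c p) v = fd (transition c' c'') (snd c' p) (fd (transition c c') (snd c p) v)"
proof -
  have "(snd c'' \<circ> chart_inv c') differentiable at (snd c' p)"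
    using transition_has_derivative[OF assms(2,3)] unfolding transition_def by (rule differentiableI)
  from fd_eq[OF chart_change_has_derivative[OF assms(1,2) this]]
  show ?thesis by (simp add: transition_def)
qed

lemma transition_self: "c \<in> charts_at M p \<Longrightarrow> fd (transition c c) (snd c p) v = v"
proof -
  assume c: "c \<in> charts_at M p"
  have 1: "((\<lambda>x. x) has_derivative (\<lambda>v. v)) (at (snd c p))" by (rule has_derivative_ident)
  have "(transition c c has_derivative (\<lambda>v. v)) (at (snd c p))"
  proof (rule has_derivative_transform_within_open[OF 1])
    show "open (snd c ` fst c)" "snd c p \<in> snd c ` fst c"
      using charts_atD[OF c] chart_facts(2) by blast+
  qed (simp add: transition_def)
  then show ?thesis using fd_eq by metis
qed

lemma linear_transition:
  "c \<in> charts_at M p \<Longrightarrow> c' \<in> charts_at M p \<Longrightarrow> linear (fd (transition c c') (snd c p))"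
  using transition_has_derivative has_derivative_linear by blast

lemma coord_tvec_self [simp]: "c \<in> charts_at M p \<Longrightarrow> coord_tvec M c p w c = w"
  by (simp add: coord_tvec_def transition_self)

lemma coord_tvec_in: "c \<in> charts_at M p \<Longrightarrow> coord_tvec M c p w \<in> tangent_space M p"
  unfolding tangent_space_def coord_tvec_def by (auto intro: transition_chain)

lemma tangent_space_chart:
  "v \<in> tangent_space M p \<Longrightarrow> c \<in> charts_at M p \<Longrightarrow> c' \<in> charts_at M p \<Longrightarrow>
    fd (transition c c') (snd c p) (v c) = v c'"
  by (rule sym) (unfold tangent_space_def, blast)

lemma tangent_space_outside: "v \<in> tangent_space M p \<Longrightarrow> c \<notin> charts_at M p \<Longrightarrow> v c = 0"
  unfolding tangent_space_def by blast

lemma coord_tvec_of: "v \<in> tangent_space M p \<Longrightarrow> c \<in> charts_at M p \<Longrightarrow> coord_tvec M c p (v c) = v"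
  unfolding coord_tvec_def
  by (rule ext) (simp add: tangent_space_chart tangent_space_outside)

lemma tangent_space_eqI:
  "v \<in> tangent_space M p \<Longrightarrow> w \<in> tangent_space M p \<Longrightarrow> c \<in> charts_at M p \<Longrightarrow> v c = w c \<Longrightarrow> v = w"
  using coord_tvec_of by metis

lemma tangent_space_lincomb:
  assumes "u \<in> tangent_space M p" "w \<in> tangent_space M p"
  shows "(\<lambda>c. r *\<^sub>R u c + s *\<^sub>R w c) \<in> tangent_space M p"
proof -
  have "r *\<^sub>R u c' + s *\<^sub>R w c' = fd (transition c c') (snd c p) (r *\<^sub>R u c + s *\<^sub>R w c)"
    if "c \<in> charts_at M p" "c' \<in> charts_at M p" for c c'
    using linear_transition[OF that] assms that
    by (simp add: linear_add linear_scale tangent_space_chart)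
  moreover have "r *\<^sub>R u c + s *\<^sub>R w c = 0" if "c \<notin> charts_at M p" for c
    using tangent_space_outside[OF assms(1) that] tangent_space_outside[OF assms(2) that] by simp
  ultimately show ?thesis
    unfolding tangent_space_def by blast
qed

lemma coord_tvec_lincomb:
  "c \<in> charts_at M p \<Longrightarrow> coord_tvec M c p (r *\<^sub>R v + s *\<^sub>R w) =
    (\<lambda>d. r *\<^sub>R coord_tvec M c p v d + s *\<^sub>R coord_tvec M c p w d)"
  by (rule tangent_space_eqI[of _ p _ c]) (simp_all add: coord_tvec_in tangent_space_lincomb)

section \<open>One-forms and exterior derivatives in a chart\<close>

definition linear_form :: "('m, 'e) form \<Rightarrow> bool" where
  "linear_form \<alpha> \<longleftrightarrow> (\<forall>p\<in>points M. \<forall>u\<in>tangent_space M p. \<forall>w\<in>tangent_space M p. \<forall>r s.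
     \<alpha> p [\<lambda>c. r *\<^sub>R u c + s *\<^sub>R w c] = r * \<alpha> p [u] + s * \<alpha> p [w])"

lemma smooth_form_1_iff:
  "smooth_form M 1 \<alpha> \<longleftrightarrow> linear_form \<alpha> \<and>
     (\<forall>c\<in>atlas M. \<forall>w. smooth_on (snd c ` fst c) (\<lambda>x. coord_form M c \<alpha> x [w]))"
proof
  assume a: "smooth_form M 1 \<alpha>"
  have "linear_form \<alpha>"
    unfolding linear_form_def
  proof (intro ballI allI)
    fix p u w r s
    assume *: "p \<in> points M" "u \<in> tangent_space M p" "w \<in> tangent_space M p"
    then have l: "[u] \<in> tangent_lists M p 1" by (simp add: tangent_lists_def)
    have "\<alpha> p ([u][0 := (\<lambda>c. r *\<^sub>R u c + s *\<^sub>R w c)]) = r * \<alpha> p ([u][0 := u]) + s * \<alpha> p ([u][0 := w])"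
      using conjunct1[OF bspec[OF bspec[OF conjunct1[OF a[unfolded smooth_form_def]] *(1)] l]] *(2,3)
      by blast
    then show "\<alpha> p [\<lambda>c. r *\<^sub>R u c + s *\<^sub>R w c] = r * \<alpha> p [u] + s * \<alpha> p [w]" by simp
  qed
  moreover have "smooth_on (snd c ` fst c) (\<lambda>x. coord_form M c \<alpha> x [w])" if "c \<in> atlas M" for c w
    using a that unfolding smooth_form_def by simp
  ultimately show "linear_form \<alpha> \<and> (\<forall>c\<in>atlas M. \<forall>w. smooth_on (snd c ` fst c) (\<lambda>x. coord_form M c \<alpha> x [w]))"
    by blast
next
  assume a: "linear_form \<alpha> \<and> (\<forall>c\<in>atlas M. \<forall>w. smooth_on (snd c ` fst c) (\<lambda>x. coord_form M c \<alpha> x [w]))"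
  show "smooth_form M 1 \<alpha>"
    unfolding smooth_form_def
  proof (intro conjI ballI allI impI)
    fix p vs i u w r s
    assume *: "p \<in> points M" "vs \<in> tangent_lists M p 1" "i < (1::nat)" "u \<in> tangent_space M p" "w \<in> tangent_space M p"
    obtain v where "vs = [v]" using *(2) by (auto simp: tangent_lists_def length_Suc_conv)
    moreover have "\<alpha> p [\<lambda>c. r *\<^sub>R u c + s *\<^sub>R w c] = r * \<alpha> p [u] + s * \<alpha> p [w]"
      using a * unfolding linear_form_def by blast
    ultimately show "\<alpha> p (vs[i := (\<lambda>c. r *\<^sub>R u c + s *\<^sub>R w c)]) = r * \<alpha> p (vs[i := u]) + s * \<alpha> p (vs[i := w])"
      using *(3) by simp
  next
    fix c ws assume "c \<in> atlas M" "length (ws :: 'e list) = 1"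
    with a show "smooth_on (snd c ` fst c) (\<lambda>x. coord_form M c \<alpha> x ws)"
      by (auto simp: length_Suc_conv)
  qed auto
qed

lemma smooth_form_linear: "smooth_form M 1 \<alpha> \<Longrightarrow> linear_form \<alpha>"
  unfolding smooth_form_1_iff by blast

lemma smooth_coord_form:
  "smooth_form M 1 \<alpha> \<Longrightarrow> c \<in> atlas M \<Longrightarrow> smooth_on (snd c ` fst c) (\<lambda>x. coord_form M c \<alpha> x [w])"
  unfolding smooth_form_1_iff by blast

lemma coord_form_linear:
  assumes "linear_form \<alpha>" "c \<in> atlas M" "x \<in> snd c ` fst c"
  shows "linear (\<lambda>v. coord_form M c \<alpha> x [v])"
proof -
  have "coord_form M c \<alpha> x [r *\<^sub>R v + s *\<^sub>R w] = r * coord_form M c \<alpha> x [v] + s * coord_form M c \<alpha> x [w]" for r s v w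
    using assms(1) chart_inv_charts_at[OF assms(2,3)] charts_at_points coord_tvec_in
    unfolding linear_form_def by (simp add: coord_form_def coord_tvec_lincomb)
  from this[of 1 _ 1] this[of _ _ 0] show ?thesis by (simp add: linear_iff)
qed

lemma form_vec_inner:
  assumes "linear_form \<alpha>" "c \<in> atlas M" "x \<in> snd c ` fst c"
  shows "form_vec c \<alpha> x \<bullet> v = coord_form M c \<alpha> x [v]"
  unfolding form_vec_def linear_Basis_expand[OF coord_form_linear[OF assms], of v] inner_sum_left
  by (intro sum.cong refl) (simp add: inner_commute)

lemma smooth_form_vec:
  "smooth_form M 1 \<alpha> \<Longrightarrow> c \<in> atlas M \<Longrightarrow> smooth_on (snd c ` fst c) (form_vec c \<alpha>)"
  unfolding form_vec_def smooth_form_1_iff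
  by (intro smooth_on_sum smooth_on_scaleR smooth_on_const) (auto simp: chart_facts)

lemma form_eval:
  assumes "linear_form \<alpha>" "c \<in> charts_at M p" "v \<in> tangent_space M p"
  shows "\<alpha> p [v] = form_vec c \<alpha> (snd c p) \<bullet> v c"
  using assms charts_atD[OF assms(2)] by (simp add: form_vec_inner coord_form_def coord_tvec_of)

lemma form_vec_change:
  assumes \<alpha>: "linear_form \<alpha>" and c: "c \<in> atlas M" "c' \<in> atlas M" and x: "x \<in> snd c ` (fst c \<inter> fst c')"
  shows "form_vec c \<alpha> x \<bullet> v = form_vec c' \<alpha> (transition c c' x) \<bullet> fd (transition c c') x v"
proof -
  let ?p = "chart_inv c x"
  have p: "c \<in> charts_at M ?p" "c' \<in> charts_at M ?p" "snd c ?p = x"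
    using c x transition_in_overlap[OF c x] by (auto simp: charts_at_def)
  have "form_vec c \<alpha> x \<bullet> v = \<alpha> ?p [coord_tvec M c ?p v]"
    using form_eval[OF \<alpha> p(1) coord_tvec_in[OF p(1)], of v] p by simp
  also have "\<dots> = form_vec c' \<alpha> (snd c' ?p) \<bullet> coord_tvec M c ?p v c'"
    by (rule form_eval[OF \<alpha> p(2) coord_tvec_in[OF p(1)]])
  also have "\<dots> = form_vec c' \<alpha> (transition c c' x) \<bullet> fd (transition c c') x v"
    using p by (simp add: coord_tvec_def transition_def)
  finally show ?thesis .
qed

text \<open>Independence of the chart in \<open>ext_deriv\<close> is naturality of \<open>d\<close>
  under the transition map, so \<open>pullback_field\<close> carries the formula from
  \<open>some_chart\<close> to \<open>c\<close>.\<close>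

lemma ext_deriv_1:
  assumes \<alpha>: "smooth_form M 1 \<alpha>" and c: "c \<in> charts_at M p"
    and v: "v \<in> tangent_space M p" "w \<in> tangent_space M p"
  shows "ext_deriv M \<alpha> p [v, w] = curl (form_vec c \<alpha>) (snd c p) [v c, w c]"
proof -
  have lin: "linear_form \<alpha>" by (rule smooth_form_linear[OF \<alpha>])
  define d where "d = some_chart M p"
  have d: "d \<in> charts_at M p" using some_chart_in charts_at_points[OF c] by (simp add: d_def)
  note da = charts_atD[OF d] and ca = charts_atD[OF c]
  have x: "snd d p \<in> snd d ` fst d" using da by blast
  note sd = smooth_form_vec[OF \<alpha> da(1)] chart_facts(2)[OF da(1)]
  have *: "fd (\<lambda>x. coord_form M d \<alpha> x [u]) (snd d p) v = fd (form_vec d \<alpha>) (snd d p) v \<bullet> u" for u v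
  proof -
    have "fd (\<lambda>x. coord_form M d \<alpha> x [u]) (snd d p) = fd (\<lambda>x. form_vec d \<alpha> x \<bullet> u) (snd d p)"
      by (intro frechet_derivative_transform_within_open[OF _ sd(2) x]
          smooth_on_differentiable[OF _ sd(2) x] smooth_coord_form[OF \<alpha> da(1)])
        (simp add: form_vec_inner[OF lin da(1)])
    then show ?thesis using fd_inner_const[OF sd x] by simp
  qed
  have "ext_deriv M \<alpha> p [v, w] = curl (form_vec d \<alpha>) (snd d p) [v d, w d]"
    by (simp add: ext_deriv_def d_def[symmetric] Let_def lessThan_Suc * curl_def)
  also have "\<dots> = curl (form_vec c \<alpha>) (transition d c (snd d p))
      [fd (transition d c) (snd d p) (v d), fd (transition d c) (snd d p) (w d)]"
  proof (rule pullback_field(2)[where U = "snd d ` (fst d \<inter> fst c)" and V = "snd c ` fst c"])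
    show "form_vec d \<alpha> y \<bullet> v = form_vec c \<alpha> (transition d c y) \<bullet> fd (transition d c) y v"
      if "y \<in> snd d ` (fst d \<inter> fst c)" for y v
      by (rule form_vec_change[OF lin da(1) ca(1) that])
    show "transition d c ` (snd d ` (fst d \<inter> fst c)) \<subseteq> snd c ` fst c"
      using transition_in_overlap(1)[OF da(1) ca(1)] by blast
  qed (use da ca in \<open>auto intro: open_overlap chart_facts smooth_transition smooth_form_vec[OF \<alpha>]\<close>)
  also have "\<dots> = curl (form_vec c \<alpha>) (snd c p) [v c, w c]"
    using d c v by (simp add: transition_at tangent_space_chart)
  finally show ?thesis .
qed

lemma ext_deriv_fun:
  assumes c: "c \<in> charts_at M p" and f: "(f \<circ> chart_inv c) differentiable at (snd c p)"
    and v: "v \<in> tangent_space M p"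
  shows "ext_deriv M (fun_form f) p [v] = fd (f \<circ> chart_inv c) (snd c p) (v c)"
proof -
  define d where "d = some_chart M p"
  have d: "d \<in> charts_at M p" using some_chart_in charts_at_points[OF c] by (simp add: d_def)
  have "ext_deriv M (fun_form f) p [v] = fd (f \<circ> chart_inv d) (snd d p) (v d)"
    by (simp add: ext_deriv_def d_def[symmetric] Let_def coord_form_def fun_form_def o_def)
  also have "\<dots> = fd (f \<circ> chart_inv c) (snd c p) (fd (transition d c) (snd d p) (v d))"
    using fd_eq[OF chart_change_has_derivative[OF d c f]] by simp
  finally show ?thesis using tangent_space_chart[OF v d c] by simp
qed

section \<open>Functions, vector fields and Lie derivatives\<close>

lemma smooth_fun_on_points:
  "smooth_fun_on M (points M) f \<longleftrightarrow> (\<forall>c\<in>atlas M. smooth_on (snd c ` fst c) (f \<circ> chart_inv c))"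
proof -
  have "fst c \<inter> points M = fst c" if "c \<in> atlas M" for c using chart_facts(4)[OF that] by blast
  then show ?thesis by (simp add: smooth_fun_on_def)
qed

lemma smooth_fun_differentiable:
  "smooth_fun_on M (points M) f \<Longrightarrow> c \<in> charts_at M p \<Longrightarrow> (f \<circ> chart_inv c) differentiable at (snd c p)"
  using charts_atD chart_facts unfolding smooth_fun_on_points
  by (intro smooth_on_differentiable) blast+

lemma vector_field_in: "smooth_vector_field M X \<Longrightarrow> p \<in> points M \<Longrightarrow> X p \<in> tangent_space M p"
  by (simp add: smooth_vector_field_def)

lemma vf_app_eq:
  assumes "smooth_vector_field M X" "c \<in> charts_at M p" "(f \<circ> chart_inv c) differentiable at (snd c p)"
  shows "vf_app M X f p = fd (f \<circ> chart_inv c) (snd c p) (X p c)"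
  unfolding vf_app_def
  by (rule ext_deriv_fun[OF assms(2,3) vector_field_in[OF assms(1) charts_at_points[OF assms(2)]]])

lemma smooth_vf_coord:
  "smooth_vector_field M X \<Longrightarrow> c \<in> atlas M \<Longrightarrow> smooth_on (snd c ` fst c) (vf_coord X c)"
  unfolding smooth_vector_field_def vf_coord_def[abs_def] by blast

lemma smooth_contraction:
  assumes \<alpha>: "smooth_form M 1 \<alpha>" and X: "smooth_vector_field M X"
  shows "smooth_fun_on M (points M) (\<lambda>p. \<alpha> p [X p])"
    and "c \<in> atlas M \<Longrightarrow> x \<in> snd c ` fst c \<Longrightarrow>
      ((\<lambda>p. \<alpha> p [X p]) \<circ> chart_inv c) x = form_vec c \<alpha> x \<bullet> vf_coord X c x"
proof -
  have lin: "linear_form \<alpha>" by (rule smooth_form_linear[OF \<alpha>])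
  show eq: "((\<lambda>p. \<alpha> p [X p]) \<circ> chart_inv c) x = form_vec c \<alpha> x \<bullet> vf_coord X c x"
    if "c \<in> atlas M" "x \<in> snd c ` fst c" for c x
  proof -
    have c: "c \<in> charts_at M (chart_inv c x)" by (rule chart_inv_charts_at[OF that])
    show ?thesis
      using form_eval[OF lin c vector_field_in[OF X charts_at_points[OF c]]] that
      by (simp add: vf_coord_def)
  qed
  show "smooth_fun_on M (points M) (\<lambda>p. \<alpha> p [X p])"
    unfolding smooth_fun_on_points
  proof
    fix c assume c: "c \<in> atlas M"
    have S: "smooth_on (snd c ` fst c) (\<lambda>x. form_vec c \<alpha> x \<bullet> vf_coord X c x)"
      by (intro smooth_on_inner smooth_form_vec smooth_vf_coord \<alpha> X c chart_facts(2)[OF c])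
    show "smooth_on (snd c ` fst c) ((\<lambda>p. \<alpha> p [X p]) \<circ> chart_inv c)"
      by (rule iffD2[OF smooth_on_cong[OF chart_facts(2)[OF c]] S]) (rule eq[OF c])
  qed
qed

lemma ext_deriv_interior_prod:
  "ext_deriv M (interior_prod X \<alpha>) p [v] = ext_deriv M (fun_form (\<lambda>p. \<alpha> p [X p])) p [v]"
  by (simp add: ext_deriv_def Let_def coord_form_def fun_form_def interior_prod_def)

text \<open>In Cartan's formula the derivative of the form in direction \<open>v\<close>, paired
  with \<open>X\<close>, occurs once in each summand with opposite signs. What remains is the left
  side of \<open>conformal_on\<close>.\<close>

lemma lie_deriv_1:
  assumes \<alpha>: "smooth_form M 1 \<alpha>" and X: "smooth_vector_field M X"
    and c: "c \<in> charts_at M p" and v: "v \<in> tangent_space M p"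
  shows "lie_deriv M X \<alpha> p [v] =
    fd (form_vec c \<alpha>) (snd c p) (vf_coord X c (snd c p)) \<bullet> v c +
    form_vec c \<alpha> (snd c p) \<bullet> fd (vf_coord X c) (snd c p) (v c)"
proof -
  note ca = charts_atD[OF c]
  have x: "snd c p \<in> snd c ` fst c" using ca by blast
  note op = chart_facts(2)[OF ca(1)]
  have Xp: "vf_coord X c (snd c p) = X p c" using ca by (simp add: vf_coord_def)
  have 1: "((\<lambda>x. form_vec c \<alpha> x \<bullet> vf_coord X c x) has_derivative
     (\<lambda>v. form_vec c \<alpha> (snd c p) \<bullet> fd (vf_coord X c) (snd c p) v +
       fd (form_vec c \<alpha>) (snd c p) v \<bullet> vf_coord X c (snd c p))) (at (snd c p))"
    by (intro has_derivative_inner smooth_on_has_derivative[OF _ op x] smooth_form_vec smooth_vf_coord \<alpha> X ca)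
  have "(((\<lambda>p. \<alpha> p [X p]) \<circ> chart_inv c) has_derivative
     (\<lambda>v. form_vec c \<alpha> (snd c p) \<bullet> fd (vf_coord X c) (snd c p) v +
       fd (form_vec c \<alpha>) (snd c p) v \<bullet> vf_coord X c (snd c p))) (at (snd c p))"
    by (rule has_derivative_transform_within_open[OF 1 op x])
      (simp add: smooth_contraction(2)[OF \<alpha> X ca(1), unfolded o_def])
  note * = this
  have "ext_deriv M (interior_prod X \<alpha>) p [v] =
     form_vec c \<alpha> (snd c p) \<bullet> fd (vf_coord X c) (snd c p) (v c) +
       fd (form_vec c \<alpha>) (snd c p) (v c) \<bullet> vf_coord X c (snd c p)"
    unfolding ext_deriv_interior_prod
    using ext_deriv_fun[OF c differentiableI[OF *] v] fd_eq[OF *] by simp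
  moreover have "ext_deriv M \<alpha> p [X p, v] = curl (form_vec c \<alpha>) (snd c p) [X p c, v c]"
    by (rule ext_deriv_1[OF \<alpha> c vector_field_in[OF X charts_at_points[OF c]] v])
  ultimately show ?thesis
    by (simp add: lie_deriv_def form_add_def interior_prod_def curl_def Xp)
qed

text \<open>Since \<open>d\<alpha>(X, X) = 0\<close>, only the second summand of Cartan's formula
  survives at \<open>X\<close>. A conformal factor of \<open>\<alpha>\<close> is thereby passed on
  to the function \<open>\<alpha>(X)\<close>.\<close>

lemma vf_app_contraction:
  assumes \<alpha>: "smooth_form M 1 \<alpha>" and X: "smooth_vector_field M X" and p: "p \<in> points M"
  shows "vf_app M X (\<lambda>p. \<alpha> p [X p]) p = lie_deriv M X \<alpha> p [X p]"
proof -
  define c where "c = some_chart M p"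
  have c: "c \<in> charts_at M p" using some_chart_in p by (simp add: c_def)
  have "ext_deriv M \<alpha> p [X p, X p] = 0"
    using ext_deriv_1[OF \<alpha> c vector_field_in[OF X p] vector_field_in[OF X p]] by (simp add: curl_def)
  then show ?thesis
    by (simp add: lie_deriv_def form_add_def interior_prod_def vf_app_def
        ext_deriv_interior_prod[unfolded interior_prod_def])
qed

lemma conformal_on_chart:
  assumes \<alpha>: "smooth_form M 1 \<alpha>" and X: "smooth_vector_field M X" and c: "c \<in> atlas M"
    and L: "\<And>p v. p \<in> points M \<Longrightarrow> v \<in> tangent_space M p \<Longrightarrow> lie_deriv M X \<alpha> p [v] = - f p * \<alpha> p [v]"
  shows "conformal_on (snd c ` fst c) (vf_coord X c) (form_vec c \<alpha>) (f \<circ> chart_inv c)"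
  unfolding conformal_on_def
proof (intro ballI allI)
  fix x v assume x: "x \<in> snd c ` fst c"
  let ?p = "chart_inv c x"
  have p: "c \<in> charts_at M ?p" by (rule chart_inv_charts_at[OF c x])
  have t: "coord_tvec M c ?p v \<in> tangent_space M ?p" by (rule coord_tvec_in[OF p])
  have lin: "linear_form \<alpha>" by (rule smooth_form_linear[OF \<alpha>])
  show "fd (form_vec c \<alpha>) x (vf_coord X c x) \<bullet> v + form_vec c \<alpha> x \<bullet> fd (vf_coord X c) x v =
    - (f \<circ> chart_inv c) x * (form_vec c \<alpha> x \<bullet> v)"
    using L[OF charts_at_points[OF p] t] lie_deriv_1[OF \<alpha> X p t] form_eval[OF lin p t] x p by simp
qed

lemma contact_vol_chart:
  assumes \<alpha>: "smooth_form M 1 \<alpha>" and c: "c \<in> charts_at M p" and vs: "vs \<in> tangent_lists M p (2 * n + 1)"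
  shows "contact_vol n \<alpha> (ext_deriv M \<alpha>) p vs = vol n (form_vec c \<alpha>) (snd c p) (map (\<lambda>v. v c) vs)"
proof -
  have lin: "linear_form \<alpha>" by (rule smooth_form_linear[OF \<alpha>])
  have len: "length vs = 2 * n + 1" and sub: "set vs \<subseteq> tangent_space M p"
    using vs by (auto simp: tangent_lists_def)
  show ?thesis
    unfolding contact_vol_eq_lvol vol_def lvol_map[OF len]
  proof (rule lvol_cong[OF len])
    fix us assume "length us = 1" "set us \<subseteq> set vs"
    then show "\<alpha> p us = covec (form_vec c \<alpha> (snd c p)) (map (\<lambda>v. v c) us)"
      using form_eval[OF lin c] sub by (auto simp: length_Suc_conv covec_def)
  next
    fix us assume us: "length us = 2" "set us \<subseteq> set vs"
    then obtain v w where vw: "us = [v, w]" by (auto simp: numeral_2_eq_2 length_Suc_conv)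
    then have "v \<in> tangent_space M p" "w \<in> tangent_space M p" using us(2) sub by auto
    then show "ext_deriv M \<alpha> p us = curl (form_vec c \<alpha>) (snd c p) (map (\<lambda>v. v c) us)"
      using ext_deriv_1[OF \<alpha> c] vw by simp
  qed
qed

section \<open>Sums and multiples of one-forms\<close>

lemma smooth_form_scale:
  assumes \<alpha>: "smooth_form M 1 \<alpha>" and g: "smooth_fun_on M (points M) g"
  shows "smooth_form M 1 (form_scale g \<alpha>)"
    and "c \<in> atlas M \<Longrightarrow> form_vec c (form_scale g \<alpha>) x = (g \<circ> chart_inv c) x *\<^sub>R form_vec c \<alpha> x"
proof -
  have "smooth_on (snd c ` fst c) (\<lambda>x. (g \<circ> chart_inv c) x * coord_form M c \<alpha> x [w])" if "c \<in> atlas M" for c w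
    using g that unfolding smooth_fun_on_points
    by (intro smooth_on_mult smooth_coord_form[OF \<alpha>] chart_facts(2)) blast+
  then show "smooth_form M 1 (form_scale g \<alpha>)"
    using \<alpha> unfolding smooth_form_1_iff linear_form_def
    by (auto simp: form_scale_def coord_form_def algebra_simps)
  show "form_vec c (form_scale g \<alpha>) x = (g \<circ> chart_inv c) x *\<^sub>R form_vec c \<alpha> x"
    by (simp add: form_vec_def coord_form_def form_scale_def scaleR_sum_right)
qed

lemma smooth_form_add:
  assumes "smooth_form M 1 \<alpha>" "smooth_form M 1 \<beta>"
  shows "smooth_form M 1 (form_add \<alpha> \<beta>)"
    and "form_vec c (form_add \<alpha> \<beta>) x = form_vec c \<alpha> x + form_vec c \<beta> x"
proof -
  have "smooth_on (snd c ` fst c) (\<lambda>x. coord_form M c \<alpha> x [w] + coord_form M c \<beta> x [w])" if "c \<in> atlas M" for c w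
    using that by (intro smooth_on_add smooth_coord_form assms chart_facts(2))
  then show "smooth_form M 1 (form_add \<alpha> \<beta>)"
    using assms unfolding smooth_form_1_iff linear_form_def
    by (auto simp: form_add_def coord_form_def algebra_simps)
  show "form_vec c (form_add \<alpha> \<beta>) x = form_vec c \<alpha> x + form_vec c \<beta> x"
    by (simp add: form_vec_def coord_form_def form_add_def sum.distrib scaleR_add_left)
qed

lemma form_vec_has_derivative:
  assumes "smooth_form M 1 \<alpha>" "c \<in> charts_at M p"
  shows "(form_vec c \<alpha> has_derivative fd (form_vec c \<alpha>) (snd c p)) (at (snd c p))"
  by (rule smooth_on_has_derivative[OF smooth_form_vec chart_facts(2)]) (use assms charts_atD in auto)

lemma fd_form_vec_add:
  assumes "smooth_form M 1 \<alpha>" "smooth_form M 1 \<beta>" "c \<in> charts_at M p"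
  shows "fd (form_vec c (form_add \<alpha> \<beta>)) (snd c p) v = fd (form_vec c \<alpha>) (snd c p) v + fd (form_vec c \<beta>) (snd c p) v"
proof -
  have "form_vec c (form_add \<alpha> \<beta>) = (\<lambda>x. form_vec c \<alpha> x + form_vec c \<beta> x)"
    using smooth_form_add(2)[OF assms(1,2)] by (simp add: fun_eq_iff)
  then show ?thesis
    using fd_eq[OF has_derivative_add[OF form_vec_has_derivative[OF assms(1,3)] form_vec_has_derivative[OF assms(2,3)]]]
    by simp
qed

lemma ext_deriv_add:
  assumes "smooth_form M 1 \<alpha>" "smooth_form M 1 \<beta>" "p \<in> points M" "v \<in> tangent_space M p" "w \<in> tangent_space M p"
  shows "ext_deriv M (form_add \<alpha> \<beta>) p [v, w] = ext_deriv M \<alpha> p [v, w] + ext_deriv M \<beta> p [v, w]"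
proof -
  have c: "some_chart M p \<in> charts_at M p" by (rule some_chart_in[OF assms(3)])
  show ?thesis
    unfolding ext_deriv_1[OF smooth_form_add(1)[OF assms(1,2)] c assms(4,5)]
      ext_deriv_1[OF assms(1) c assms(4,5)] ext_deriv_1[OF assms(2) c assms(4,5)]
    by (simp add: curl_def fd_form_vec_add[OF assms(1,2) c] inner_add_left)
qed

lemma lie_deriv_add:
  assumes "smooth_form M 1 \<alpha>" "smooth_form M 1 \<beta>" "smooth_vector_field M X"
    "p \<in> points M" "v \<in> tangent_space M p"
  shows "lie_deriv M X (form_add \<alpha> \<beta>) p [v] = lie_deriv M X \<alpha> p [v] + lie_deriv M X \<beta> p [v]"
proof -
  have c: "some_chart M p \<in> charts_at M p" by (rule some_chart_in[OF assms(4)])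
  show ?thesis
    unfolding lie_deriv_1[OF smooth_form_add(1)[OF assms(1,2)] assms(3) c assms(5)]
      lie_deriv_1[OF assms(1,3) c assms(5)] lie_deriv_1[OF assms(2,3) c assms(5)]
    by (simp add: fd_form_vec_add[OF assms(1,2) c] smooth_form_add(2)[OF assms(1,2)] inner_add_left)
qed

lemma fd_form_vec_scale:
  assumes "smooth_form M 1 \<alpha>" "smooth_fun_on M (points M) g" "c \<in> charts_at M p"
  shows "fd (form_vec c (form_scale g \<alpha>)) (snd c p) v =
    g p *\<^sub>R fd (form_vec c \<alpha>) (snd c p) v + fd (g \<circ> chart_inv c) (snd c p) v *\<^sub>R form_vec c \<alpha> (snd c p)"
proof -
  have eq: "form_vec c (form_scale g \<alpha>) = (\<lambda>x. (g \<circ> chart_inv c) x *\<^sub>R form_vec c \<alpha> x)"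
    using smooth_form_scale(2)[OF assms(1,2)] charts_atD[OF assms(3)] by (simp add: fun_eq_iff)
  have g: "((g \<circ> chart_inv c) has_derivative fd (g \<circ> chart_inv c) (snd c p)) (at (snd c p))"
    using smooth_fun_differentiable[OF assms(2,3)] by (simp add: frechet_derivative_works)
  show ?thesis
    unfolding eq fd_eq[OF has_derivative_scaleR[OF g form_vec_has_derivative[OF assms(1,3)]]]
    using charts_atD[OF assms(3)] by simp
qed

lemma lie_deriv_scale:
  assumes "smooth_form M 1 \<alpha>" "smooth_fun_on M (points M) g" "smooth_vector_field M X"
    "p \<in> points M" "v \<in> tangent_space M p"
  shows "lie_deriv M X (form_scale g \<alpha>) p [v] = vf_app M X g p * \<alpha> p [v] + g p * lie_deriv M X \<alpha> p [v]"
proof -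
  define c where "c = some_chart M p"
  have c: "c \<in> charts_at M p" unfolding c_def by (rule some_chart_in[OF assms(4)])
  have lin: "linear_form \<alpha>" by (rule smooth_form_linear[OF assms(1)])
  have vf: "vf_app M X g p = fd (g \<circ> chart_inv c) (snd c p) (vf_coord X c (snd c p))"
    using vf_app_eq[OF assms(3) c smooth_fun_differentiable[OF assms(2) c]] charts_atD[OF c] by (simp add: vf_coord_def)
  show ?thesis
    unfolding lie_deriv_1[OF smooth_form_scale(1)[OF assms(1,2)] assms(3) c assms(5)]
      lie_deriv_1[OF assms(1,3) c assms(5)] vf form_eval[OF lin c assms(5)]
      fd_form_vec_scale[OF assms(1,2) c] smooth_form_scale(2)[OF assms(1,2) charts_atD(1)[OF c]]
    using charts_atD[OF c] by (simp add: inner_add_left algebra_simps)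
qed

lemma ext_deriv_scale_const:
  assumes "smooth_form M 1 \<alpha>" "p \<in> points M" "v \<in> tangent_space M p" "w \<in> tangent_space M p"
  shows "ext_deriv M (form_scale (\<lambda>_. t) \<alpha>) p [v, w] = t * ext_deriv M \<alpha> p [v, w]"
proof -
  have c: "some_chart M p \<in> charts_at M p" by (rule some_chart_in[OF assms(2)])
  have t: "smooth_fun_on M (points M) (\<lambda>_. t)" by (simp add: smooth_fun_on_points o_def)
  show ?thesis
    unfolding ext_deriv_1[OF smooth_form_scale(1)[OF assms(1) t] c assms(3,4)] ext_deriv_1[OF assms(1) c assms(3,4)]
    by (simp add: curl_def fd_form_vec_scale[OF assms(1) t c] o_def algebra_simps)
qed

end


section \<open>Ratio of contact volumes and pullbacks\<close>

lemma Basis_list: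
  obtains bs :: "'e::euclidean_space list" where "length bs = DIM('e)" "span (set bs) = UNIV"
proof -
  obtain bs :: "'e list" where "set bs = Basis" "distinct bs"
    using finite_distinct_list[OF finite_Basis] by blast
  then show thesis using that[of bs] distinct_card[of bs] by simp
qed

lemma multilinear_vol: "a differentiable at x \<Longrightarrow> multilinear (2 * n + 1) (vol n a x)"
  unfolding vol_def by (intro multilinear_lvol multilinear_covec multilinear_curl)

lemma alternating_vol: "alternating (2 * n + 1) (vol n a x)"
  unfolding vol_def by (rule alternating_lvol)

text \<open>The sign of \<open>\<rho>\<close> is not prescribed; with division by \<open>r\<close>,
  one formula covers both half-lines.\<close>

lemma DERIV_abs_powr:
  fixes r e :: real
  assumes "r \<noteq> 0"
  shows "((\<lambda>r. \<bar>r\<bar> powr e) has_real_derivative e * \<bar>r\<bar> powr e / r) (at r)"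
proof (cases "r > 0")
  case True
  have "((\<lambda>r. r powr e) has_real_derivative e * \<bar>r\<bar> powr e / r) (at r)"
    using has_real_derivative_powr[OF True, of e] True by (simp add: powr_diff)
  then show ?thesis
    by (rule has_field_derivative_transform_within_open[where S = "{0<..}"]) (use True in auto)
next
  case False
  then have r: "r < 0" using assms by simp
  have "((\<lambda>r. (- r) powr e) has_real_derivative (e * (- r) powr (e - 1)) * (- 1)) (at r)"
    by (rule DERIV_chain2[OF has_real_derivative_powr]) (use r in \<open>auto intro!: derivative_eq_intros\<close>)
  moreover have "(e * (- r) powr (e - 1)) * (- 1) = e * \<bar>r\<bar> powr e / r"
    using r by (simp add: powr_diff)
  ultimately have "((\<lambda>r. (- r) powr e) has_real_derivative e * \<bar>r\<bar> powr e / r) (at r)"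
    by simp
  then show ?thesis
    by (rule has_field_derivative_transform_within_open[where S = "{..<0}"]) (use r in auto)
qed

context smooth_mfd
begin

section \<open>Derivatives of functions along a vector field\<close>

lemma vf_app_has_derivative:
  assumes "smooth_vector_field M X" "c \<in> charts_at M p" "((f \<circ> chart_inv c) has_derivative f') (at (snd c p))"
  shows "vf_app M X f p = f' (X p c)"
  using vf_app_eq[OF assms(1,2) differentiableI[OF assms(3)]] fd_eq[OF assms(3)] by simp

lemma smooth_fun_has_derivative:
  assumes "smooth_fun_on M (points M) f" "c \<in> charts_at M p"
  shows "((f \<circ> chart_inv c) has_derivative fd (f \<circ> chart_inv c) (snd c p)) (at (snd c p))"
  using smooth_fun_differentiable[OF assms] by (simp add: frechet_derivative_works)

lemma vf_app_compose:
  assumes X: "smooth_vector_field M X" and f: "smooth_fun_on M (points M) f" and p: "p \<in> points M"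
    and g: "(g has_real_derivative D) (at (f p))"
  shows "vf_app M X (\<lambda>p. g (f p)) p = D * vf_app M X f p"
proof -
  define c where "c = some_chart M p"
  have c: "c \<in> charts_at M p" unfolding c_def by (rule some_chart_in[OF p])
  have "(g has_derivative (*) D) (at ((f \<circ> chart_inv c) (snd c p)))"
    using g charts_atD[OF c] by (simp add: has_field_derivative_def)
  from diff_chain_at[OF smooth_fun_has_derivative[OF f c] this]
  have "(((\<lambda>p. g (f p)) \<circ> chart_inv c) has_derivative (\<lambda>v. D * fd (f \<circ> chart_inv c) (snd c p) v)) (at (snd c p))"
    by (simp add: o_def)
  from vf_app_has_derivative[OF X c this] show ?thesis
    using vf_app_has_derivative[OF X c smooth_fun_has_derivative[OF f c]] by simp
qed

lemma vf_app_divide: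
  assumes X: "smooth_vector_field M X" and p: "p \<in> points M" "g p \<noteq> 0"
    and f: "smooth_fun_on M (points M) f" and g: "smooth_fun_on M (points M) g"
  shows "vf_app M X (\<lambda>p. f p / g p) p = (vf_app M X f p * g p - f p * vf_app M X g p) / (g p * g p)"
proof -
  define c where "c = some_chart M p"
  have c: "c \<in> charts_at M p" unfolding c_def by (rule some_chart_in[OF p(1)])
  have *: "(f \<circ> chart_inv c) (snd c p) = f p" "(g \<circ> chart_inv c) (snd c p) = g p"
    using charts_atD[OF c] by simp_all
  note hf = smooth_fun_has_derivative[OF f c] and hg = smooth_fun_has_derivative[OF g c]
  have "((\<lambda>x. (f \<circ> chart_inv c) x / (g \<circ> chart_inv c) x) has_derivative
      (\<lambda>v. (fd (f \<circ> chart_inv c) (snd c p) v * g p - f p * fd (g \<circ> chart_inv c) (snd c p) v) / (g p * g p))) (at (snd c p))"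
    using has_derivative_divide'[OF hf hg] p(2) unfolding * by simp
  then have "(((\<lambda>p. f p / g p) \<circ> chart_inv c) has_derivative
      (\<lambda>v. (fd (f \<circ> chart_inv c) (snd c p) v * g p - f p * fd (g \<circ> chart_inv c) (snd c p) v) / (g p * g p))) (at (snd c p))"
    by (simp add: o_def)
  from vf_app_has_derivative[OF X c this] show ?thesis
    using vf_app_has_derivative[OF X c hf] vf_app_has_derivative[OF X c hg] by simp
qed

lemma vf_app_lincomb:
  assumes X: "smooth_vector_field M X" and p: "p \<in> points M"
    and f: "\<And>k. k \<in> I \<Longrightarrow> smooth_fun_on M (points M) (f k)"
  shows "vf_app M X (\<lambda>p. \<Sum>k\<in>I. w k * f k p) p = (\<Sum>k\<in>I. w k * vf_app M X (f k) p)"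
proof -
  define c where "c = some_chart M p"
  have c: "c \<in> charts_at M p" unfolding c_def by (rule some_chart_in[OF p])
  have "((\<lambda>x. \<Sum>k\<in>I. w k * (f k \<circ> chart_inv c) x) has_derivative
      (\<lambda>v. \<Sum>k\<in>I. w k * fd (f k \<circ> chart_inv c) (snd c p) v)) (at (snd c p))"
    by (intro has_derivative_sum has_derivative_mult_right smooth_fun_has_derivative[OF f c])
  then have "(((\<lambda>p. \<Sum>k\<in>I. w k * f k p) \<circ> chart_inv c) has_derivative
      (\<lambda>v. \<Sum>k\<in>I. w k * fd (f k \<circ> chart_inv c) (snd c p) v)) (at (snd c p))"
    by (simp add: o_def)
  from vf_app_has_derivative[OF X c this] show ?thesis
    using vf_app_has_derivative[OF X c smooth_fun_has_derivative[OF f c]] by simp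
qed

lemma smooth_fun_lincomb:
  assumes "\<And>k. k \<in> I \<Longrightarrow> smooth_fun_on M (points M) (f k)"
  shows "smooth_fun_on M (points M) (\<lambda>p. \<Sum>k\<in>I. w k * f k p)"
  unfolding smooth_fun_on_points
proof
  fix c assume c: "c \<in> atlas M"
  have "smooth_on (snd c ` fst c) (\<lambda>x. \<Sum>k\<in>I. w k * (f k \<circ> chart_inv c) x)"
    using assms c unfolding smooth_fun_on_points
    by (intro smooth_on_sum smooth_on_mult smooth_on_const chart_facts(2)) blast+
  then show "smooth_on (snd c ` fst c) ((\<lambda>p. \<Sum>k\<in>I. w k * f k p) \<circ> chart_inv c)"
    by (simp add: o_def)
qed

lemma smooth_fun_minus:
  assumes "smooth_fun_on M (points M) f" shows "smooth_fun_on M (points M) (\<lambda>p. - f p)"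
  using smooth_fun_lincomb[of "{()}" "\<lambda>_. f" "\<lambda>_. -1"] assms by simp

lemma smooth_fun_abs_powr:
  assumes f: "smooth_fun_on M (points M) f" and nz: "\<And>p. p \<in> points M \<Longrightarrow> f p \<noteq> 0"
  shows "smooth_fun_on M (points M) (\<lambda>p. \<bar>f p\<bar> powr e)"
  unfolding smooth_fun_on_points
proof
  fix c assume c: "c \<in> atlas M"
  have "smooth_on (snd c ` fst c) (\<lambda>x. \<bar>(f \<circ> chart_inv c) x\<bar> powr e)"
  proof (rule smooth_on_abs_powr[OF chart_facts(2)[OF c]])
    show "smooth_on (snd c ` fst c) (f \<circ> chart_inv c)" using f c unfolding smooth_fun_on_points by blast
    show "(f \<circ> chart_inv c) x \<noteq> 0" if "x \<in> snd c ` fst c" for x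
      using nz[OF charts_at_points[OF chart_inv_charts_at[OF c that]]] by simp
  qed
  then show "smooth_on (snd c ` fst c) ((\<lambda>p. \<bar>f p\<bar> powr e) \<circ> chart_inv c)" by (simp add: o_def)
qed

lemma smooth_fun_divide_on:
  assumes f: "smooth_fun_on M (points M) f" and g: "smooth_fun_on M (points M) g"
  shows "smooth_fun_on M {p \<in> points M. g p \<noteq> 0} (\<lambda>p. f p / g p)"
  unfolding smooth_fun_on_def
proof
  fix c assume c: "c \<in> atlas M"
  let ?U = "snd c ` fst c" and ?f = "f \<circ> chart_inv c" and ?g = "g \<circ> chart_inv c"
  let ?V = "{x \<in> ?U. ?g x \<noteq> 0}"
  have sm: "smooth_on ?U ?f" "smooth_on ?U ?g" using f g c unfolding smooth_fun_on_points by blast+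
  have V: "snd c ` (fst c \<inter> {p \<in> points M. g p \<noteq> 0}) = ?V"
    using c chart_facts(4)[OF c] by (force simp: image_iff)
  have "open (?U \<inter> ?g -` (- {0}))"
    using continuous_open_preimage[OF smooth_on_continuous[OF sm(2)] chart_facts(2)[OF c]] by blast
  moreover have "?U \<inter> ?g -` (- {0}) = ?V" by auto
  ultimately have "open ?V" by simp
  then have "smooth_on ?V (\<lambda>x. ?f x / ?g x)"
    by (intro smooth_on_divide smooth_on_subset[OF sm(1)] smooth_on_subset[OF sm(2)]) auto
  then show "smooth_on (snd c ` (fst c \<inter> {p \<in> points M. g p \<noteq> 0})) ((\<lambda>p. f p / g p) \<circ> chart_inv c)"
    unfolding V by (simp add: o_def)
qed

text \<open>Applied to the Reeb field, it makes \<open>a = R(H)\<close> an admissible conformal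
  factor.\<close>

lemma smooth_vf_app:
  assumes X: "smooth_vector_field M X" and f: "smooth_fun_on M (points M) f"
  shows "smooth_fun_on M (points M) (vf_app M X f)"
  unfolding smooth_fun_on_points
proof
  fix c assume c: "c \<in> atlas M"
  note op = chart_facts(2)[OF c]
  have S: "smooth_on (snd c ` fst c) (\<lambda>x. fd (f \<circ> chart_inv c) x (vf_coord X c x))"
    using f c unfolding smooth_fun_on_points
    by (intro smooth_on_frechet_derivative2[OF op _ smooth_vf_coord[OF X c]]) blast
  show "smooth_on (snd c ` fst c) (vf_app M X f \<circ> chart_inv c)"
  proof (rule iffD2[OF smooth_on_cong[OF op] S])
    fix x assume x: "x \<in> snd c ` fst c"
    show "(vf_app M X f \<circ> chart_inv c) x = fd (f \<circ> chart_inv c) x (vf_coord X c x)"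
      using vf_app_eq[OF X chart_inv_charts_at[OF c x] smooth_fun_differentiable[OF f chart_inv_charts_at[OF c x]]] x
      by (simp add: vf_coord_def)
  qed
qed

section \<open>Volume ratios on the manifold\<close>

lemma form_vec_differentiable:
  "smooth_form M 1 \<alpha> \<Longrightarrow> c \<in> charts_at M p \<Longrightarrow> form_vec c \<alpha> differentiable at (snd c p)"
  using form_vec_has_derivative differentiableI by blast

lemma coord_tvec_list:
  assumes "c \<in> charts_at M p" "length ws = k"
  shows "map (coord_tvec M c p) ws \<in> tangent_lists M p k"
    and "map (\<lambda>v. v c) (map (coord_tvec M c p) ws) = ws"
  using assms by (auto simp: tangent_lists_def coord_tvec_in intro: map_idI)

text \<open>The contact condition offers a list that depends on the point. A smooth denominator on a
  whole chart requires one fixed coordinate basis, to which nonvanishing is transferred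
  here.\<close>

lemma contact_vol_basis_nonzero:
  assumes \<eta>: "smooth_form M 1 \<eta>" and c: "c \<in> charts_at M p"
    and bs: "length bs = 2 * n + 1" "span (set bs) = UNIV"
    and vs: "vs \<in> tangent_lists M p (2 * n + 1)" "contact_vol n \<eta> (ext_deriv M \<eta>) p vs \<noteq> 0"
  shows "vol n (form_vec c \<eta>) (snd c p) bs \<noteq> 0"
proof
  assume 0: "vol n (form_vec c \<eta>) (snd c p) bs = 0"
  have "vol n (form_vec c \<eta>) (snd c p) (map (\<lambda>v. v c) vs) = 0"
    by (rule multilinear_alternating_eq_0[OF multilinear_vol[OF form_vec_differentiable[OF \<eta> c]] alternating_vol bs 0])
      (use vs in \<open>simp add: tangent_lists_def\<close>)
  then show False using vs contact_vol_chart[OF \<eta> c vs(1)] by simp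
qed

text \<open>Used twice: for the pullback of \<open>\<eta>\<close>, with factors \<open>b\<close> and
  \<open>a\<close>, and for each member of the pencil, with factor \<open>a\<close> on both
  sides.\<close>

lemma contact_vol_ratio:
  assumes \<alpha>: "smooth_form M 1 \<alpha>" and \<eta>: "contact_form M n \<eta>" and dim: "DIM('e) = 2 * n + 1"
    and X: "smooth_vector_field M X"
    and f: "smooth_fun_on M (points M) f" and k: "smooth_fun_on M (points M) k"
    and L\<alpha>: "\<And>p v. p \<in> points M \<Longrightarrow> v \<in> tangent_space M p \<Longrightarrow> lie_deriv M X \<alpha> p [v] = - f p * \<alpha> p [v]"
    and L\<eta>: "\<And>p v. p \<in> points M \<Longrightarrow> v \<in> tangent_space M p \<Longrightarrow> lie_deriv M X \<eta> p [v] = - k p * \<eta> p [v]"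
    and \<rho>: "\<And>p vs. p \<in> points M \<Longrightarrow> vs \<in> tangent_lists M p (2 * n + 1) \<Longrightarrow>
      contact_vol n \<alpha> (ext_deriv M \<alpha>) p vs = \<rho> p * contact_vol n \<eta> (ext_deriv M \<eta>) p vs"
  shows "smooth_fun_on M (points M) \<rho>"
    and "p \<in> points M \<Longrightarrow> vf_app M X \<rho> p = (real n + 1) * (k p - f p) * \<rho> p"
proof -
  have \<eta>s: "smooth_form M 1 \<eta>" using \<eta> by (simp add: contact_form_def)
  obtain bs :: "'e list" where bs: "length bs = 2 * n + 1" "span (set bs) = UNIV"
    using Basis_list dim by metis
  have nz: "vol n (form_vec c \<eta>) y bs \<noteq> 0" if "c \<in> atlas M" "y \<in> snd c ` fst c" for c y
  proof -
    have c: "c \<in> charts_at M (chart_inv c y)" by (rule chart_inv_charts_at[OF that])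
    obtain vs where "vs \<in> tangent_lists M (chart_inv c y) (2 * n + 1)"
      "contact_vol n \<eta> (ext_deriv M \<eta>) (chart_inv c y) vs \<noteq> 0"
      using \<eta> charts_at_points[OF c] unfolding contact_form_def by blast
    from contact_vol_basis_nonzero[OF \<eta>s c bs this] show ?thesis using that by simp
  qed
  have ratio: "vol n (form_vec c \<alpha>) y ws = (\<rho> \<circ> chart_inv c) y * vol n (form_vec c \<eta>) y ws"
    if "c \<in> atlas M" "y \<in> snd c ` fst c" "length ws = 2 * n + 1" for c y ws
  proof -
    have c: "c \<in> charts_at M (chart_inv c y)" by (rule chart_inv_charts_at[OF that(1,2)])
    note ws = coord_tvec_list[OF c that(3)]
    show ?thesis
      using \<rho>[OF charts_at_points[OF c] ws(1)] that(2)
      unfolding contact_vol_chart[OF \<alpha> c ws(1)] contact_vol_chart[OF \<eta>s c ws(1)] ws(2) by simp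
  qed
  have sm: "smooth_on (snd c ` fst c) (f \<circ> chart_inv c)" "smooth_on (snd c ` fst c) (k \<circ> chart_inv c)"
    if "c \<in> atlas M" for c
    using f k that unfolding smooth_fun_on_points by blast+
  note R = vol_ratio[OF chart_facts(2) smooth_form_vec[OF \<alpha>] smooth_form_vec[OF \<eta>s] smooth_vf_coord[OF X]
      sm conformal_on_chart[OF \<alpha> X _ L\<alpha>] conformal_on_chart[OF \<eta>s X _ L\<eta>] dim bs(1) nz ratio]
  show sm\<rho>: "smooth_fun_on M (points M) \<rho>"
    unfolding smooth_fun_on_points by (intro ballI R(1))
  assume p: "p \<in> points M"
  define c where "c = some_chart M p"
  have c: "c \<in> charts_at M p" unfolding c_def by (rule some_chart_in[OF p])
  note ca = charts_atD[OF c]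
  have "fd (\<rho> \<circ> chart_inv c) (snd c p) (vf_coord X c (snd c p)) =
      (real n + 1) * ((k \<circ> chart_inv c) (snd c p) - (f \<circ> chart_inv c) (snd c p)) * (\<rho> \<circ> chart_inv c) (snd c p)"
    by (rule R(2)) (use ca in auto)
  then show "vf_app M X \<rho> p = (real n + 1) * (k p - f p) * \<rho> p"
    using vf_app_eq[OF X c smooth_fun_differentiable[OF sm\<rho> c]] ca by (simp add: vf_coord_def)
qed

section \<open>Smooth maps in charts\<close>

lemma local_rep:
  assumes \<Phi>: "smooth_map_on M M U \<Phi>" and U: "openin (topo M) U" and c: "c \<in> atlas M" "d \<in> atlas M"
  shows "open (snd c ` (fst c \<inter> U \<inter> \<Phi> -` fst d))"
    and "smooth_on (snd c ` (fst c \<inter> U \<inter> \<Phi> -` fst d)) (snd d \<circ> \<Phi> \<circ> chart_inv c)"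
proof -
  have "continuous_map (subtopology (topo M) U) (topo M) \<Phi>" using \<Phi> by (simp add: smooth_map_on_def)
  from openin_continuous_map_preimage[OF this chart_facts(1)[OF c(2)]]
  have "openin (topo M) {x \<in> topspace (subtopology (topo M) U). \<Phi> x \<in> fst d}"
    using openin_open_subtopology[OF U] by blast
  moreover have "fst c \<inter> {x \<in> topspace (subtopology (topo M) U). \<Phi> x \<in> fst d} = fst c \<inter> U \<inter> \<Phi> -` fst d"
    using openin_subset[OF U] by auto
  ultimately show "open (snd c ` (fst c \<inter> U \<inter> \<Phi> -` fst d))"
    using open_chart_image[OF c(1)] by metis
  show "smooth_on (snd c ` (fst c \<inter> U \<inter> \<Phi> -` fst d)) (snd d \<circ> \<Phi> \<circ> chart_inv c)"
    using \<Phi> c unfolding smooth_map_on_def by blast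
qed

lemma local_rep_has_derivative:
  assumes "smooth_map_on M M U \<Phi>" "openin (topo M) U" "p \<in> U" "c \<in> charts_at M p" "d \<in> charts_at M (\<Phi> p)"
  shows "((snd d \<circ> \<Phi> \<circ> chart_inv c) has_derivative fd (snd d \<circ> \<Phi> \<circ> chart_inv c) (snd c p)) (at (snd c p))"
  using assms charts_atD[OF assms(4)] charts_atD[OF assms(5)]
  by (intro smooth_on_has_derivative[OF local_rep(2,1)]) auto

end

locale smooth_endo = smooth_mfd M for M :: "('m, 'e::euclidean_space) manifold" +
  fixes \<Phi> :: "'m \<Rightarrow> 'm"
  assumes smooth_map: "smooth_map_on M M (points M) \<Phi>"
begin

lemma openin_points: "openin (topo M) (points M)"
  by (metis openin_topspace points_eq)

lemma image_points: "p \<in> points M \<Longrightarrow> \<Phi> p \<in> points M"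
  using smooth_map continuous_map_image_subset_topspace[of "subtopology (topo M) (points M)" "topo M" \<Phi>]
  by (auto simp: smooth_map_on_def)

lemma tangent_map_chart:
  assumes c: "c \<in> charts_at M p" and d: "d \<in> charts_at M (\<Phi> p)" and v: "v \<in> tangent_space M p"
  shows "tangent_map M M \<Phi> p v d = fd (snd d \<circ> \<Phi> \<circ> chart_inv c) (snd c p) (v c)"
proof -
  define c0 where "c0 = some_chart M p"
  have p: "p \<in> points M" by (rule charts_at_points[OF c])
  have c0: "c0 \<in> charts_at M p" unfolding c0_def by (rule some_chart_in[OF p])
  have "tangent_map M M \<Phi> p v d = fd (snd d \<circ> \<Phi> \<circ> chart_inv c0) (snd c0 p) (v c0)"
    using d by (simp add: tangent_map_def c0_def Let_def)
  also have "\<dots> = fd (snd d \<circ> \<Phi> \<circ> chart_inv c) (snd c p) (fd (transition c0 c) (snd c0 p) (v c0))"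
    using fd_eq[OF chart_change_has_derivative[OF c0 c
        differentiableI[OF local_rep_has_derivative[OF smooth_map openin_points p c d]]]] by simp
  finally show ?thesis using tangent_space_chart[OF v c0 c] by simp
qed

lemma tangent_map_in:
  assumes p: "p \<in> points M" and v: "v \<in> tangent_space M p"
  shows "tangent_map M M \<Phi> p v \<in> tangent_space M (\<Phi> p)"
proof -
  define c where "c = some_chart M p"
  have c: "c \<in> charts_at M p" unfolding c_def by (rule some_chart_in[OF p])
  have "tangent_map M M \<Phi> p v d' = fd (transition d d') (snd d (\<Phi> p)) (tangent_map M M \<Phi> p v d)"
    if d: "d \<in> charts_at M (\<Phi> p)" and d': "d' \<in> charts_at M (\<Phi> p)" for d d'
  proof -
    let ?\<phi> = "snd d \<circ> \<Phi> \<circ> chart_inv c" and ?W = "snd c ` (fst c \<inter> points M \<inter> \<Phi> -` fst d)"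
    note ca = charts_atD[OF c] and da = charts_atD[OF d]
    have "(transition d d' has_derivative fd (transition d d') (snd d (\<Phi> p))) (at (?\<phi> (snd c p)))"
      using transition_has_derivative[OF d d'] ca by simp
    from diff_chain_at[OF local_rep_has_derivative[OF smooth_map openin_points p c d] this]
    have 1: "(transition d d' \<circ> ?\<phi> has_derivative
        (\<lambda>v. fd (transition d d') (snd d (\<Phi> p)) (fd ?\<phi> (snd c p) v))) (at (snd c p))"
      by (simp add: o_def)
    have "(snd d' \<circ> \<Phi> \<circ> chart_inv c has_derivative
        (\<lambda>v. fd (transition d d') (snd d (\<Phi> p)) (fd ?\<phi> (snd c p) v))) (at (snd c p))"
    proof (rule has_derivative_transform_within_open[OF 1])
      show "open ?W" by (rule local_rep(1)[OF smooth_map openin_points ca(1) da(1)])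
      show "snd c p \<in> ?W" using ca da p by auto
      show "(transition d d' \<circ> ?\<phi>) x = (snd d' \<circ> \<Phi> \<circ> chart_inv c) x" if "x \<in> ?W" for x
        using that ca da by (auto simp: transition_def)
    qed
    then show ?thesis
      unfolding tangent_map_chart[OF c d v] tangent_map_chart[OF c d' v] by (simp add: fd_eq)
  qed
  moreover have "tangent_map M M \<Phi> p v d = 0" if "d \<notin> charts_at M (\<Phi> p)" for d
    using that by (simp add: tangent_map_def)
  ultimately show ?thesis unfolding tangent_space_def by blast
qed

lemma tangent_map_lincomb:
  assumes p: "p \<in> points M" and u: "u \<in> tangent_space M p" and w: "w \<in> tangent_space M p"
  shows "tangent_map M M \<Phi> p (\<lambda>c. r *\<^sub>R u c + s *\<^sub>R w c) =
    (\<lambda>d. r *\<^sub>R tangent_map M M \<Phi> p u d + s *\<^sub>R tangent_map M M \<Phi> p w d)"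
proof -
  define c d where "c = some_chart M p" and "d = some_chart M (\<Phi> p)"
  have c: "c \<in> charts_at M p" unfolding c_def by (rule some_chart_in[OF p])
  have d: "d \<in> charts_at M (\<Phi> p)" unfolding d_def by (rule some_chart_in[OF image_points[OF p]])
  have l: "linear (fd (snd d \<circ> \<Phi> \<circ> chart_inv c) (snd c p))"
    by (rule has_derivative_linear[OF local_rep_has_derivative[OF smooth_map openin_points p c d]])
  show ?thesis
  proof (rule tangent_space_eqI[OF _ _ d])
    show "tangent_map M M \<Phi> p (\<lambda>c. r *\<^sub>R u c + s *\<^sub>R w c) \<in> tangent_space M (\<Phi> p)"
      by (intro tangent_map_in p tangent_space_lincomb u w)
    show "(\<lambda>d. r *\<^sub>R tangent_map M M \<Phi> p u d + s *\<^sub>R tangent_map M M \<Phi> p w d) \<in> tangent_space M (\<Phi> p)"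
      by (intro tangent_map_in p tangent_space_lincomb u w)
  qed (simp add: tangent_map_chart[OF c d] tangent_space_lincomb u w linear_add[OF l] linear_scale[OF l])
qed

text \<open>Linearity comes before smoothness, because smoothness of the pullback is read off from
  \<open>form_vec\<close>, which represents a form only once the form is known to be linear.\<close>

lemma linear_form_pullback:
  assumes "linear_form \<eta>"
  shows "linear_form (pullback M M \<Phi> \<eta>)"
  using assms unfolding linear_form_def
  by (simp add: pullback_def tangent_map_lincomb tangent_map_in image_points)

lemma form_vec_pullback:
  assumes \<eta>: "linear_form \<eta>" and c: "c \<in> atlas M" and d: "d \<in> atlas M"
    and x: "x \<in> snd c ` (fst c \<inter> points M \<inter> \<Phi> -` fst d)"
  shows "form_vec c (pullback M M \<Phi> \<eta>) x \<bullet> v =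
    form_vec d \<eta> ((snd d \<circ> \<Phi> \<circ> chart_inv c) x) \<bullet> fd (snd d \<circ> \<Phi> \<circ> chart_inv c) x v"
proof -
  let ?p = "chart_inv c x"
  have xc: "x \<in> snd c ` fst c" using x by auto
  have p: "c \<in> charts_at M ?p" by (rule chart_inv_charts_at[OF c xc])
  have dp: "d \<in> charts_at M (\<Phi> ?p)" using x c d by (auto simp: charts_at_def)
  let ?v = "coord_tvec M c ?p v"
  have t: "?v \<in> tangent_space M ?p" by (rule coord_tvec_in[OF p])
  have "form_vec c (pullback M M \<Phi> \<eta>) x \<bullet> v = pullback M M \<Phi> \<eta> ?p [?v]"
    using form_vec_inner[OF linear_form_pullback[OF \<eta>] c xc] by (simp add: coord_form_def)
  also have "\<dots> = \<eta> (\<Phi> ?p) [tangent_map M M \<Phi> ?p ?v]" by (simp add: pullback_def)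
  also have "\<dots> = form_vec d \<eta> (snd d (\<Phi> ?p)) \<bullet> tangent_map M M \<Phi> ?p ?v d"
    by (rule form_eval[OF \<eta> dp tangent_map_in[OF charts_at_points[OF p] t]])
  also have "tangent_map M M \<Phi> ?p ?v d = fd (snd d \<circ> \<Phi> \<circ> chart_inv c) x v"
    using tangent_map_chart[OF p dp t] p xc by simp
  finally show ?thesis by simp
qed

lemma pullback_curl:
  assumes \<eta>: "smooth_form M 1 \<eta>" and c: "c \<in> atlas M" and d: "d \<in> atlas M"
  shows "smooth_on (snd c ` (fst c \<inter> points M \<inter> \<Phi> -` fst d)) (form_vec c (pullback M M \<Phi> \<eta>))"
    and "x \<in> snd c ` (fst c \<inter> points M \<inter> \<Phi> -` fst d) \<Longrightarrow>
      curl (form_vec c (pullback M M \<Phi> \<eta>)) x [v, w] =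
      curl (form_vec d \<eta>) ((snd d \<circ> \<Phi> \<circ> chart_inv c) x)
        [fd (snd d \<circ> \<Phi> \<circ> chart_inv c) x v, fd (snd d \<circ> \<Phi> \<circ> chart_inv c) x w]"
proof -
  have "(snd d \<circ> \<Phi> \<circ> chart_inv c) ` (snd c ` (fst c \<inter> points M \<inter> \<Phi> -` fst d)) \<subseteq> snd d ` fst d"
    using c by auto
  note * = pullback_field[OF local_rep(1)[OF smooth_map openin_points c d] chart_facts(2)[OF d]
      local_rep(2)[OF smooth_map openin_points c d] this smooth_form_vec[OF \<eta> d]
      form_vec_pullback[OF smooth_form_linear[OF \<eta>] c d]]
  show "smooth_on (snd c ` (fst c \<inter> points M \<inter> \<Phi> -` fst d)) (form_vec c (pullback M M \<Phi> \<eta>))"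
    by (rule *(1))
  show "x \<in> snd c ` (fst c \<inter> points M \<inter> \<Phi> -` fst d) \<Longrightarrow>
      curl (form_vec c (pullback M M \<Phi> \<eta>)) x [v, w] =
      curl (form_vec d \<eta>) ((snd d \<circ> \<Phi> \<circ> chart_inv c) x)
        [fd (snd d \<circ> \<Phi> \<circ> chart_inv c) x v, fd (snd d \<circ> \<Phi> \<circ> chart_inv c) x w]"
    by (rule *(2))
qed

text \<open>The preimages of the target charts cover the domain of a source chart, and on each of
  them \<open>pullback_curl\<close> gives smoothness.\<close>

lemma smooth_pullback:
  assumes \<eta>: "smooth_form M 1 \<eta>"
  shows "smooth_form M 1 (pullback M M \<Phi> \<eta>)"
  unfolding smooth_form_1_iff
proof (intro conjI ballI allI)
  show lin: "linear_form (pullback M M \<Phi> \<eta>)"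
    by (rule linear_form_pullback[OF smooth_form_linear[OF \<eta>]])
  fix c w assume c: "c \<in> atlas M"
  note op = chart_facts(2)[OF c]
  have "smooth_on (snd c ` fst c) (form_vec c (pullback M M \<Phi> \<eta>))"
  proof (rule smooth_on_local[OF op])
    fix x assume x: "x \<in> snd c ` fst c"
    have p: "chart_inv c x \<in> points M" by (rule charts_at_points[OF chart_inv_charts_at[OF c x]])
    obtain d where d: "d \<in> charts_at M (\<Phi> (chart_inv c x))" using some_chart_in[OF image_points[OF p]] by blast
    note da = charts_atD[OF d]
    have "x \<in> snd c ` (fst c \<inter> points M \<inter> \<Phi> -` fst d)"
      using x p da(2) by (intro image_eqI[of _ _ "chart_inv c x"]) auto
    then show "\<exists>T. open T \<and> x \<in> T \<and> smooth_on T (form_vec c (pullback M M \<Phi> \<eta>))"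
      using local_rep(1)[OF smooth_map openin_points c da(1)] pullback_curl(1)[OF \<eta> c da(1)] by blast
  qed
  then have S: "smooth_on (snd c ` fst c) (\<lambda>x. form_vec c (pullback M M \<Phi> \<eta>) x \<bullet> w)"
    by (intro smooth_on_inner op smooth_on_const)
  show "smooth_on (snd c ` fst c) (\<lambda>x. coord_form M c (pullback M M \<Phi> \<eta>) x [w])"
    by (rule iffD2[OF smooth_on_cong[OF op] S]) (simp add: form_vec_inner[OF lin c])
qed

lemma ext_deriv_pullback:
  assumes \<eta>: "smooth_form M 1 \<eta>" and p: "p \<in> points M"
    and v: "v \<in> tangent_space M p" and w: "w \<in> tangent_space M p"
  shows "ext_deriv M (pullback M M \<Phi> \<eta>) p [v, w] =
    ext_deriv M \<eta> (\<Phi> p) [tangent_map M M \<Phi> p v, tangent_map M M \<Phi> p w]"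
proof -
  define c d where "c = some_chart M p" and "d = some_chart M (\<Phi> p)"
  have c: "c \<in> charts_at M p" unfolding c_def by (rule some_chart_in[OF p])
  have d: "d \<in> charts_at M (\<Phi> p)" unfolding d_def by (rule some_chart_in[OF image_points[OF p]])
  note ca = charts_atD[OF c] and da = charts_atD[OF d]
  have "snd c p \<in> snd c ` (fst c \<inter> points M \<inter> \<Phi> -` fst d)" using ca da p by auto
  from pullback_curl(2)[OF \<eta> ca(1) da(1) this] show ?thesis
    using ext_deriv_1[OF smooth_pullback[OF \<eta>] c v w]
      ext_deriv_1[OF \<eta> d tangent_map_in[OF p v] tangent_map_in[OF p w]]
      tangent_map_chart[OF c d v] tangent_map_chart[OF c d w] ca by simp
qed

text \<open>Pointwise, the wedge commutes with mapping the arguments, so naturality of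
  \<open>d\<close> is the only content.\<close>

lemma contact_vol_pullback:
  assumes \<eta>: "smooth_form M 1 \<eta>" and p: "p \<in> points M" and vs: "vs \<in> tangent_lists M p (2 * n + 1)"
  shows "contact_vol n (pullback M M \<Phi> \<eta>) (ext_deriv M (pullback M M \<Phi> \<eta>)) p vs =
    pullback M M \<Phi> (contact_vol n \<eta> (ext_deriv M \<eta>)) p vs"
proof -
  have len: "length vs = 2 * n + 1" and sub: "set vs \<subseteq> tangent_space M p"
    using vs by (auto simp: tangent_lists_def)
  show ?thesis
    unfolding pullback_def[of _ _ _ "contact_vol n \<eta> _"] contact_vol_eq_lvol lvol_map[OF len]
  proof (rule lvol_cong[OF len])
    fix us assume us: "length us = 2" "set us \<subseteq> set vs"
    then obtain v w where vw: "us = [v, w]" by (auto simp: numeral_2_eq_2 length_Suc_conv)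
    then have "v \<in> tangent_space M p" "w \<in> tangent_space M p" using us(2) sub by auto
    then show "ext_deriv M (pullback M M \<Phi> \<eta>) p us = ext_deriv M \<eta> (\<Phi> p) (map (tangent_map M M \<Phi> p) us)"
      using ext_deriv_pullback[OF \<eta> p] vw by simp
  qed (simp add: pullback_def)
qed

text \<open>With \<open>\<Psi>\<close> the local inverse, differentiating
  \<open>\<Phi> \<circ> \<Psi> = id\<close> in charts yields a right inverse of the tangent
  map.\<close>

lemma tangent_map_surj:
  assumes \<Phi>: "local_diffeo M M \<Phi>" and p: "p \<in> points M" and w: "w \<in> tangent_space M (\<Phi> p)"
  shows "\<exists>v\<in>tangent_space M p. tangent_map M M \<Phi> p v = w"
proof -
  obtain U where U: "p \<in> U" "openin (topo M) U" "openin (topo M) (\<Phi> ` U)" "inj_on \<Phi> U"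
    "smooth_map_on M M (\<Phi> ` U) (inv_into U \<Phi>)"
    using \<Phi> p unfolding local_diffeo_def by blast
  define \<Psi> where "\<Psi> = inv_into U \<Phi>"
  have \<Psi>: "\<Psi> (\<Phi> p) = p" using U by (simp add: \<Psi>_def)
  define c d where "c = some_chart M p" and "d = some_chart M (\<Phi> p)"
  have c: "c \<in> charts_at M p" unfolding c_def by (rule some_chart_in[OF p])
  have d: "d \<in> charts_at M (\<Phi> p)" unfolding d_def by (rule some_chart_in[OF image_points[OF p]])
  note ca = charts_atD[OF c] and da = charts_atD[OF d]
  let ?\<phi> = "snd d \<circ> \<Phi> \<circ> chart_inv c" and ?\<psi> = "snd c \<circ> \<Psi> \<circ> chart_inv d"
  let ?V = "snd d ` (fst d \<inter> \<Phi> ` U \<inter> \<Psi> -` fst c)"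
  have sm: "smooth_map_on M M (\<Phi> ` U) \<Psi>" using U(5) by (simp add: \<Psi>_def)
  have \<psi>: "(?\<psi> has_derivative fd ?\<psi> (snd d (\<Phi> p))) (at (snd d (\<Phi> p)))"
    by (rule local_rep_has_derivative[OF sm U(3) _ d]) (use U c \<Psi> in auto)
  have "(?\<phi> has_derivative fd ?\<phi> (snd c p)) (at (?\<psi> (snd d (\<Phi> p))))"
    using local_rep_has_derivative[OF smooth_map openin_points p c d] da \<Psi> by simp
  from diff_chain_at[OF \<psi> this]
  have 1: "(?\<phi> \<circ> ?\<psi> has_derivative (\<lambda>v. fd ?\<phi> (snd c p) (fd ?\<psi> (snd d (\<Phi> p)) v))) (at (snd d (\<Phi> p)))"
    by (simp add: o_def)
  have "((\<lambda>y. y) has_derivative (\<lambda>v. fd ?\<phi> (snd c p) (fd ?\<psi> (snd d (\<Phi> p)) v))) (at (snd d (\<Phi> p)))"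
  proof (rule has_derivative_transform_within_open[OF 1])
    show "open ?V" by (rule local_rep(1)[OF sm U(3) da(1) ca(1)])
    show "snd d (\<Phi> p) \<in> ?V" using U da ca \<Psi> by auto
    show "(?\<phi> \<circ> ?\<psi>) y = y" if "y \<in> ?V" for y
      using that da ca by (auto simp: \<Psi>_def f_inv_into_f)
  qed
  from fun_cong[OF has_derivative_unique[OF this has_derivative_ident]]
  have id: "fd ?\<phi> (snd c p) (fd ?\<psi> (snd d (\<Phi> p)) v) = v" for v .
  let ?v = "coord_tvec M c p (fd ?\<psi> (snd d (\<Phi> p)) (w d))"
  have v: "?v \<in> tangent_space M p" by (rule coord_tvec_in[OF c])
  have "tangent_map M M \<Phi> p ?v = w"
    by (rule tangent_space_eqI[OF tangent_map_in[OF p v] w d])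
      (simp add: tangent_map_chart[OF c d v] coord_tvec_self[OF c] id)
  with v show ?thesis by blast
qed

text \<open>A list at \<open>\<Phi> p\<close> with nonzero volume is lifted vector by vector through
  the surjective tangent map. This is what forces \<open>\<rho> \<noteq> 0\<close>.\<close>

lemma pullback_vol_nonzero:
  assumes "local_diffeo M M \<Phi>" "contact_form M n \<eta>" "p \<in> points M"
  shows "\<exists>vs\<in>tangent_lists M p (2 * n + 1). pullback M M \<Phi> (contact_vol n \<eta> (ext_deriv M \<eta>)) p vs \<noteq> 0"
proof -
  obtain ws where ws: "ws \<in> tangent_lists M (\<Phi> p) (2 * n + 1)"
    "contact_vol n \<eta> (ext_deriv M \<eta>) (\<Phi> p) ws \<noteq> 0"
    using assms(2) image_points[OF assms(3)] unfolding contact_form_def by blast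
  have "\<forall>w\<in>tangent_space M (\<Phi> p). \<exists>v. v \<in> tangent_space M p \<and> tangent_map M M \<Phi> p v = w"
    using tangent_map_surj[OF assms(1,3)] by blast
  from bchoice[OF this] obtain S where
    S: "\<forall>w\<in>tangent_space M (\<Phi> p). S w \<in> tangent_space M p \<and> tangent_map M M \<Phi> p (S w) = w" by blast
  have "map (tangent_map M M \<Phi> p) (map S ws) = ws"
    using ws(1) S by (auto simp: tangent_lists_def intro!: map_idI)
  moreover have "map S ws \<in> tangent_lists M p (2 * n + 1)"
    using ws(1) S by (auto simp: tangent_lists_def)
  ultimately show ?thesis using ws(2) by (intro bexI[of _ "map S ws"]) (simp_all add: pullback_def)
qed

end


section \<open>Contact canonoid transformations\<close>

context smooth_mfd
begin

lemma hamiltonian_contraction_has_derivative: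
  assumes H: "smooth_fun_on M (points M) H" and \<eta>X: "\<And>p. p \<in> points M \<Longrightarrow> \<eta> p [X p] = - H p"
    and c: "c \<in> charts_at M p"
  shows "((\<lambda>p. \<eta> p [X p]) \<circ> chart_inv c has_derivative
    (\<lambda>v. - fd (H \<circ> chart_inv c) (snd c p) v)) (at (snd c p))"
proof (rule has_derivative_transform_within_open[OF has_derivative_minus[OF smooth_fun_has_derivative[OF H c]]])
  note ca = charts_atD[OF c]
  show "open (snd c ` fst c)" by (rule chart_facts(2)[OF ca(1)])
  show "snd c p \<in> snd c ` fst c" using ca by blast
  show "- (H \<circ> chart_inv c) x = ((\<lambda>p. \<eta> p [X p]) \<circ> chart_inv c) x" if "x \<in> snd c ` fst c" for x
    using \<eta>X[OF charts_at_points[OF chart_inv_charts_at[OF ca(1) that]]] by simp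
qed

text \<open>In Cartan's formula the \<open>dH\<close> contained in
  \<open>\<iota>\<^sub>X d\<eta>\<close> cancels against \<open>d(\<eta>(X)) = - dH\<close>.\<close>

lemma lie_deriv_contact_form:
  assumes \<eta>: "smooth_form M 1 \<eta>" and H: "smooth_fun_on M (points M) H"
    and X: "contact_hamiltonian_field M \<eta> R H X"
    and p: "p \<in> points M" and v: "v \<in> tangent_space M p"
  shows "lie_deriv M X \<eta> p [v] = - vf_app M R H p * \<eta> p [v]"
proof -
  have Xs: "smooth_vector_field M X" and \<eta>X: "\<And>q. q \<in> points M \<Longrightarrow> \<eta> q [X q] = - H q"
    using X by (auto simp: contact_hamiltonian_field_def)
  have "[v] \<in> tangent_lists M p 1" using v by (simp add: tangent_lists_def)
  then have "ext_deriv M \<eta> p [X p, v] = ext_deriv M (fun_form H) p [v] + - vf_app M R H p * \<eta> p [v]"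
    using X p unfolding contact_hamiltonian_field_def form_eq_def
    by (auto simp: interior_prod_def form_add_def form_scale_def)
  moreover have "ext_deriv M (fun_form (\<lambda>p. \<eta> p [X p])) p [v] = - ext_deriv M (fun_form H) p [v]"
  proof -
    define c where "c = some_chart M p"
    have c: "c \<in> charts_at M p" unfolding c_def by (rule some_chart_in[OF p])
    note d = hamiltonian_contraction_has_derivative[where \<eta> = \<eta> and X = X, OF H \<eta>X c]
    show ?thesis
      using ext_deriv_fun[OF c differentiableI[OF d] v] fd_eq[OF d]
        ext_deriv_fun[OF c smooth_fun_differentiable[OF H c] v] by simp
  qed
  ultimately show ?thesis
    by (simp add: lie_deriv_def form_add_def ext_deriv_interior_prod) (simp add: interior_prod_def)
qed

section \<open>The pencil of one-forms and its coefficients\<close>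

definition pencil :: "('m, 'e) form \<Rightarrow> ('m, 'e) form \<Rightarrow> real \<Rightarrow> ('m, 'e) form" where
  "pencil \<eta> \<beta> t = form_add \<eta> (form_scale (\<lambda>_. t) \<beta>)"

lemma smooth_fun_const: "smooth_fun_on M (points M) (\<lambda>_. t)"
  by (simp add: smooth_fun_on_points o_def)

lemma smooth_pencil: "smooth_form M 1 \<eta> \<Longrightarrow> smooth_form M 1 \<beta> \<Longrightarrow> smooth_form M 1 (pencil \<eta> \<beta> t)"
  unfolding pencil_def by (intro smooth_form_add smooth_form_scale smooth_fun_const)

text \<open>\<open>pencil_coeffs\<close> is phrased with \<open>d\<eta> + t d\<beta>\<close>,
  whereas \<open>contact_vol_ratio\<close> requires the exterior derivative of the member itself;
  linearity of \<open>d\<close> bridges the two.\<close>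

lemma contact_vol_pencil:
  assumes \<eta>: "smooth_form M 1 \<eta>" and \<beta>: "smooth_form M 1 \<beta>" and p: "p \<in> points M"
    and vs: "vs \<in> tangent_lists M p (2 * n + 1)"
  shows "contact_vol n (pencil \<eta> \<beta> t) (form_add (ext_deriv M \<eta>) (form_scale (\<lambda>_. t) (ext_deriv M \<beta>))) p vs
    = contact_vol n (pencil \<eta> \<beta> t) (ext_deriv M (pencil \<eta> \<beta> t)) p vs"
proof -
  have len: "length vs = 2 * n + 1" and sub: "set vs \<subseteq> tangent_space M p"
    using vs by (auto simp: tangent_lists_def)
  show ?thesis
    unfolding contact_vol_eq_lvol
  proof (rule lvol_cong[OF len])
    fix us assume us: "length us = 2" "set us \<subseteq> set vs"
    then obtain v w where vw: "us = [v, w]" by (auto simp: numeral_2_eq_2 length_Suc_conv)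
    then have t: "v \<in> tangent_space M p" "w \<in> tangent_space M p" using us(2) sub by auto
    show "form_add (ext_deriv M \<eta>) (form_scale (\<lambda>_. t) (ext_deriv M \<beta>)) p us = ext_deriv M (pencil \<eta> \<beta> t) p us"
      unfolding vw pencil_def ext_deriv_add[OF \<eta> smooth_form_scale(1)[OF \<beta> smooth_fun_const] p t]
        ext_deriv_scale_const[OF \<beta> p t] by (simp add: form_add_def form_scale_def)
  qed simp
qed

text \<open>It keeps the conservation claim from being vacuous. At each point the ratio to the
  volume of \<open>\<eta>\<close> is independent of the list, so it can be read off on one basis,
  where it is a polynomial in \<open>t\<close>.\<close>

lemma pencil_coeffs_exist:
  assumes \<eta>: "contact_form M n \<eta>" and \<beta>: "smooth_form M 1 \<beta>" and dim: "DIM('e) = 2 * n + 1"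
  shows "\<exists>C. pencil_coeffs M n \<eta> \<beta> C"
proof -
  have \<eta>s: "smooth_form M 1 \<eta>" using \<eta> by (simp add: contact_form_def)
  define V where "V t = contact_vol n (pencil \<eta> \<beta> t) (form_add (ext_deriv M \<eta>) (form_scale (\<lambda>_. t) (ext_deriv M \<beta>)))" for t
  obtain bs :: "'e list" where bs: "length bs = 2 * n + 1" "span (set bs) = UNIV"
    using Basis_list dim by metis
  have "\<exists>C. \<forall>t. \<forall>vs\<in>tangent_lists M p (2 * n + 1).
      V t p vs = (1 + (\<Sum>j=1..n+1. C j * t ^ j)) * contact_vol n \<eta> (ext_deriv M \<eta>) p vs" if p: "p \<in> points M" for p
  proof -
    define c where "c = some_chart M p"
    have c: "c \<in> charts_at M p" unfolding c_def by (rule some_chart_in[OF p])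
    let ?\<mu> = "contact_vol n \<eta> (ext_deriv M \<eta>) p" and ?bs = "map (coord_tvec M c p) bs"
    note B = coord_tvec_list[OF c bs(1)]
    obtain ws where ws: "ws \<in> tangent_lists M p (2 * n + 1)" "?\<mu> ws \<noteq> 0"
      using \<eta> p unfolding contact_form_def by blast
    have nz: "?\<mu> ?bs \<noteq> 0"
      using contact_vol_basis_nonzero[OF \<eta>s c bs ws] unfolding contact_vol_chart[OF \<eta>s c B(1)] B(2) .
    have ratio: "V t p vs = V t p ?bs / ?\<mu> ?bs * ?\<mu> vs" if vs: "vs \<in> tangent_lists M p (2 * n + 1)" for t vs
    proof -
      note P = smooth_pencil[OF \<eta>s \<beta>]
      have "?\<mu> ?bs * V t p vs = V t p ?bs * ?\<mu> vs"
        unfolding V_def contact_vol_pencil[OF \<eta>s \<beta> p vs] contact_vol_pencil[OF \<eta>s \<beta> p B(1)]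
          contact_vol_chart[OF P c vs] contact_vol_chart[OF P c B(1)]
          contact_vol_chart[OF \<eta>s c vs] contact_vol_chart[OF \<eta>s c B(1)] B(2)
        by (rule multilinear_alternating_proportional[OF multilinear_vol alternating_vol multilinear_vol alternating_vol bs])
          (use vs form_vec_differentiable[OF P c] form_vec_differentiable[OF \<eta>s c] in \<open>simp_all add: tangent_lists_def\<close>)
      then show ?thesis using nz by (simp add: field_simps)
    qed
    have "poly_fun (n + 1) (\<lambda>t. V t p ?bs)"
      unfolding V_def contact_vol_eq_lvol
      by (rule poly_fun_lvol) (simp_all add: pencil_def form_add_def form_scale_def poly_fun_affine[unfolded One_nat_def])
    then obtain q where q: "degree q \<le> n + 1" "\<And>t. V t p ?bs = poly q t"
      by (auto simp: poly_fun_def)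
    have q_sum: "poly q t = coeff q 0 + (\<Sum>j=1..n+1. coeff q j * t ^ j)" for t
    proof -
      have "poly q t = (\<Sum>j\<le>degree q. coeff q j * t ^ j)" by (rule poly_altdef)
      also have "\<dots> = (\<Sum>j\<le>n+1. coeff q j * t ^ j)"
        using q(1) by (intro sum.mono_neutral_left) (auto simp: coeff_eq_0)
      also have "{..n+1} = insert 0 {1..n+1}" by auto
      finally show ?thesis by simp
    qed
    \<comment> \<open>At \<open>t = 0\<close> the pencil is \<open>\<eta>\<close> itself, whence the
      constant term 1 after division.\<close>
    have "V 0 p ?bs = ?\<mu> ?bs"
      by (simp add: V_def pencil_def contact_vol_eq_lvol form_add_def form_scale_def)
    then have q0: "coeff q 0 = ?\<mu> ?bs" using q(2)[of 0] by (simp add: poly_0_coeff_0)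
    show ?thesis
    proof (intro exI[of _ "\<lambda>j. coeff q j / ?\<mu> ?bs"] allI ballI)
      fix t vs assume vs: "vs \<in> tangent_lists M p (2 * n + 1)"
      have "poly q t / ?\<mu> ?bs = 1 + (\<Sum>j=1..n+1. coeff q j / ?\<mu> ?bs * t ^ j)"
        unfolding q_sum q0 using nz by (simp add: add_divide_distrib sum_divide_distrib)
      then show "V t p vs = (1 + (\<Sum>j=1..n+1. coeff q j / ?\<mu> ?bs * t ^ j)) * ?\<mu> vs"
        using ratio[OF vs, of t] q(2) by simp
    qed
  qed
  then have "\<forall>p\<in>points M. \<exists>C. \<forall>t. \<forall>vs\<in>tangent_lists M p (2 * n + 1).
      V t p vs = (1 + (\<Sum>j=1..n+1. C j * t ^ j)) * contact_vol n \<eta> (ext_deriv M \<eta>) p vs" by blast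
  from bchoice[OF this] obtain C where C: "\<forall>p\<in>points M. \<forall>t. \<forall>vs\<in>tangent_lists M p (2 * n + 1).
      V t p vs = (1 + (\<Sum>j=1..n+1. C p j * t ^ j)) * contact_vol n \<eta> (ext_deriv M \<eta>) p vs" by blast
  show ?thesis
    by (rule exI[of _ "\<lambda>j p. C p j"]) (use C in \<open>simp add: pencil_coeffs_def form_eq_def form_scale_def V_def pencil_def\<close>)
qed

text \<open>As \<open>t\<close> is constant and the Lie derivative is linear, each member of the
  pencil has the conformal factor \<open>a\<close> of \<open>\<eta>\<close>, so
  \<open>contact_vol_ratio\<close> makes its volume ratio smooth and conserved. A member may
  degenerate: only \<open>\<eta>\<close> stands in the denominator.\<close>

lemma pencil_coeffs_conserved:
  assumes \<eta>: "contact_form M n \<eta>" and \<beta>: "smooth_form M 1 \<beta>" and dim: "DIM('e) = 2 * n + 1"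
    and X: "smooth_vector_field M X" and a: "smooth_fun_on M (points M) a"
    and L\<eta>: "\<And>p v. p \<in> points M \<Longrightarrow> v \<in> tangent_space M p \<Longrightarrow> lie_deriv M X \<eta> p [v] = - a p * \<eta> p [v]"
    and L\<beta>: "\<And>p v. p \<in> points M \<Longrightarrow> v \<in> tangent_space M p \<Longrightarrow> lie_deriv M X \<beta> p [v] = - a p * \<beta> p [v]"
    and C: "pencil_coeffs M n \<eta> \<beta> C" and j: "j \<in> {1..n+1}"
  shows "smooth_fun_on M (points M) (C j)" and "p \<in> points M \<Longrightarrow> vf_app M X (C j) p = 0"
proof -
  have \<eta>s: "smooth_form M 1 \<eta>" using \<eta> by (simp add: contact_form_def)
  define \<rho> where "\<rho> t p = 1 + (\<Sum>j=1..n+1. C j p * t ^ j)" for t p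
  have L: "lie_deriv M X (pencil \<eta> \<beta> t) p [v] = - a p * pencil \<eta> \<beta> t p [v]"
    if p: "p \<in> points M" and v: "v \<in> tangent_space M p" for p v t
  proof -
    have "vf_app M X (\<lambda>_. t) p = 0"
      using vf_app_lincomb[OF X p, of "{}" "\<lambda>_ _. 0"] vf_app_compose[OF X smooth_fun_const p DERIV_const] by simp
    then show ?thesis
      unfolding pencil_def lie_deriv_add[OF \<eta>s smooth_form_scale(1)[OF \<beta> smooth_fun_const] X p v]
        lie_deriv_scale[OF \<beta> smooth_fun_const X p v] L\<eta>[OF p v] L\<beta>[OF p v]
      by (simp add: form_add_def form_scale_def algebra_simps)
  qed
  have R: "contact_vol n (pencil \<eta> \<beta> t) (ext_deriv M (pencil \<eta> \<beta> t)) p vs = \<rho> t p * contact_vol n \<eta> (ext_deriv M \<eta>) p vs"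
    if "p \<in> points M" "vs \<in> tangent_lists M p (2 * n + 1)" for p vs t
    using C that unfolding contact_vol_pencil[OF \<eta>s \<beta> that, symmetric]
    by (simp add: pencil_coeffs_def form_eq_def form_scale_def pencil_def \<rho>_def)
  have \<rho>s: "smooth_fun_on M (points M) (\<rho> t)" for t
    by (rule contact_vol_ratio(1)[OF smooth_pencil[OF \<eta>s \<beta>] \<eta> dim X a a L L\<eta> R])
  have X\<rho>: "vf_app M X (\<rho> t) p = (real n + 1) * (a p - a p) * \<rho> t p" if "p \<in> points M" for t p
    by (rule contact_vol_ratio(2)[OF smooth_pencil[OF \<eta>s \<beta>] \<eta> dim X a a L L\<eta> R that])
  \<comment> \<open>The weights do not depend on the point, so \<open>C j\<close> is a fixed linear
    combination of the ratios at \<open>t = 0, ..., n + 1\<close>. This yields its smoothness as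
    well as its conservation.\<close>
  obtain w where w: "\<And>c. c j = (\<Sum>k\<le>n+1. w k * (\<Sum>i\<le>n+1. c i * real k ^ i))"
    using poly_coeff_from_values[of j "n + 1"] j by auto
  have "C j p = (\<Sum>k\<le>n+1. w k * \<rho> (real k) p)" for p
  proof -
    have "(\<Sum>i\<le>n+1. (if i = 0 then 1 else C i p) * real k ^ i) = \<rho> (real k) p" for k
    proof -
      have "{..n+1} = insert 0 {1..n+1}" by auto
      then show ?thesis by (simp add: \<rho>_def)
    qed
    \<comment> \<open>The constant term 1 takes the place of coefficient 0; because
      \<open>j \<ge> 1\<close>, the coefficient extracted is still \<open>C j p\<close>.\<close>
    then show ?thesis using w[of "\<lambda>i. if i = 0 then 1 else C i p"] j by simp
  qed
  then have Cj: "C j = (\<lambda>p. \<Sum>k\<le>n+1. w k * \<rho> (real k) p)" by blast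
  show "smooth_fun_on M (points M) (C j)"
    unfolding Cj by (intro smooth_fun_lincomb \<rho>s)
  assume p: "p \<in> points M"
  show "vf_app M X (C j) p = 0"
    unfolding Cj vf_app_lincomb[OF X p \<rho>s] by (simp add: X\<rho>[OF p])
qed

end

theorem proposition3:
  fixes M :: "('m, 'e::euclidean_space) manifold"
    and n :: nat
    and \<eta> \<mu> \<beta> :: "('m, 'e) form"
    and H a K \<rho> J I :: "'m \<Rightarrow> real"
    and R X :: "'m \<Rightarrow> ('m, 'e) tvec"
    and \<Phi> :: "'m \<Rightarrow> 'm"
  assumes "n \<ge> 1"
    and "contact_hamiltonian_system M n \<eta> H"
    and "reeb_field M \<eta> R"
    and "contact_hamiltonian_field M \<eta> R H X"
    and "contact_canonoid_transformation M \<eta> X \<Phi>"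
    and "a = vf_app M R H"
    and "\<mu> = contact_vol n \<eta> (ext_deriv M \<eta>)"
    and "K = (\<lambda>p. - pullback M M \<Phi> \<eta> p [X p])"
    and "form_eq M (2 * n + 1) (pullback M M \<Phi> \<mu>) (form_scale \<rho> \<mu>)"
    and "\<beta> = form_scale (\<lambda>p. \<bar>\<rho> p\<bar> powr (- 1 / real (n + 1))) (pullback M M \<Phi> \<eta>)"
    and "J = (\<lambda>p. K p / \<bar>\<rho> p\<bar> powr (1 / real (n + 1)))"
    and "I = (\<lambda>p. K p / (H p * \<bar>\<rho> p\<bar> powr (1 / real (n + 1))))"
  shows "(\<forall>p\<in>points M. \<rho> p \<noteq> 0) \<and>
    smooth_form M 1 \<beta> \<and>
    form_eq M 1 (lie_deriv M X \<beta>) (form_scale (\<lambda>p. - a p) \<beta>) \<and>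
    smooth_fun_on M (points M) J \<and>
    (\<forall>p\<in>points M. vf_app M X J p = - a p * J p) \<and>
    smooth_fun_on M {p\<in>points M. H p \<noteq> 0} I \<and>
    (\<forall>p\<in>points M. H p \<noteq> 0 \<longrightarrow> vf_app M X I p = 0) \<and>
    (\<exists>C. pencil_coeffs M n \<eta> \<beta> C) \<and>
    (\<forall>C. pencil_coeffs M n \<eta> \<beta> C \<longrightarrow>
      (\<forall>j\<in>{1..n+1}. smooth_fun_on M (points M) (C j) \<and>
        (\<forall>p\<in>points M. vf_app M X (C j) p = 0)))"
proof -
  have M: "Defs.smooth_manifold M" and dim: "DIM('e) = 2 * n + 1" and \<eta>: "contact_form M n \<eta>"
    and H: "smooth_fun_on M (points M) H"
    using assms(2) by (auto simp: contact_hamiltonian_system_def)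
  have R: "smooth_vector_field M R" using assms(3) by (simp add: reeb_field_def)
  have X: "smooth_vector_field M X" and \<eta>X: "\<And>p. p \<in> points M \<Longrightarrow> \<eta> p [X p] = - H p"
    using assms(4) by (auto simp: contact_hamiltonian_field_def)
  obtain b where \<Phi>: "smooth_map_on M M (points M) \<Phi>" "local_diffeo M M \<Phi>"
    and b: "smooth_fun_on M (points M) b"
    and L: "form_eq M 1 (lie_deriv M X (pullback M M \<Phi> \<eta>)) (form_scale (\<lambda>p. - b p) (pullback M M \<Phi> \<eta>))"
    using assms(5) by (auto simp: contact_canonoid_transformation_def contact_canonoid_map_def)
  interpret smooth_endo M \<Phi> by unfold_locales (use M \<Phi> in auto)
  define \<theta> where "\<theta> = pullback M M \<Phi> \<eta>"
  define N where "N = real n + 1"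
  have N: "N > 0" "real (n + 1) = N" by (simp_all add: N_def)
  have \<eta>s: "smooth_form M 1 \<eta>" using \<eta> by (simp add: contact_form_def)
  have \<theta>s: "smooth_form M 1 \<theta>" unfolding \<theta>_def by (rule smooth_pullback[OF \<eta>s])
  have as: "smooth_fun_on M (points M) a" unfolding assms(6) by (rule smooth_vf_app[OF R H])
  have single: "[v] \<in> tangent_lists M p 1" if "v \<in> tangent_space M p" for v p
    using that by (simp add: tangent_lists_def)
  have L\<theta>: "lie_deriv M X \<theta> p [v] = - b p * \<theta> p [v]" if "p \<in> points M" "v \<in> tangent_space M p" for p v
    using L that single unfolding form_eq_def form_scale_def \<theta>_def by blast
  have L\<eta>: "lie_deriv M X \<eta> p [v] = - a p * \<eta> p [v]" if "p \<in> points M" "v \<in> tangent_space M p" for p v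
    unfolding assms(6) by (rule lie_deriv_contact_form[OF \<eta>s H assms(4) that])
  have \<rho>_eq: "contact_vol n \<theta> (ext_deriv M \<theta>) p vs = \<rho> p * contact_vol n \<eta> (ext_deriv M \<eta>) p vs"
    if "p \<in> points M" "vs \<in> tangent_lists M p (2 * n + 1)" for p vs
    using assms(9) that unfolding \<theta>_def contact_vol_pullback[OF \<eta>s that] form_eq_def form_scale_def assms(7)
    by blast
  have \<rho>_nz: "\<rho> p \<noteq> 0" if "p \<in> points M" for p
    using pullback_vol_nonzero[OF \<Phi>(2) \<eta> that] assms(9) that
    unfolding form_eq_def form_scale_def assms(7) by force
  have \<rho>s: "smooth_fun_on M (points M) \<rho>"
    by (rule contact_vol_ratio(1)[OF \<theta>s \<eta> dim X b as L\<theta> L\<eta> \<rho>_eq])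
  have X\<rho>: "vf_app M X \<rho> p = (real n + 1) * (a p - b p) * \<rho> p" if "p \<in> points M" for p
    by (rule contact_vol_ratio(2)[OF \<theta>s \<eta> dim X b as L\<theta> L\<eta> \<rho>_eq that])
  define g where "g p = \<bar>\<rho> p\<bar> powr (- 1 / N)" for p
  have gs: "smooth_fun_on M (points M) g"
    unfolding g_def by (rule smooth_fun_abs_powr[OF \<rho>s \<rho>_nz])
  \<comment> \<open>The exponent \<open>- 1 / N\<close> cancels the weight \<open>N = n + 1\<close>
    in the derivative of \<open>\<rho>\<close>.\<close>
  have Xg: "vf_app M X g p = (b p - a p) * g p" if p: "p \<in> points M" for p
  proof -
    have "g = (\<lambda>p. \<bar>\<rho> p\<bar> powr (- 1 / N))" by (simp add: g_def fun_eq_iff)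
    then have "vf_app M X g p = (- 1 / N * g p / \<rho> p) * (N * (a p - b p) * \<rho> p)"
      using vf_app_compose[OF X \<rho>s p DERIV_abs_powr[OF \<rho>_nz[OF p], of "- 1 / N"]]
        X\<rho>[OF p, folded N_def] by simp
    also have "\<dots> = (b p - a p) * g p"
      using N(1) \<rho>_nz[OF p] by (simp add: field_simps)
    finally show ?thesis .
  qed
  have \<beta>: "\<beta> = form_scale g \<theta>" unfolding assms(10) g_def[abs_def] \<theta>_def N ..
  have \<beta>s: "smooth_form M 1 \<beta>" unfolding \<beta> by (rule smooth_form_scale(1)[OF \<theta>s gs])
  \<comment> \<open>By the product rule, \<open>(b - a) g\<close> from the factor and
    \<open>- b g\<close> from the pullback add up to \<open>- a g\<close>.\<close>
  have L\<beta>: "lie_deriv M X \<beta> p [v] = - a p * \<beta> p [v]" if "p \<in> points M" "v \<in> tangent_space M p" for p v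
    unfolding \<beta> lie_deriv_scale[OF \<theta>s gs X that] Xg[OF that(1)] L\<theta>[OF that]
    by (simp add: form_scale_def algebra_simps)
  have L\<beta>': "form_eq M 1 (lie_deriv M X \<beta>) (form_scale (\<lambda>p. - a p) \<beta>)"
    unfolding form_eq_def
  proof (intro ballI)
    fix p vs assume p: "p \<in> points M" and vs: "vs \<in> tangent_lists M p 1"
    then obtain v where "vs = [v]" "v \<in> tangent_space M p" by (auto simp: tangent_lists_def length_Suc_conv)
    then show "lie_deriv M X \<beta> p vs = form_scale (\<lambda>p. - a p) \<beta> p vs"
      using L\<beta>[OF p] by (simp add: form_scale_def)
  qed
  \<comment> \<open>The denominator of \<open>J\<close> is the reciprocal of the factor in
    \<open>\<beta>\<close>, so \<open>J\<close> is a contraction and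
    \<open>vf_app_contraction\<close> applies.\<close>
  have J: "J = (\<lambda>p. - \<beta> p [X p])"
    unfolding assms(8,11) \<beta> g_def form_scale_def \<theta>_def N
    by (simp add: powr_minus divide_inverse mult.commute)
  have Js: "smooth_fun_on M (points M) J"
    unfolding J by (intro smooth_fun_minus smooth_contraction(1)[OF \<beta>s X])
  have XJ: "vf_app M X J p = - a p * J p" if p: "p \<in> points M" for p
    unfolding J vf_app_compose[OF X smooth_contraction(1)[OF \<beta>s X] p DERIV_minus[OF DERIV_ident]]
      vf_app_contraction[OF \<beta>s X p] L\<beta>[OF p vector_field_in[OF X p]] by simp
  \<comment> \<open>The argument for \<open>J\<close> with \<open>\<eta>\<close> in place of
    \<open>\<beta>\<close>, since \<open>H = - \<eta>(X)\<close>.\<close>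
  have XH: "vf_app M X H p = - a p * H p" if p: "p \<in> points M" for p
  proof -
    define c where "c = some_chart M p"
    have c: "c \<in> charts_at M p" unfolding c_def by (rule some_chart_in[OF p])
    from vf_app_has_derivative[OF X c hamiltonian_contraction_has_derivative[where \<eta> = \<eta> and X = X, OF H \<eta>X c]] show ?thesis
      using vf_app_has_derivative[OF X c smooth_fun_has_derivative[OF H c]]
        vf_app_contraction[OF \<eta>s X p] L\<eta>[OF p vector_field_in[OF X p]] \<eta>X[OF p] by simp
  qed
  have I: "I = (\<lambda>p. J p / H p)"
    unfolding assms(11,12) by (simp add: mult.commute)
  have Is: "smooth_fun_on M {p \<in> points M. H p \<noteq> 0} I"
    unfolding I by (rule smooth_fun_divide_on[OF Js H])
  \<comment> \<open>\<open>J\<close> and \<open>H\<close> decay at the same rate \<open>a\<close>,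
    so the numerator in the quotient rule is 0.\<close>
  have XI: "vf_app M X I p = 0" if "p \<in> points M" "H p \<noteq> 0" for p
    unfolding I vf_app_divide[OF X that Js H] XJ[OF that(1)] XH[OF that(1)] by simp
  show ?thesis
    using \<rho>_nz \<beta>s L\<beta>' Js XJ Is XI pencil_coeffs_exist[OF \<eta> \<beta>s dim]
      pencil_coeffs_conserved[OF \<eta> \<beta>s dim X as L\<eta> L\<beta>] by blast
qed

end
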